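(* Let $1\le N\le M$ be integers. Let $V:\mathbb{C}\setminus\{0\}\to\mathbb{C}$ be a Laurent polynomial of the form $V(z)=\sum_{j=0}^p(a_jz^j+\overline{a_j}z^{-j})$, let $w_1,\dots,w_k$ be distinct points on the unit circle with $0\le\arg(w_1)<\dots<\arg(w_k)<2\pi$, let $\beta_j>0$ for $j=1,\dots,k$, and for $|z|=1$ let $$f(z)=e^{V(z)}\prod_{j=1}^k|z-w_j|^{\beta_j};$$ write $f$ also for the analytic continuation described in the context. Let $\epsilon\in(0,1)$, and let $\Gamma_j$, $v$, $\sigma$, $I$, $K_{CD}$ and $\oplus_{j=1}^kL^2(\Gamma_j,\sigma)$ be as in the context. Then $$T_{N-1}(f)=\mathcal{T}_{N-1}(f)\,\det(1+K)_{\oplus_{j=1}^kL^2(\Gamma_j,\sigma)},$$ where the determinant on the right is a Fredholm determinant and $K$ is the trace class integral operator on $\oplus_{j=1}^kL^2(\Gamma_j,\sigma)$ given by $(Kh)(w)=\sum_{j=1}^k\int_{\Gamma_j}K(z,w)h_j(z)\,\sigma(dz)$ (the $l$-th component of $Kh$ being this function for $w\in\Gamma_l$) with kernel $$K(z,w)=I(z)\sqrt{v(z)f(z)}\,\sqrt{v(w)f(w)}\,K_{CD}(z,w),$$ where the roots are according to the principal branch, and for a variable on $\Gamma_j$ the value of $f$ is the limit from the inside of $\Gamma_j$.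
   Context: Toeplitz determinants: $$T_{N-1}(f)=\det\Big(\frac1M\sum_{z:\,z^M=1}z^{-(l-m)}f(z)\Big)_{l,m=0}^{N-1},\qquad \mathcal{T}_{N-1}(f)=\det\Big(\int_0^{2\pi}e^{-i(l-m)\theta}f(e^{i\theta})\frac{d\theta}{2\pi}\Big)_{l,m=0}^{N-1}.$$ Analytic continuation of $f$: on $\mathbb{C}\setminus\big(\{0\}\cup\bigcup_j\{rw_j:r>0\}\big)$, $f(z)=e^{V(z)}\prod_{j=1}^k(1-z/w_j)^{\beta_j/2}(1-w_j/z)^{\beta_j/2}$ with principal branches of the powers; this agrees with the original $f$ on the unit circle. Orthonormal polynomials: $\phi_j(z)=\chi_jz^j+\mathcal{O}(z^{j-1})$, $\chi_j\ne0$ real, with $\int_0^{2\pi}\phi_j(e^{i\theta})\overline{\phi_l(e^{i\theta})}f(e^{i\theta})\frac{d\theta}{2\pi}=\delta_{j,l}$; $\overline{\phi}_j(z)=\overline{\phi_j(\overline z)}$ is the polynomial with complex conjugated coefficients. Contours: put $w_{k+1}=w_1$ and $\arg w_{k+1}=\arg w_1+2\pi$. $\Gamma_j$ is the boundary, oriented counter-clockwise, of the annular sector $\{re^{i\theta}:1-\epsilon<r<1+\epsilon,\ \arg w_j<\theta<\arg w_{j+1}\}$; thus it consists of the segments $\{rw_j\}$ and $\{rw_{j+1}\}$, $r\in(1-\epsilon,1+\epsilon)$, and the two arcs of radius $1\pm\epsilon$ joining $(1\pm\epsilon)w_j$ to $(1\pm\epsilon)w_{j+1}$. (If $k=1$,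 the two sides of the slit along the ray through $w_1$ are regarded as distinct parts of $\Gamma_1$.) $$v(z)=\begin{cases}-\dfrac{z^M}{1-z^M},&|z|<1\\[2mm] \dfrac{z^{-M}}{1-z^{-M}},&|z|>1\end{cases},\qquad \sigma(dz)=\begin{cases}\dfrac{dz}{2\pi iz},&|z|=1\pm\epsilon\\[2mm] \dfrac{dz}{2\pi z},&|z|\in(1-\epsilon,1+\epsilon)\end{cases},\qquad I(z)=\begin{cases}1,&|z|=1\pm\epsilon\\-i,&|z|\in(1-\epsilon,1+\epsilon)\end{cases}.$$ Here $dz$ is taken along the oriented contours, so $\sigma$ is a real signed measure on each $\Gamma_j$. $\oplus_{j=1}^kL^2(\Gamma_j,\sigma)$ is the space of $h=(h_1,\dots,h_k)$ with $h_j:\Gamma_j\to\mathbb{C}$ square integrable with respect to $\sigma$ (i.e. with respect to its total variation $|\sigma|$). Finally $$K_{CD}(z,w)=\frac{\frac{w^N}{z^N}\phi_N(z)\overline{\phi}_N(w^{-1})-\overline{\phi}_N(z^{-1})\phi_N(w)}{1-\frac wz},$$ extended by continuity to $z=w$. *)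

theory Defs
  imports "HOL-Analysis.Analysis" "Jordan_Normal_Form.Determinant"
begin

section \<open>Square integrable functions, trace class operators, Fredholm determinants\<close>

text \<open>Elements of \<open>L\<^sup>2(\<mu>)\<close> are handled through representatives: equality in \<open>L\<^sup>2(\<mu>)\<close>
  is equality almost everywhere, that is, vanishing of the norm of the difference.\<close>

definition L2_space :: "'a measure \<Rightarrow> ('a \<Rightarrow> complex) set" where
  "L2_space \<mu> = {h \<in> borel_measurable \<mu>. integrable \<mu> (\<lambda>x. (cmod (h x))\<^sup>2)}"

definition L2_inner :: "'a measure \<Rightarrow> ('a \<Rightarrow> complex) \<Rightarrow> ('a \<Rightarrow> complex) \<Rightarrow> complex" where
  "L2_inner \<mu> g h = (LINT x|\<mu>. cnj (g x) * h x)"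

definition L2_norm :: "'a measure \<Rightarrow> ('a \<Rightarrow> complex) \<Rightarrow> real" where
  "L2_norm \<mu> h = sqrt (LINT x|\<mu>. (cmod (h x))\<^sup>2)"

text \<open>Trace class operators on a Hilbert space are the nuclear ones:
  \<open>A = \<Sum>\<^sub>n \<langle>u\<^sub>n, \<cdot>\<rangle> v\<^sub>n\<close> with \<open>\<Sum>\<^sub>n \<parallel>u\<^sub>n\<parallel> \<parallel>v\<^sub>n\<parallel> < \<infinity>\<close>.\<close>

definition trace_class_on :: "'a measure \<Rightarrow> (('a \<Rightarrow> complex) \<Rightarrow> 'a \<Rightarrow> complex) \<Rightarrow> bool" where
  "trace_class_on \<mu> A \<longleftrightarrow>
     (\<forall>h\<in>L2_space \<mu>. A h \<in> L2_space \<mu>) \<and>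
     (\<exists>u v. (\<forall>n::nat. u n \<in> L2_space \<mu> \<and> v n \<in> L2_space \<mu>) \<and>
        summable (\<lambda>n. L2_norm \<mu> (u n) * L2_norm \<mu> (v n)) \<and>
        (\<forall>h\<in>L2_space \<mu>.
           (\<lambda>n. L2_norm \<mu> (\<lambda>x. A h x - (\<Sum>i<n. L2_inner \<mu> (u i) h * v i x)))
             \<longlonglongrightarrow> 0))"

text \<open>The Fredholm series
  \<open>\<Sum>\<^sub>n 1/n! \<integral> \<dots> \<integral> det (K(x\<^sub>i, x\<^sub>j)) \<sigma>(dx\<^sub>1) \<dots> \<sigma>(dx\<^sub>n)\<close>
  of a kernel with respect to the real signed measure \<open>\<sigma> = s \<cdot> \<nu>\<close>.\<close>

definition fredholm_det :: "'a measure \<Rightarrow> ('a \<Rightarrow> real) \<Rightarrow> ('a \<Rightarrow> 'a \<Rightarrow> complex) \<Rightarrow> complex" where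
  "fredholm_det \<nu> s K =
     (\<Sum>n. (LINT x|PiM {..<n} (\<lambda>_. \<nu>).
               Determinant.det (mat n n (\<lambda>(i, j). K (x i) (x j))) * of_real (\<Prod>i<n. s (x i)))
           / fact n)"


section \<open>The symbol and its Toeplitz determinants\<close>

definition laurent_V :: "nat \<Rightarrow> (nat \<Rightarrow> complex) \<Rightarrow> complex \<Rightarrow> complex" where
  "laurent_V p a z = (\<Sum>j\<le>p. a j * z ^ j + cnj (a j) * z powi (- int j))"

definition symbol_circle ::
    "(complex \<Rightarrow> complex) \<Rightarrow> nat \<Rightarrow> (nat \<Rightarrow> complex) \<Rightarrow> (nat \<Rightarrow> real) \<Rightarrow> complex \<Rightarrow> complex" where
  "symbol_circle V k w \<beta> z = exp (V z) * of_real (\<Prod>j=1..k. cmod (z - w j) powr \<beta> j)"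

definition symbol_ext ::
    "(complex \<Rightarrow> complex) \<Rightarrow> nat \<Rightarrow> (nat \<Rightarrow> complex) \<Rightarrow> (nat \<Rightarrow> real) \<Rightarrow> complex \<Rightarrow> complex" where
  "symbol_ext V k w \<beta> z =
     exp (V z) * (\<Prod>j=1..k. (1 - z / w j) powr of_real (\<beta> j / 2)
                            * (1 - w j / z) powr of_real (\<beta> j / 2))"

text \<open>Both determinants have size \<open>n + 1\<close>, with indices running from \<open>0\<close> to \<open>n\<close>.\<close>

definition toeplitz_discrete :: "nat \<Rightarrow> nat \<Rightarrow> (complex \<Rightarrow> complex) \<Rightarrow> complex" where
  "toeplitz_discrete M n f =
     Determinant.det (mat (n + 1) (n + 1) (\<lambda>(l, m).
       (\<Sum>z | z ^ M = 1. z powi (- (int l - int m)) * f z) / of_nat M))"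

definition toeplitz :: "nat \<Rightarrow> (complex \<Rightarrow> complex) \<Rightarrow> complex" where
  "toeplitz n f =
     Determinant.det (mat (n + 1) (n + 1) (\<lambda>(l, m).
       integral {0..2*pi} (\<lambda>\<theta>. cis (- (real l - real m) * \<theta>) * f (cis \<theta>)) / of_real (2 * pi)))"

definition orthonormal_polys :: "(complex \<Rightarrow> complex) \<Rightarrow> (nat \<Rightarrow> complex poly) \<Rightarrow> bool" where
  "orthonormal_polys f \<phi> \<longleftrightarrow>
     (\<forall>j. degree (\<phi> j) = j \<and> lead_coeff (\<phi> j) \<noteq> 0 \<and> lead_coeff (\<phi> j) \<in> \<real>) \<and>
     (\<forall>j l. integral {0..2*pi}
               (\<lambda>\<theta>. poly (\<phi> j) (cis \<theta>) * cnj (poly (\<phi> l) (cis \<theta>)) * f (cis \<theta>)) / of_real (2 * pi)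
            = (if j = l then 1 else 0))"


section \<open>The contours\<close>

text \<open>In polar coordinates \<open>(r, \<theta>)\<close> the contour \<open>\<Gamma>\<^sub>j\<close> is the boundary of the rectangle
  \<open>sector\<close> below. The map \<open>(r, \<theta>) \<mapsto> r e\<^sup>i\<^sup>\<theta>\<close> preserves orientation, so the edges,
  traversed counter-clockwise in the \<open>(r, \<theta>)\<close> plane, are: the ray through \<open>w\<^sub>j\<close> outwards,
  the outer arc, the ray through \<open>w\<^sub>j\<^sub>+\<^sub>1\<close> inwards, the inner arc backwards. Working with polar
  coordinates keeps the two sides of the slit apart when \<open>k = 1\<close>.

  A point of the disjoint union of the \<open>\<Gamma>\<^sub>j\<close> is encoded as \<open>(j, e, t)\<close> with \<open>e\<close> an edge and
  \<open>t \<in> (0, 1)\<close> the parameter along it; only the four corners of each \<open>\<Gamma>\<^sub>j\<close> are left out.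
  A tuple \<open>(h\<^sub>1, \<dots>, h\<^sub>k)\<close> of functions on the \<open>\<Gamma>\<^sub>j\<close> thus is one function
  on these triples.\<close>

datatype edge = Ray_Start | Outer_Arc | Ray_End | Inner_Arc

type_synonym cpoint = "nat \<times> edge \<times> real"

definition angle :: "nat \<Rightarrow> (nat \<Rightarrow> complex) \<Rightarrow> nat \<Rightarrow> real" where
  "angle k w j = (if j = k + 1 then Arg2pi (w 1) + 2 * pi else Arg2pi (w j))"

definition sector :: "real \<Rightarrow> nat \<Rightarrow> (nat \<Rightarrow> complex) \<Rightarrow> nat \<Rightarrow> (real \<times> real) set" where
  "sector \<epsilon> k w j = {1 - \<epsilon><..<1 + \<epsilon>} \<times> {angle k w j<..<angle k w (j + 1)}"

fun polar_path ::
    "real \<Rightarrow> nat \<Rightarrow> (nat \<Rightarrow> complex) \<Rightarrow> nat \<Rightarrow> edge \<Rightarrow> real \<Rightarrow> real \<times> real" where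
  "polar_path \<epsilon> k w j Ray_Start =
     linepath (1 - \<epsilon>, angle k w j) (1 + \<epsilon>, angle k w j)"
| "polar_path \<epsilon> k w j Outer_Arc =
     linepath (1 + \<epsilon>, angle k w j) (1 + \<epsilon>, angle k w (j + 1))"
| "polar_path \<epsilon> k w j Ray_End =
     linepath (1 + \<epsilon>, angle k w (j + 1)) (1 - \<epsilon>, angle k w (j + 1))"
| "polar_path \<epsilon> k w j Inner_Arc =
     linepath (1 - \<epsilon>, angle k w (j + 1)) (1 - \<epsilon>, angle k w j)"

definition contour_path ::
    "real \<Rightarrow> nat \<Rightarrow> (nat \<Rightarrow> complex) \<Rightarrow> nat \<Rightarrow> edge \<Rightarrow> real \<Rightarrow> complex" where
  "contour_path \<epsilon> k w j e t = (case polar_path \<epsilon> k w j e t of (r, \<theta>) \<Rightarrow> rcis r \<theta>)"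

definition cpt :: "real \<Rightarrow> nat \<Rightarrow> (nat \<Rightarrow> complex) \<Rightarrow> cpoint \<Rightarrow> complex" where
  "cpt \<epsilon> k w x = (case x of (j, e, t) \<Rightarrow> contour_path \<epsilon> k w j e t)"

text \<open>The parameter space of the disjoint union of the \<open>\<Gamma>\<^sub>j\<close>, with Lebesgue measure
  in \<open>t\<close>; \<open>\<sigma>\<close> has density \<open>sigma_density\<close> with respect to it. The quotients in the
  definition of \<open>sigma_density\<close> are real.\<close>

definition param_measure :: "nat \<Rightarrow> cpoint measure" where
  "param_measure k =
     count_space {1..k} \<Otimes>\<^sub>M (count_space UNIV \<Otimes>\<^sub>M restrict_space lborel {0<..<1})"

definition sigma_density :: "real \<Rightarrow> nat \<Rightarrow> (nat \<Rightarrow> complex) \<Rightarrow> cpoint \<Rightarrow> real" where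
  "sigma_density \<epsilon> k w x = (case x of (j, e, t) \<Rightarrow>
     let z = contour_path \<epsilon> k w j e t;
         dz = vector_derivative (contour_path \<epsilon> k w j e) (at t)
     in Re (if cmod z = 1 + \<epsilon> \<or> cmod z = 1 - \<epsilon>
            then dz / (2 * of_real pi * \<i> * z) else dz / (2 * of_real pi * z)))"

text \<open>The total variation \<open>|\<sigma>|\<close>; \<open>L2_space (sigma_var \<epsilon> k w)\<close> is the direct sum of
  the \<open>L\<^sup>2(\<Gamma>\<^sub>j, \<sigma>)\<close>.\<close>

definition sigma_var :: "real \<Rightarrow> nat \<Rightarrow> (nat \<Rightarrow> complex) \<Rightarrow> cpoint measure" where
  "sigma_var \<epsilon> k w = density (param_measure k) (\<lambda>x. ennreal \<bar>sigma_density \<epsilon> k w x\<bar>)"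

definition sigma_integral ::
    "real \<Rightarrow> nat \<Rightarrow> (nat \<Rightarrow> complex) \<Rightarrow> nat \<Rightarrow> (cpoint \<Rightarrow> complex) \<Rightarrow> complex" where
  "sigma_integral \<epsilon> k w j g =
     (\<Sum>e\<in>{Ray_Start, Outer_Arc, Ray_End, Inner_Arc}.
        LINT t:{0<..<1}|lborel. g (j, e, t) * of_real (sigma_density \<epsilon> k w (j, e, t)))"


section \<open>The kernel\<close>

text \<open>The value of \<open>v\<close> on the unit circle is irrelevant: \<open>\<Gamma>\<^sub>j\<close> meets the circle
  in two points.\<close>

definition v_fun :: "nat \<Rightarrow> complex \<Rightarrow> complex" where
  "v_fun M z = (if cmod z < 1 then - (z ^ M / (1 - z ^ M))
                else z powi (- int M) / (1 - z powi (- int M)))"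

definition I_fun :: "real \<Rightarrow> complex \<Rightarrow> complex" where
  "I_fun \<epsilon> z = (if cmod z = 1 + \<epsilon> \<or> cmod z = 1 - \<epsilon> then 1 else - \<i>)"

definition inside_limit ::
    "real \<Rightarrow> nat \<Rightarrow> (nat \<Rightarrow> complex) \<Rightarrow> (complex \<Rightarrow> complex) \<Rightarrow> cpoint \<Rightarrow> complex" where
  "inside_limit \<epsilon> k w f x = (case x of (j, e, t) \<Rightarrow>
     Lim (at (polar_path \<epsilon> k w j e t) within sector \<epsilon> k w j) (\<lambda>(r, \<theta>). f (rcis r \<theta>)))"

definition CD_quotient :: "nat \<Rightarrow> complex poly \<Rightarrow> complex \<Rightarrow> complex \<Rightarrow> complex" where
  "CD_quotient N q z w =
     (w ^ N / z ^ N * poly q z * poly (map_poly cnj q) (inverse w)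
        - poly (map_poly cnj q) (inverse z) * poly q w) / (1 - w / z)"

definition K_CD :: "nat \<Rightarrow> complex poly \<Rightarrow> complex \<Rightarrow> complex \<Rightarrow> complex" where
  "K_CD N q z w = (if w = z then Lim (at z) (CD_quotient N q z) else CD_quotient N q z w)"

definition K_kernel ::
    "real \<Rightarrow> nat \<Rightarrow> (nat \<Rightarrow> complex) \<Rightarrow> (complex \<Rightarrow> complex) \<Rightarrow> nat \<Rightarrow> nat \<Rightarrow> complex poly
       \<Rightarrow> cpoint \<Rightarrow> cpoint \<Rightarrow> complex" where
  "K_kernel \<epsilon> k w f M N q x y =
     (let z = cpt \<epsilon> k w x; u = cpt \<epsilon> k w y in
        I_fun \<epsilon> z * csqrt (v_fun M z * inside_limit \<epsilon> k w f x)
          * csqrt (v_fun M u * inside_limit \<epsilon> k w f y) * K_CD N q z u)"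

definition K_operator ::
    "real \<Rightarrow> nat \<Rightarrow> (nat \<Rightarrow> complex) \<Rightarrow> (cpoint \<Rightarrow> cpoint \<Rightarrow> complex)
       \<Rightarrow> (cpoint \<Rightarrow> complex) \<Rightarrow> cpoint \<Rightarrow> complex" where
  "K_operator \<epsilon> k w K h y = (\<Sum>j=1..k. sigma_integral \<epsilon> k w j (\<lambda>x. K x y * h x))"

end

theory Submission
  imports Defs "HOL-Complex_Analysis.Cauchy_Integral_Formula"
begin

text \<open>Both Toeplitz determinants are Gram determinants of the monomials \<open>1, z, \<dots>, z\<^sup>N\<^sup>-\<^sup>1\<close>: one for the
  measure \<open>f d\<theta> / 2\<pi>\<close> on the circle, the other for the measure with mass \<open>f(\<rho>) / M\<close> at each \<open>M\<close>-th
  root of unity \<open>\<rho>\<close>. Replacing the monomials by \<open>\<phi>\<^sub>0, \<dots>, \<phi>\<^sub>N\<^sub>-\<^sub>1\<close> multiplies both by the same factor and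
  makes the first Gram matrix the identity. The quotient of the two determinants is therefore the
  determinant of the discrete Gram matrix of \<open>\<phi>\<^sub>0, \<dots>, \<phi>\<^sub>N\<^sub>-\<^sub>1\<close> (\<open>det_moments_eq\<close>).

  On the other side, the Christoffel--Darboux formula turns \<open>K\<^sub>C\<^sub>D\<close> into a sum of \<open>N\<close> products, so that
  \<open>K(x, y) = \<Sum>\<^sub>m A\<^sub>m(x) B\<^sub>m(y)\<close> has rank at most \<open>N\<close>. Such an operator is trace class
  (\<open>finite_rank_trace_class\<close>), and its Fredholm series is the determinant of the \<open>N \<times> N\<close> matrix
  \<open>\<delta>\<^sub>m\<^sub>l + \<integral> A\<^sub>m B\<^sub>l d\<sigma>\<close> (\<open>fredholm_det_finite_rank\<close>). This matrix is the discrete Gram matrix because of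
  the contour formula
    \<open>1/M \<Sum>\<^sub>\<rho> g(\<rho>) f(\<rho>) = \<integral> g f d\<theta> / 2\<pi> + \<Sum>\<^sub>j \<integral>\<^sub>\<Gamma>\<^sub>j g v f dz / (2\<pi>\<i> z)\<close>
  for Laurent polynomials \<open>g\<close> (\<open>contour_formula\<close>). Off the unit circle \<open>v\<close> equals
  \<open>z\<^sup>M / (z\<^sup>M - 1)\<close> for \<open>|z| < 1\<close> and \<open>z\<^sup>M / (z\<^sup>M - 1) - 1\<close> for \<open>|z| > 1\<close>. The quotient is
  \<open>1/M \<Sum>\<^sub>\<rho> z / (z - \<rho>)\<close>, whose residues give the discrete mean; the constant \<open>-1\<close> contributes an integral
  over the outer part of \<open>\<Gamma>\<^sub>j\<close>, which contracts to the arc of the circle.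

  A root of unity may coincide with some \<open>w\<^sub>j\<close> and then lies on the contour. Since \<open>f\<close> decays like
  \<open>|z - w\<^sub>j|\<close> to the power \<open>\<beta>\<^sub>j > 0\<close>, the integrals still converge absolutely, but in general the
  integrand has no continuous extension to the closed sector. In the coordinate \<open>\<zeta>\<close> with \<open>z = exp \<zeta>\<close>, where sectors are
  rectangles, all pole terms have the form \<open>- \<i> exp (x / 2) / S(x)\<close> with \<open>S(x) = - 2 \<i> sinh (x / 2)\<close> and
  \<open>x = \<zeta> - \<i> \<alpha>\<close>. The real part of \<open>S\<close> is nonnegative for \<open>0 \<le> Im x \<le> 2\<pi>\<close>. If \<open>\<rho>\<close> does
  not lie on the open arc, its argument \<open>\<alpha>\<close> can be chosen such that the rectangle lies in this range, and
  \<open>S\<close> can be replaced by \<open>S + \<delta>\<close> with \<open>\<delta> > 0\<close>: there are no poles left, Cauchy's theorem applies, and the modulus of the integrand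
  does not grow, so that dominated convergence gives the result for \<open>\<delta> \<rightarrow> 0\<close>
  (\<open>edge_integral_pole_outside\<close>). The same function describes the symbol: each pair of factors
  \<open>(1 - z / w)\<close> and \<open>(1 - w / z)\<close> with exponent \<open>\<beta> / 2\<close> is the single principal power of \<open>S\<close> with exponent
  \<open>\<beta>\<close> (\<open>powr_factor_half_sine\<close>). This expression is continuous on the closed strip between two
  consecutive angles, and it supplies the limits of \<open>f\<close> from the inside of \<open>\<Gamma>\<^sub>j\<close>.\<close>

section \<open>Fredholm determinants of finite rank kernels\<close>

text \<open>The Leibniz sum over the permutations of the index set itself: minors of one matrix for
  different subsets are compared without renumbering indices.\<close>

definition principal_minor :: "('a \<Rightarrow> 'a \<Rightarrow> complex) \<Rightarrow> 'a set \<Rightarrow> complex" where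
  "principal_minor G S = (\<Sum>p | p permutes S. of_int (sign p) * (\<Prod>i\<in>S. G i (p i)))"

text \<open>Multiplying out the Leibniz products selects a set \<open>S\<close> of rows in which the entry of \<open>G\<close> is
  taken. The Kronecker deltas of the other rows leave only the permutations that fix every index
  outside \<open>S\<close>, and these are the permutations of \<open>S\<close>.\<close>

lemma det_one_plus_principal_minors:
  "Determinant.det (mat N N (\<lambda>(i, j). (if i = j then 1 else 0) + G i j))
     = (\<Sum>S\<in>Pow {..<N}. principal_minor G S)"
proof -
  let ?U = "{..<N}"
  let ?d = "\<lambda>i j. (if i = j then 1 else 0) :: complex"
  have "Determinant.det (mat N N (\<lambda>(i, j). ?d i j + G i j))
      = (\<Sum>p | p permutes ?U. of_int (sign p) * (\<Prod>i\<in>?U. G i (p i) + ?d i (p i)))"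
    by (subst det_def'[of _ N])
       (auto simp: atLeast0LessThan add.commute intro!: sum.cong prod.cong dest: permutes_in_image)
  also have "\<dots> = (\<Sum>p | p permutes ?U. \<Sum>S\<in>Pow ?U.
                   of_int (sign p) * ((\<Prod>i\<in>S. G i (p i)) * (\<Prod>i\<in>?U - S. ?d i (p i))))"
    by (simp add: prod_add sum_distrib_left)
  also have "\<dots> = (\<Sum>S\<in>Pow ?U. \<Sum>p | p permutes ?U.
                   of_int (sign p) * ((\<Prod>i\<in>S. G i (p i)) * (\<Prod>i\<in>?U - S. ?d i (p i))))"
    by (rule sum.swap)
  also have "\<dots> = (\<Sum>S\<in>Pow ?U. principal_minor G S)"
  proof (rule sum.cong[OF refl])
    fix S assume S: "S \<in> Pow ?U"
    have *: "(\<Prod>i\<in>?U - S. ?d i (p i)) = (if p permutes S then 1 else 0)" if "p permutes ?U" for p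
    proof (cases "p permutes S")
      case True
      then show ?thesis by (auto intro!: prod.neutral simp: permutes_not_in)
    next
      case False
      then have "\<not> (\<forall>i\<in>?U - S. p i = i)"
        using permutes_superset[OF that, of S] by blast
      then obtain i where "i \<in> ?U - S" "p i \<noteq> i" by blast
      then show ?thesis using False by (auto intro!: prod_zero bexI[of _ i])
    qed
    have "(\<Sum>p | p permutes ?U.
             of_int (sign p) * ((\<Prod>i\<in>S. G i (p i)) * (\<Prod>i\<in>?U - S. ?d i (p i))))
        = (\<Sum>p | p permutes ?U. if p permutes S then of_int (sign p) * (\<Prod>i\<in>S. G i (p i)) else 0)"
      by (intro sum.cong refl) (simp add: *)
    also have "\<dots> = (\<Sum>p | p permutes S. of_int (sign p) * (\<Prod>i\<in>S. G i (p i)))"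
      using S by (intro sum.mono_neutral_cong_right)
        (auto simp: finite_permutations intro: permutes_subset)
    finally show "(\<Sum>p | p permutes ?U.
             of_int (sign p) * ((\<Prod>i\<in>S. G i (p i)) * (\<Prod>i\<in>?U - S. ?d i (p i)))) = principal_minor G S"
      by (simp add: principal_minor_def)
  qed
  finally show ?thesis .
qed

lemma principal_minor_image:
  assumes f: "inj_on f A" and A: "finite A"
  shows "principal_minor G (f ` A) = principal_minor (\<lambda>i j. G (f i) (f j)) A"
proof -
  have bij: "bij_betw f A (f ` A)"
    using f by (rule inj_on_imp_bij_betw)
  have eq: "(\<lambda>x. if x \<in> f ` A then f (\<pi> (inv_into A f x)) else x) = map_permutation A f \<pi>" for \<pi>
    by (auto simp: map_permutation_def restrict_id_def)
  have b: "bij_betw (map_permutation A f) {p. p permutes A} {p. p permutes f ` A}"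
    using bij_betw_permutations[OF bij] unfolding eq .
  have "principal_minor G (f ` A)
      = (\<Sum>p | p permutes A. of_int (sign (map_permutation A f p)) *
            (\<Prod>i\<in>f ` A. G i (map_permutation A f p i)))"
    unfolding principal_minor_def by (rule sum.reindex_bij_betw[OF b, symmetric])
  also have "\<dots> = (\<Sum>p | p permutes A. of_int (sign p) * (\<Prod>i\<in>A. G (f i) (f (p i))))"
  proof (rule sum.cong[OF refl])
    fix p assume "p \<in> {p. p permutes A}"
    then show "of_int (sign (map_permutation A f p)) * (\<Prod>i\<in>f ` A. G i (map_permutation A f p i))
         = of_int (sign p) * (\<Prod>i\<in>A. G (f i) (f (p i)))"
      using f A by (simp add: sign_map_permutation prod.reindex map_permutation_apply)
  qed
  finally show ?thesis by (simp add: principal_minor_def)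
qed

lemma principal_minor_eq_det:
  fixes n :: nat shows
  "principal_minor G {..<n} = Determinant.det (mat n n (\<lambda>(i, j). G i j))"
  unfolding principal_minor_def
  by (subst det_def'[of _ n])
     (auto simp: atLeast0LessThan intro!: sum.cong prod.cong dest: permutes_in_image)

lemma principal_minor_not_inj:
  fixes n :: nat
  assumes "\<not> inj_on g {..<n}"
  shows "principal_minor (\<lambda>i j. G (g i) (g j)) {..<n} = 0"
proof -
  from assms obtain i j where "i < n" "j < n" "i \<noteq> j" "g i = g j"
    by (auto simp: inj_on_def)
  note ij = this
  let ?A = "mat n n (\<lambda>(i, j). G (g i) (g j))"
  have "row ?A i = row ?A j"
    using ij by (intro eq_vecI) simp_all
  then have "Determinant.det ?A = 0"
    using ij det_identical_rows[of ?A n i j] by simp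
  then show ?thesis by (simp only: principal_minor_eq_det)
qed

text \<open>A tuple with a repetition produces two equal rows, and every set of size \<open>n\<close> is the image of
  exactly \<open>n!\<close> injective tuples.\<close>

lemma sum_tuples_principal_minor:
  fixes n N :: nat
  shows "(\<Sum>g\<in>{..<n} \<rightarrow>\<^sub>E {..<N}. principal_minor (\<lambda>i j. G (g i) (g j)) {..<n})
     = fact n * (\<Sum>S\<in>{S\<in>Pow {..<N}. card S = n}. principal_minor G S)"
proof -
  let ?I = "{g \<in> {..<n} \<rightarrow>\<^sub>E {..<N}. inj_on g {..<n}}"
  let ?P = "{S\<in>Pow {..<N}. card S = n}"
  have finE: "finite ({..<n} \<rightarrow>\<^sub>E {..<N})" by (simp add: finite_PiE)
  then have finI: "finite ?I" by simp
  have "(\<Sum>g\<in>{..<n} \<rightarrow>\<^sub>E {..<N}. principal_minor (\<lambda>i j. G (g i) (g j)) {..<n})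
      = (\<Sum>g\<in>?I. principal_minor (\<lambda>i j. G (g i) (g j)) {..<n})"
  proof (rule sum.mono_neutral_right[OF finE])
    show "\<forall>g\<in>({..<n} \<rightarrow>\<^sub>E {..<N}) - ?I. principal_minor (\<lambda>i j. G (g i) (g j)) {..<n} = 0"
    proof
      fix g assume "g \<in> ({..<n} \<rightarrow>\<^sub>E {..<N}) - ?I"
      then have "\<not> inj_on g {..<n}" by simp
      then show "principal_minor (\<lambda>i j. G (g i) (g j)) {..<n} = 0"
        by (rule principal_minor_not_inj[where G = G and g = g])
    qed
  qed auto
  also have "\<dots> = (\<Sum>g\<in>?I. principal_minor G (g ` {..<n}))"
  proof (rule sum.cong[OF refl])
    fix g assume "g \<in> ?I"
    then have "principal_minor G (g ` {..<n}) = principal_minor (\<lambda>i j. G (g i) (g j)) {..<n}"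
      by (intro principal_minor_image[where G = G and f = g]) simp_all
    then show "principal_minor (\<lambda>i j. G (g i) (g j)) {..<n} = principal_minor G (g ` {..<n})" ..
  qed
  also have "\<dots> = (\<Sum>S\<in>?P. \<Sum>g\<in>{g\<in>?I. g ` {..<n} = S}. principal_minor G (g ` {..<n}))"
  proof -
    have "g ` {..<n} \<in> ?P" if "g \<in> ?I" for g
    proof -
      have "card (g ` {..<n}) = n" using that card_image[of g "{..<n}"] by simp
      moreover have "g ` {..<n} \<subseteq> {..<N}" using that by (auto simp: PiE_iff)
      ultimately show ?thesis by simp
    qed
    then have "(\<lambda>g. g ` {..<n}) ` ?I \<subseteq> ?P" by blast
    moreover have "finite ?P" by simp
    ultimately show ?thesis
      using sum.group[of ?I ?P "\<lambda>g. g ` {..<n}" "\<lambda>g. principal_minor G (g ` {..<n})"] finI by metis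
  qed
  also have "\<dots> = (\<Sum>S\<in>?P. fact n * principal_minor G S)"
  proof (rule sum.cong[OF refl])
    fix S assume S: "S \<in> ?P"
    then have fin: "finite S" by (auto intro: finite_subset)
    have "{g\<in>?I. g ` {..<n} = S} = {g \<in> {..<n} \<rightarrow>\<^sub>E S. inj_on g {..<n}}"
    proof (intro equalityI subsetI)
      fix g assume g: "g \<in> {g \<in> {..<n} \<rightarrow>\<^sub>E S. inj_on g {..<n}}"
      then have "g ` {..<n} \<subseteq> S" "card (g ` {..<n}) = card S"
        using S by (auto simp: card_image)
      then have "g ` {..<n} = S" using fin by (intro card_subset_eq) auto
      then show "g \<in> {g\<in>?I. g ` {..<n} = S}" using g S by (auto simp: PiE_iff)
    qed (auto simp: PiE_iff)
    moreover have "card {g \<in> {..<n} \<rightarrow>\<^sub>E S. inj_on g {..<n}} = fact n"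
      using card_inj_on_subset_funcset[of "{..<n}" S "{..<n}"] fin S
      by (simp add: fact_prod_rev)
    ultimately have "card {g\<in>?I. g ` {..<n} = S} = fact n" by simp
    moreover have "(\<Sum>g\<in>{g\<in>?I. g ` {..<n} = S}. principal_minor G (g ` {..<n}))
        = (\<Sum>g\<in>{g\<in>?I. g ` {..<n} = S}. principal_minor G S)"
      by (rule sum.cong) auto
    ultimately show "(\<Sum>g\<in>{g\<in>?I. g ` {..<n} = S}. principal_minor G (g ` {..<n}))
        = fact n * principal_minor G S" by simp
  qed
  finally show ?thesis by (simp add: sum_distrib_left)
qed

text \<open>Once every entry \<open>K(x\<^sub>i, x\<^sub>p\<^sub>i)\<close> is expanded, the factors containing the variable \<open>x\<^sub>i\<close> are \<open>A\<close> with
  the index chosen at \<open>i\<close> and \<open>B\<close> with the index chosen at the preimage of \<open>i\<close>. So the \<open>n\<close>-fold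
  integral factorizes into entries of the matrix \<open>G\<close> of integrals, and the \<open>n\<close>-th term of the Fredholm series
  becomes the sum of the principal minors of \<open>G\<close> of size \<open>n\<close>.\<close>

lemma fredholm_det_finite_rank:
  fixes A B :: "nat \<Rightarrow> 'a \<Rightarrow> complex" and s :: "'a \<Rightarrow> real"
  assumes "sigma_finite_measure \<nu>"
    and K: "\<And>x y. x \<in> space \<nu> \<Longrightarrow> y \<in> space \<nu> \<Longrightarrow> K x y = (\<Sum>m<N. A m x * B m y)"
    and int: "\<And>m l. m < N \<Longrightarrow> l < N \<Longrightarrow> integrable \<nu> (\<lambda>x. A m x * B l x * of_real (s x))"
  shows "fredholm_det \<nu> s K
     = Determinant.det (mat N N (\<lambda>(m, l). (if m = l then 1 else 0)
          + (LINT x|\<nu>. A m x * B l x * of_real (s x))))"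
proof -
  interpret sigma_finite_measure \<nu> by fact
  interpret product_sigma_finite "\<lambda>_::nat. \<nu>" ..
  define G where "G m l = (LINT x|\<nu>. A m x * B l x * of_real (s x))" for m l
  have trace: "(LINT x|PiM {..<n} (\<lambda>_. \<nu>).
               Determinant.det (mat n n (\<lambda>(i, j). K (x i) (x j))) * of_real (\<Prod>i<n. s (x i)))
      = fact n * (\<Sum>S\<in>{S\<in>Pow {..<N}. card S = n}. principal_minor G S)" (is "?L = _") for n
  proof -
    let ?E = "{..<n} \<rightarrow>\<^sub>E {..<N}" and ?S = "{p. p permutes {..<n}}"
    have integrand: "Determinant.det (mat n n (\<lambda>(i, j). K (x i) (x j))) * of_real (\<Prod>i<n. s (x i))
        = (\<Sum>p\<in>?S. \<Sum>g\<in>?E. of_int (sign p) *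
             (\<Prod>i<n. A (g i) (x i) * B (g (inv_into UNIV p i)) (x i) * of_real (s (x i))))"
      if x: "x \<in> space (PiM {..<n} (\<lambda>_. \<nu>))" for x
    proof -
      have x: "x i \<in> space \<nu>" if "i < n" for i
        using x that by (auto simp: space_PiM PiE_iff)
      have "Determinant.det (mat n n (\<lambda>(i, j). K (x i) (x j)))
          = (\<Sum>p\<in>?S. of_int (sign p) * (\<Prod>i<n. \<Sum>m<N. A m (x i) * B m (x (p i))))"
        unfolding principal_minor_eq_det[symmetric] principal_minor_def
      proof (rule sum.cong[OF refl])
        fix p assume p: "p \<in> ?S"
        have "(\<Prod>i<n. K (x i) (x (p i))) = (\<Prod>i<n. \<Sum>m<N. A m (x i) * B m (x (p i)))"
        proof (rule prod.cong[OF refl])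
          fix i assume "i \<in> {..<n}"
          then have "i < n" "p i < n" using permutes_in_image[of p "{..<n}" i] p by auto
          then show "K (x i) (x (p i)) = (\<Sum>m<N. A m (x i) * B m (x (p i)))"
            by (intro K x)
        qed
        then show "of_int (sign p) * (\<Prod>i<n. K (x i) (x (p i)))
            = of_int (sign p) * (\<Prod>i<n. \<Sum>m<N. A m (x i) * B m (x (p i)))" by simp
      qed
      also have "\<dots> = (\<Sum>p\<in>?S. \<Sum>g\<in>?E. of_int (sign p) * (\<Prod>i<n. A (g i) (x i) * B (g i) (x (p i))))"
        by (simp add: prod_sum_PiE sum_distrib_left)
      also have "\<dots> = (\<Sum>p\<in>?S. \<Sum>g\<in>?E. of_int (sign p) * (\<Prod>i<n. A (g i) (x i) * B (g (inv_into UNIV p i)) (x i)))"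
      proof (rule sum.cong[OF refl], rule sum.cong[OF refl])
        fix p g assume p: "p \<in> ?S"
        then have "bij_betw p {..<n} {..<n}" by (auto intro: permutes_imp_bij)
        then have "(\<Prod>i<n. B (g (inv_into UNIV p i)) (x i)) = (\<Prod>i<n. B (g (inv_into UNIV p (p i))) (x (p i)))"
          by (rule prod.reindex_bij_betw[symmetric])
        also have "\<dots> = (\<Prod>i<n. B (g i) (x (p i)))"
          using p by (simp add: permutes_inverses(2))
        finally show "of_int (sign p) * (\<Prod>i<n. A (g i) (x i) * B (g i) (x (p i)))
            = of_int (sign p) * (\<Prod>i<n. A (g i) (x i) * B (g (inv_into UNIV p i)) (x i))"
          by (simp add: prod.distrib)
      qed
      finally show ?thesis
        by (simp only: sum_distrib_right prod.distrib of_real_prod mult.assoc)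
    qed
    have gi: "g (inv_into UNIV p i) < N" "g i < N" if "p \<in> ?S" "g \<in> ?E" "i < n" for p g i
      using that permutes_in_image[OF permutes_inv, of p "{..<n}" i] by (auto simp: PiE_iff)
    define T where "T p g x = of_int (sign p) *
        (\<Prod>i<n. A (g i) (x i) * B (g (inv_into UNIV p i)) (x i) * of_real (s (x i)))"
      for p :: "nat \<Rightarrow> nat" and g and x :: "nat \<Rightarrow> 'a"
    have int_T: "integrable (PiM {..<n} (\<lambda>_. \<nu>)) (T p g)" if "p \<in> ?S" "g \<in> ?E" for p g
      unfolding T_def
      by (intro integrable_mult_right product_integrable_prod int gi[OF that]) auto
    have LINT_T: "(LINT x|PiM {..<n} (\<lambda>_. \<nu>). T p g x)
        = of_int (sign p) * (\<Prod>i<n. G (g i) (g (inv_into UNIV p i)))"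
      if "p \<in> ?S" "g \<in> ?E" for p g
    proof -
      have "integrable \<nu> (\<lambda>x. A (g i) x * B (g (inv_into UNIV p i)) x * of_real (s x))"
        if "i \<in> {..<n}" for i
        using gi[OF \<open>p \<in> ?S\<close> \<open>g \<in> ?E\<close>] that by (intro int) auto
      then show ?thesis
        unfolding T_def G_def integral_mult_right_zero
        by (subst product_integral_prod) auto
    qed
    have "?L = (LINT x|PiM {..<n} (\<lambda>_. \<nu>). (\<Sum>p\<in>?S. \<Sum>g\<in>?E. T p g x))"
      unfolding T_def by (intro Bochner_Integration.integral_cong refl integrand)
    also have "\<dots> = (\<Sum>p\<in>?S. LINT x|PiM {..<n} (\<lambda>_. \<nu>). (\<Sum>g\<in>?E. T p g x))"
      by (intro Bochner_Integration.integral_sum Bochner_Integration.integrable_sum int_T)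
    also have "\<dots> = (\<Sum>p\<in>?S. \<Sum>g\<in>?E. LINT x|PiM {..<n} (\<lambda>_. \<nu>). T p g x)"
      by (intro sum.cong refl Bochner_Integration.integral_sum int_T)
    also have "\<dots> = (\<Sum>p\<in>?S. \<Sum>g\<in>?E.
                 of_int (sign p) * (\<Prod>i<n. G (g i) (g (inv_into UNIV p i))))"
      by (intro sum.cong refl LINT_T)
    also have "\<dots> = (\<Sum>g\<in>?E. \<Sum>p\<in>?S. of_int (sign p) * (\<Prod>i<n. G (g i) (g (inv_into UNIV p i))))"
      by (rule sum.swap)
    also have "\<dots> = (\<Sum>g\<in>?E. \<Sum>p\<in>?S. of_int (sign p) * (\<Prod>i<n. G (g i) (g (p i))))"
    proof (rule sum.cong[OF refl])
      fix g
      have "(\<Sum>p\<in>?S. of_int (sign p) * (\<Prod>i<n. G (g i) (g (p i))))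
          = (\<Sum>p\<in>?S. of_int (sign (inv_into UNIV p)) * (\<Prod>i<n. G (g i) (g (inv_into UNIV p i))))"
        by (rule sum_permutations_inverse)
      also have "\<dots> = (\<Sum>p\<in>?S. of_int (sign p) * (\<Prod>i<n. G (g i) (g (inv_into UNIV p i))))"
      proof (rule sum.cong[OF refl])
        fix p assume "p \<in> ?S"
        then have "sign (inv_into UNIV p) = sign p"
          by (intro sign_inverse) (auto simp: permutation_permutes intro: exI[of _ "{..<n}"])
        then show "of_int (sign (inv_into UNIV p)) * (\<Prod>i<n. G (g i) (g (inv_into UNIV p i)))
            = of_int (sign p) * (\<Prod>i<n. G (g i) (g (inv_into UNIV p i)))" by simp
      qed
      finally show "(\<Sum>p\<in>?S. of_int (sign p) * (\<Prod>i<n. G (g i) (g (inv_into UNIV p i))))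
          = (\<Sum>p\<in>?S. of_int (sign p) * (\<Prod>i<n. G (g i) (g (p i))))" ..
    qed
    also have "\<dots> = (\<Sum>g\<in>?E. principal_minor (\<lambda>i j. G (g i) (g j)) {..<n})"
      by (simp add: principal_minor_def)
    finally show ?thesis by (simp only: sum_tuples_principal_minor)
  qed
  have "fredholm_det \<nu> s K = (\<Sum>n. \<Sum>S\<in>{S\<in>Pow {..<N}. card S = n}. principal_minor G S)"
    unfolding fredholm_det_def trace by simp
  also have "\<dots> = (\<Sum>n\<le>N. \<Sum>S\<in>{S\<in>Pow {..<N}. card S = n}. principal_minor G S)"
  proof (rule suminf_finite)
    fix n assume "n \<notin> {..N}"
    moreover have "card S \<le> N" if "S \<subseteq> {..<N}" for S
      using card_mono[OF _ that] by simp
    ultimately have "{S\<in>Pow {..<N}. card S = n} = {}" by force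
    then show "(\<Sum>S\<in>{S\<in>Pow {..<N}. card S = n}. principal_minor G S) = 0"
      by (simp only: sum.empty)
  qed simp
  also have "\<dots> = (\<Sum>S\<in>Pow {..<N}. principal_minor G S)"
    by (rule sum.group[where g = card])
       (use card_mono[of "{..<N}"] in force)+
  finally show ?thesis
    unfolding det_one_plus_principal_minors[symmetric] G_def .
qed

section \<open>Finite rank operators on weighted square integrable functions\<close>

lemma L2_density_iff:
  assumes s: "s \<in> borel_measurable \<nu>"
  shows "h \<in> L2_space (density \<nu> (\<lambda>x. ennreal \<bar>s x\<bar>)) \<longleftrightarrow>
    h \<in> borel_measurable \<nu> \<and> integrable \<nu> (\<lambda>x. \<bar>s x\<bar> * (cmod (h x))\<^sup>2)"
proof -
  have "integrable (density \<nu> (\<lambda>x. ennreal \<bar>s x\<bar>)) (\<lambda>x. (cmod (h x))\<^sup>2)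
      \<longleftrightarrow> integrable \<nu> (\<lambda>x. \<bar>s x\<bar> * (cmod (h x))\<^sup>2)" if [measurable]: "h \<in> borel_measurable \<nu>"
    using s by (subst integrable_density) auto
  then show ?thesis by (auto simp: L2_space_def)
qed

lemma L2_density_mult_integrable:
  assumes s: "s \<in> borel_measurable \<nu>"
    and A: "A \<in> L2_space (density \<nu> (\<lambda>x. ennreal \<bar>s x\<bar>))"
    and h: "h \<in> L2_space (density \<nu> (\<lambda>x. ennreal \<bar>s x\<bar>))"
  shows "integrable \<nu> (\<lambda>x. A x * h x * of_real (s x))"
proof -
  note A' = A[unfolded L2_density_iff[OF s]] and h' = h[unfolded L2_density_iff[OF s]]
  have [measurable]: "s \<in> borel_measurable \<nu>" "A \<in> borel_measurable \<nu>" "h \<in> borel_measurable \<nu>"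
    using s A' h' by auto
  show ?thesis
  proof (rule Bochner_Integration.integrable_bound)
    show "integrable \<nu> (\<lambda>x. \<bar>s x\<bar> * (cmod (A x))\<^sup>2 + \<bar>s x\<bar> * (cmod (h x))\<^sup>2)"
      using A' h' by (intro Bochner_Integration.integrable_add) auto
    have "cmod (A x * h x * of_real (s x)) \<le> \<bar>s x\<bar> * (cmod (A x))\<^sup>2 + \<bar>s x\<bar> * (cmod (h x))\<^sup>2" for x
    proof -
      have "cmod (A x) * cmod (h x) \<le> (cmod (A x))\<^sup>2 + (cmod (h x))\<^sup>2"
        using sum_squares_bound[of "cmod (A x)" "cmod (h x)"]
          mult_nonneg_nonneg[OF norm_ge_zero[of "A x"] norm_ge_zero[of "h x"]] by linarith
      from mult_left_mono[OF this, of "\<bar>s x\<bar>"] show ?thesis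
        by (simp add: norm_mult algebra_simps)
    qed
    then show "AE x in \<nu>. cmod (A x * h x * of_real (s x))
       \<le> norm (\<bar>s x\<bar> * (cmod (A x))\<^sup>2 + \<bar>s x\<bar> * (cmod (h x))\<^sup>2)"
      by (auto intro!: AE_I2 intro: order_trans[OF _ abs_ge_self])
  qed measurable
qed

lemma L2_space_zero: "(\<lambda>x. 0) \<in> L2_space \<mu>"
  by (simp add: L2_space_def)

lemma L2_space_scale:
  assumes "h \<in> L2_space \<mu>" shows "(\<lambda>x. c * h x) \<in> L2_space \<mu>"
  using assms by (auto simp: L2_space_def norm_mult power_mult_distrib)

lemma L2_space_add:
  assumes g: "g \<in> L2_space \<mu>" and h: "h \<in> L2_space \<mu>" shows "(\<lambda>x. g x + h x) \<in> L2_space \<mu>"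
proof -
  have [measurable]: "g \<in> borel_measurable \<mu>" "h \<in> borel_measurable \<mu>"
    using g h by (auto simp: L2_space_def)
  have "integrable \<mu> (\<lambda>x. (cmod (g x + h x))\<^sup>2)"
  proof (rule Bochner_Integration.integrable_bound)
    show "integrable \<mu> (\<lambda>x. 2 * (cmod (g x))\<^sup>2 + 2 * (cmod (h x))\<^sup>2)"
      using g h by (auto simp: L2_space_def)
    have "(cmod (g x + h x))\<^sup>2 \<le> 2 * (cmod (g x))\<^sup>2 + 2 * (cmod (h x))\<^sup>2" for x
    proof -
      have "(cmod (g x + h x))\<^sup>2 \<le> (cmod (g x) + cmod (h x))\<^sup>2"
        by (intro power_mono norm_triangle_ineq) auto
      also have "\<dots> \<le> 2 * (cmod (g x))\<^sup>2 + 2 * (cmod (h x))\<^sup>2"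
        using sum_squares_bound[of "cmod (g x)" "cmod (h x)"] by (simp add: power2_sum)
      finally show ?thesis .
    qed
    then show "AE x in \<mu>. norm ((cmod (g x + h x))\<^sup>2) \<le> norm (2 * (cmod (g x))\<^sup>2 + 2 * (cmod (h x))\<^sup>2)"
      by (auto intro!: AE_I2)
  qed measurable
  then show ?thesis by (simp add: L2_space_def)
qed

lemma L2_space_sum:
  assumes "\<And>i. i \<in> S \<Longrightarrow> h i \<in> L2_space \<mu>" shows "(\<lambda>x. \<Sum>i\<in>S. h i x) \<in> L2_space \<mu>"
  using assms by (induction S rule: infinite_finite_induct) (auto intro: L2_space_zero L2_space_add)

lemma L2_space_cong:
  assumes "\<And>x. x \<in> space \<mu> \<Longrightarrow> g x = h x"
  shows "g \<in> L2_space \<mu> \<longleftrightarrow> h \<in> L2_space \<mu>"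
  using assms
  by (simp add: L2_space_def cong: measurable_cong Bochner_Integration.integrable_cong)

text \<open>Inner products are taken with respect to \<open>|s| \<nu>\<close>, whereas \<open>T\<close> integrates against \<open>s \<nu>\<close>. The
  sign of \<open>s\<close> therefore goes into the functionals \<open>u\<^sub>m\<close>.\<close>

lemma finite_rank_trace_class:
  fixes \<nu> :: "'a measure" and A B :: "nat \<Rightarrow> 'a \<Rightarrow> complex" and s :: "'a \<Rightarrow> real"
  defines "\<mu> \<equiv> density \<nu> (\<lambda>x. ennreal \<bar>s x\<bar>)"
  assumes s: "s \<in> borel_measurable \<nu>"
    and AB: "\<And>m. m < N \<Longrightarrow> A m \<in> L2_space \<mu>" "\<And>m. m < N \<Longrightarrow> B m \<in> L2_space \<mu>"
    and T: "\<And>h y. h \<in> L2_space \<mu> \<Longrightarrow> y \<in> space \<nu> \<Longrightarrow>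
        T h y = (\<Sum>m<N. (LINT x|\<nu>. A m x * h x * of_real (s x)) * B m y)"
  shows "trace_class_on \<mu> T"
proof -
  have space: "space \<mu> = space \<nu>" by (simp add: \<mu>_def)
  define u where "u m x = (if m < N then (if 0 \<le> s x then 1 else - 1) * cnj (A m x) else 0)" for m x
  define v where "v m x = (if m < N then B m x else 0)" for m x
  have meas: "h \<in> borel_measurable \<nu>" if "h \<in> L2_space \<mu>" for h
    using that s by (simp add: \<mu>_def L2_density_iff)
  have cnj_meas [measurable]: "cnj \<in> borel_measurable borel"
    by (intro borel_measurable_continuous_onI continuous_intros)
  have u_meas: "u m \<in> borel_measurable \<nu>" for m
  proof (cases "m < N")
    case True
    note [measurable] = s meas[OF AB(1)[OF True]]
    show ?thesis using True unfolding u_def[abs_def] by simp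
  qed (simp add: u_def[abs_def])
  have u: "u m \<in> L2_space \<mu>" for m
  proof (cases "m < N")
    case True
    note [measurable] = s meas[OF AB(1)[OF True]]
    have "integrable \<nu> (\<lambda>x. \<bar>s x\<bar> * (cmod (A m x))\<^sup>2)"
      using AB(1)[OF True] s by (simp add: \<mu>_def L2_density_iff)
    also have "(\<lambda>x. \<bar>s x\<bar> * (cmod (A m x))\<^sup>2)
        = (\<lambda>x. \<bar>s x\<bar> * (cmod ((if 0 \<le> s x then 1 else - 1) * cnj (A m x)))\<^sup>2)"
      by (auto simp: fun_eq_iff norm_mult)
    finally show ?thesis
      using True u_meas[of m] s unfolding \<mu>_def by (simp add: L2_density_iff u_def[abs_def])
  qed (simp add: u_def[abs_def] L2_space_zero)
  have v: "v m \<in> L2_space \<mu>" for m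
    using AB(2)[of m] by (cases "m < N") (auto simp: v_def[abs_def] L2_space_zero)
  have inner: "L2_inner \<mu> (u m) h = (LINT x|\<nu>. A m x * h x * of_real (s x))"
    if m: "m < N" and h: "h \<in> L2_space \<mu>" for m h
  proof -
    note [measurable] = s meas[OF AB(1)[OF m]] meas[OF h]
    have "L2_inner \<mu> (u m) h = (LINT x|\<nu>. \<bar>s x\<bar> *\<^sub>R (cnj (u m x) * h x))"
      unfolding L2_inner_def \<mu>_def using m u_meas[of m] by (subst integral_density) auto
    also have "\<dots> = (LINT x|\<nu>. A m x * h x * of_real (s x))"
      by (rule Bochner_Integration.integral_cong)
         (auto simp: u_def m scaleR_conv_of_real abs_if)
    finally show ?thesis .
  qed
  have T': "T h y = (\<Sum>m<n. L2_inner \<mu> (u m) h * v m y)"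
    if h: "h \<in> L2_space \<mu>" and y: "y \<in> space \<mu>" and n: "N \<le> n" for h y n
  proof -
    have "(\<Sum>m<n. L2_inner \<mu> (u m) h * v m y) = (\<Sum>m<N. L2_inner \<mu> (u m) h * v m y)"
      by (rule sum.mono_neutral_right) (use n in \<open>auto simp: v_def\<close>)
    then show ?thesis using T[OF h] y by (simp add: space inner h v_def)
  qed
  show ?thesis
    unfolding trace_class_on_def
  proof (rule conjI; (rule exI[of _ u], rule exI[of _ v], intro conjI allI)?; (rule ballI)?)
    fix h assume h: "h \<in> L2_space \<mu>"
    have "(\<lambda>y. \<Sum>m<N. L2_inner \<mu> (u m) h * v m y) \<in> L2_space \<mu>"
      by (intro L2_space_sum L2_space_scale v)
    then show "T h \<in> L2_space \<mu>"
      using L2_space_cong[of \<mu> "T h" "\<lambda>y. \<Sum>m<N. L2_inner \<mu> (u m) h * v m y"]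
        T'[OF h _ order_refl] by blast
    have "L2_norm \<mu> (\<lambda>x. T h x - (\<Sum>i<n. L2_inner \<mu> (u i) h * v i x)) = 0" if "N \<le> n" for n
    proof -
      have "(LINT x|\<mu>. (cmod (T h x - (\<Sum>i<n. L2_inner \<mu> (u i) h * v i x)))\<^sup>2) = (LINT x|\<mu>. 0)"
        by (rule Bochner_Integration.integral_cong) (auto simp: T'[OF h _ that])
      then show ?thesis by (simp add: L2_norm_def)
    qed
    then show "(\<lambda>n. L2_norm \<mu> (\<lambda>x. T h x - (\<Sum>i<n. L2_inner \<mu> (u i) h * v i x))) \<longlonglongrightarrow> 0"
      by (intro tendsto_eventually eventually_sequentiallyI[of N])
  next
    show "summable (\<lambda>n. L2_norm \<mu> (u n) * L2_norm \<mu> (v n))"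
      by (rule summable_finite[of "{..<N}"]) (auto simp: v_def L2_norm_def)
  qed (use u v in auto)
qed

section \<open>Gram determinants and the Christoffel--Darboux formula\<close>

definition circle_mean :: "(complex \<Rightarrow> complex) \<Rightarrow> complex" where
  "circle_mean g = integral {0..2*pi} (\<lambda>\<theta>. g (cis \<theta>)) / of_real (2 * pi)"

lemma poly_as_sum_lessThan:
  fixes p :: "'a::comm_semiring_1 poly"
  assumes "degree p < n"
  shows "poly p z = (\<Sum>m<n. coeff p m * z ^ m)"
  unfolding poly_altdef
  by (rule sum.mono_neutral_left) (use assms in \<open>auto simp: coeff_eq_0\<close>)

lemma continuous_on_circle_integrable:
  assumes "continuous_on (sphere 0 1) g"
  shows "(\<lambda>\<theta>. g (cis \<theta>) :: complex) integrable_on {a..b}"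
  by (intro integrable_continuous_interval continuous_on_compose2[OF assms])
     (auto intro!: continuous_intros)

lemma circle_mean_cong:
  assumes "\<And>z. cmod z = 1 \<Longrightarrow> g z = h z"
  shows "circle_mean g = circle_mean h"
  unfolding circle_mean_def using assms by simp

lemma circle_mean_sum:
  assumes "finite A" "\<And>i. i \<in> A \<Longrightarrow> continuous_on (sphere 0 1) (g i)"
  shows "circle_mean (\<lambda>z. \<Sum>i\<in>A. c i * g i z) = (\<Sum>i\<in>A. c i * circle_mean (g i))"
proof -
  have "integral {0..2*pi} (\<lambda>\<theta>. \<Sum>i\<in>A. c i * g i (cis \<theta>))
      = (\<Sum>i\<in>A. integral {0..2*pi} (\<lambda>\<theta>. c i * g i (cis \<theta>)))"
    by (rule integral_sum[OF assms(1)])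
       (intro continuous_on_circle_integrable continuous_intros assms)
  then show ?thesis
    by (simp add: circle_mean_def sum_divide_distrib)
qed

lemma poly_mult_cnj_expand:
  assumes p: "degree p < n" and q: "degree q < n"
  shows "poly p z * cnj (poly q z) * x
    = (\<Sum>i\<in>{..<n} \<times> {..<n}. cnj (coeff q (fst i)) * coeff p (snd i) * (z ^ snd i * cnj (z ^ fst i) * x))"
proof -
  have "cnj (poly q z) * (poly p z * x)
      = (\<Sum>l<n. \<Sum>m<n. (cnj (coeff q l) * cnj (z ^ l)) * ((coeff p m * z ^ m) * x))"
    unfolding sum_product[symmetric]
    by (simp add: poly_as_sum_lessThan[OF p] poly_as_sum_lessThan[OF q] sum_distrib_right)
  then show ?thesis
    unfolding sum.cartesian_product by (simp add: split_def mult_ac)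
qed

lemma circle_mean_form:
  assumes f: "continuous_on (sphere 0 1) f" and p: "degree p < n" and q: "degree q < n"
  shows "circle_mean (\<lambda>z. poly p z * cnj (poly q z) * f z)
    = (\<Sum>l<n. \<Sum>m<n. cnj (coeff q l) * coeff p m * circle_mean (\<lambda>z. z ^ m * cnj (z ^ l) * f z))"
  unfolding poly_mult_cnj_expand[OF p q] sum.cartesian_product
  by (subst circle_mean_sum) (auto simp: split_def intro!: continuous_intros f)

text \<open>The sesquilinear form on polynomials of degree below \<open>n\<close> whose value at \<open>z\<^sup>m, z\<^sup>l\<close> is \<open>F l m\<close>.\<close>

definition coeff_form :: "(nat \<Rightarrow> nat \<Rightarrow> complex) \<Rightarrow> nat \<Rightarrow> complex poly \<Rightarrow> complex poly \<Rightarrow> complex" where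
  "coeff_form F n p q = (\<Sum>l<n. \<Sum>m<n. cnj (coeff q l) * coeff p m * F l m)"

lemma gram_factorization:
  "mat n n (\<lambda>(i, j). coeff_form F n (e j) (e i))
     = mat n n (\<lambda>(i, l). cnj (coeff (e i) l)) * (mat n n (\<lambda>(l, m). F l m)
         * mat n n (\<lambda>(m, j). coeff (e j) m))"
  by (rule eq_matI)
     (auto simp: scalar_prod_def coeff_form_def atLeast0LessThan sum_distrib_left
        mult_ac intro!: sum.cong)

text \<open>A change of basis multiplies the determinants of all moment matrices by one and the same
  factor. For \<open>F\<close> the result is \<open>1\<close>, so this factor is the reciprocal of the determinant of \<open>F\<close>.\<close>

lemma det_moments_eq:
  assumes "\<And>i j. i < n \<Longrightarrow> j < n \<Longrightarrow> coeff_form F n (e j) (e i) = (if i = j then 1 else 0)"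
  shows "Determinant.det (mat n n (\<lambda>(l, m). H l m))
     = Determinant.det (mat n n (\<lambda>(l, m). F l m))
        * Determinant.det (mat n n (\<lambda>(i, j). coeff_form H n (e j) (e i)))"
proof -
  let ?C = "mat n n (\<lambda>(i, l). cnj (coeff (e i) l))" and ?E = "mat n n (\<lambda>(m, j). coeff (e j) m)"
  have d: "Determinant.det (mat n n (\<lambda>(i, j). coeff_form G n (e j) (e i)))
     = Determinant.det ?C * Determinant.det (mat n n (\<lambda>(l, m). G l m)) * Determinant.det ?E" for G
  proof -
    have "mat n n (\<lambda>(l, m). G l m) * ?E \<in> carrier_mat n n"
      by (rule mult_carrier_mat[of _ n n]) auto
    then show ?thesis
      unfolding gram_factorization by (simp add: det_mult[of _ n] mult.assoc)
  qed
  have "mat n n (\<lambda>(i, j). coeff_form F n (e j) (e i)) = 1\<^sub>m n"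
    by (rule eq_matI) (auto simp: assms)
  with d[of F] have "Determinant.det ?C * Determinant.det (mat n n (\<lambda>(l, m). F l m)) * Determinant.det ?E = 1"
    by simp
  then show ?thesis unfolding d[of H] by (simp add: mult_ac)
qed

text \<open>Both sides are entries of the inverse of the moment matrix: if \<open>C F E = 1\<close>, where \<open>E\<close> holds the
  coefficients of a basis and \<open>C\<close> their conjugates, then \<open>F (E C) = 1\<close>.\<close>

lemma orthonormal_kernel_unique:
  assumes e: "\<And>i j. i < n \<Longrightarrow> j < n \<Longrightarrow> coeff_form F n (e j) (e i) = (if i = j then 1 else 0)"
    and d: "\<And>i j. i < n \<Longrightarrow> j < n \<Longrightarrow> coeff_form F n (d j) (d i) = (if i = j then 1 else 0)"
    and ab: "a < n" "b < n"
  shows "(\<Sum>i<n. cnj (coeff (e i) a) * coeff (e i) b) = (\<Sum>i<n. cnj (coeff (d i) a) * coeff (d i) b)"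
proof -
  let ?F = "mat n n (\<lambda>(l, m). F l m)"
  define R where "R e = mat n n (\<lambda>(m, j). coeff (e j) m) * mat n n (\<lambda>(i, l). cnj (coeff (e i) l))"
    for e :: "nat \<Rightarrow> complex poly"
  have R: "R e \<in> carrier_mat n n" for e
    unfolding R_def by (rule mult_carrier_mat[of _ n n]) auto
  have inv: "?F * R e = 1\<^sub>m n"
    if "\<And>i j. i < n \<Longrightarrow> j < n \<Longrightarrow> coeff_form F n (e j) (e i) = (if i = j then 1 else 0)" for e
  proof -
    let ?C = "mat n n (\<lambda>(i, l). cnj (coeff (e i) l))" and ?E = "mat n n (\<lambda>(m, j). coeff (e j) m)"
    have "?C * (?F * ?E) = 1\<^sub>m n"
      unfolding gram_factorization[symmetric] by (rule eq_matI) (auto simp: that)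
    then have "?F * ?E * ?C = 1\<^sub>m n"
      by (intro mat_mult_left_right_inverse[of ?C n]) auto
    then show ?thesis
      unfolding R_def by (subst assoc_mult_mat[symmetric, of _ n n _ n _ n]) auto
  qed
  have "R d * ?F = 1\<^sub>m n"
    by (rule mat_mult_left_right_inverse[OF _ _ inv[of d, OF d]]) (auto simp: R)
  then have "R e = (R d * ?F) * R e"
    using left_mult_one_mat[OF R[of e]] by simp
  also have "\<dots> = R d * (?F * R e)"
    by (rule assoc_mult_mat[of _ n n _ n _ n]) (auto simp: R)
  also have "\<dots> = R d"
    using inv[of e] e right_mult_one_mat[OF R[of d]] by simp
  finally have "R d = R e" ..
  then have "R d $$ (b, a) = R e $$ (b, a)" by simp
  then show ?thesis
    using ab unfolding R_def by (simp add: scalar_prod_def atLeast0LessThan mult.commute)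
qed

lemma coeff_form_circle:
  assumes "continuous_on (sphere 0 1) f" "degree p < n" "degree q < n"
  shows "coeff_form (\<lambda>l m. circle_mean (\<lambda>z. z ^ m * cnj (z ^ l) * f z)) n p q
    = circle_mean (\<lambda>z. poly p z * cnj (poly q z) * f z)"
  unfolding coeff_form_def circle_mean_form[OF assms] ..

lemma orthonormal_polys_span:
  fixes \<phi> :: "nat \<Rightarrow> complex poly"
  assumes "\<And>j. degree (\<phi> j) = j" "\<And>j. lead_coeff (\<phi> j) \<noteq> 0"
  shows "degree p < n \<Longrightarrow> \<exists>c. p = (\<Sum>i<n. Polynomial.smult (c i) (\<phi> i))"
proof (induction n arbitrary: p)
  case (Suc n)
  define a where "a = coeff p n / coeff (\<phi> n) n"
  have nz: "coeff (\<phi> n) n \<noteq> 0" using assms[of n] by metis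
  have "degree (p - Polynomial.smult a (\<phi> n)) < n \<or> (n = 0 \<and> p - Polynomial.smult a (\<phi> n) = 0)"
  proof (cases "p - Polynomial.smult a (\<phi> n) = 0")
    case True
    then show ?thesis by auto
  next
    case False
    have "degree (p - Polynomial.smult a (\<phi> n)) \<le> n"
      using Suc.prems assms(1)[of n] by (intro degree_diff_le) auto
    moreover have "coeff (p - Polynomial.smult a (\<phi> n)) n = 0"
      using nz by (simp add: a_def)
    ultimately have "degree (p - Polynomial.smult a (\<phi> n)) \<noteq> n"
      using False by (metis leading_coeff_0_iff)
    then show ?thesis using \<open>degree _ \<le> n\<close> by simp
  qed
  then obtain c where c: "p - Polynomial.smult a (\<phi> n) = (\<Sum>i<n. Polynomial.smult (c i) (\<phi> i))"
    using Suc.IH by fastforce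
  have "p = (\<Sum>i<Suc n. Polynomial.smult ((c(n := a)) i) (\<phi> i))"
    using c by (simp add: algebra_simps)
  then show ?case by blast
qed simp

lemma orthogonal_to_lower_degree:
  assumes f: "continuous_on (sphere 0 1) f" and on: "orthonormal_polys f \<phi>"
    and p: "degree p < n"
  shows "circle_mean (\<lambda>z. poly (\<phi> n) z * cnj (poly p z) * f z) = 0"
    and "circle_mean (\<lambda>z. poly p z * cnj (poly (\<phi> n) z) * f z) = 0"
proof -
  have ip: "circle_mean (\<lambda>z. poly (\<phi> j) z * cnj (poly (\<phi> l) z) * f z) = (if j = l then 1 else 0)" for j l
    using on by (simp add: orthonormal_polys_def circle_mean_def)
  obtain c where c: "p = (\<Sum>i<n. Polynomial.smult (c i) (\<phi> i))"
    using orthonormal_polys_span[of \<phi> p n] on p unfolding orthonormal_polys_def by blast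
  have "circle_mean (\<lambda>z. poly (\<phi> n) z * cnj (poly p z) * f z)
      = circle_mean (\<lambda>z. \<Sum>i<n. cnj (c i) * (poly (\<phi> n) z * cnj (poly (\<phi> i) z) * f z))"
    unfolding c by (rule circle_mean_cong)
      (simp add: poly_sum sum_distrib_left sum_distrib_right mult_ac)
  also have "\<dots> = 0"
    by (subst circle_mean_sum) (auto intro!: continuous_intros f simp: ip)
  finally show "circle_mean (\<lambda>z. poly (\<phi> n) z * cnj (poly p z) * f z) = 0" .
  have "circle_mean (\<lambda>z. poly p z * cnj (poly (\<phi> n) z) * f z)
      = circle_mean (\<lambda>z. \<Sum>i<n. c i * (poly (\<phi> i) z * cnj (poly (\<phi> n) z) * f z))"
    unfolding c by (rule circle_mean_cong)
      (simp add: poly_sum sum_distrib_left sum_distrib_right mult_ac)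
  also have "\<dots> = 0"
    by (subst circle_mean_sum) (auto intro!: continuous_intros f simp: ip)
  finally show "circle_mean (\<lambda>z. poly p z * cnj (poly (\<phi> n) z) * f z) = 0" .
qed

lemma poly_cnj_circle:
  assumes "cmod z = 1" shows "cnj (poly p z) = poly (map_poly cnj p) (inverse z)"
proof -
  have "z * cnj z = 1"
    using assms by (simp add: complex_norm_square[symmetric])
  then have "inverse z = cnj z" by (rule inverse_unique)
  then show ?thesis by simp
qed

text \<open>Szego's reversed polynomial, which on the unit circle is \<open>z\<^sup>n\<close> times the conjugate of \<open>p(z)\<close> for
  \<open>n\<close> the degree of \<open>p\<close>.\<close>

definition reversed_poly :: "complex poly \<Rightarrow> complex poly" where
  "reversed_poly p = reflect_poly (map_poly cnj p)"

lemma degree_map_poly_cnj [simp]: "degree (map_poly cnj p) = degree p"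
  by (rule degree_map_poly) simp

lemma degree_reversed_poly: "degree (reversed_poly p) \<le> degree p"
  unfolding reversed_poly_def by (rule order_trans[OF degree_reflect_poly_le]) simp

lemma poly_reversed_poly:
  "z \<noteq> 0 \<Longrightarrow> poly (reversed_poly p) z = z ^ degree p * poly (map_poly cnj p) (inverse z)"
  unfolding reversed_poly_def by (simp add: poly_reflect_poly_nz)

lemma poly_cnj_reversed_poly:
  assumes "z \<noteq> 0"
  shows "poly (map_poly cnj (reversed_poly p)) (inverse z) = inverse z ^ degree p * poly p z"
proof -
  have "poly (map_poly cnj (reversed_poly p)) (inverse z) = cnj (poly (reversed_poly p) (inverse (cnj z)))"
    by simp
  also have "\<dots> = cnj (inverse (cnj z) ^ degree p * poly (map_poly cnj p) (cnj z))"
    using assms by (simp add: poly_reversed_poly)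
  also have "\<dots> = inverse z ^ degree p * poly p z"
    by simp
  finally show ?thesis .
qed

lemma kernel_eq_coeff_sum:
  fixes e :: "nat \<Rightarrow> complex poly"
  assumes "\<And>i. i < n \<Longrightarrow> degree (e i) < n"
  shows "(\<Sum>i<n. poly (map_poly cnj (e i)) x * poly (e i) u)
    = (\<Sum>a<n. \<Sum>b<n. x ^ a * u ^ b * (\<Sum>i<n. cnj (coeff (e i) a) * coeff (e i) b))"
proof -
  have "(\<Sum>i<n. poly (map_poly cnj (e i)) x * poly (e i) u)
     = (\<Sum>i<n. \<Sum>a<n. \<Sum>b<n. x ^ a * u ^ b * (cnj (coeff (e i) a) * coeff (e i) b))"
  proof (rule sum.cong[OF refl])
    fix i assume "i \<in> {..<n}"
    then have "poly (map_poly cnj (e i)) x = (\<Sum>a<n. cnj (coeff (e i) a) * x ^ a)"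
      "poly (e i) u = (\<Sum>b<n. coeff (e i) b * u ^ b)"
      using assms[of i] by (simp_all add: poly_as_sum_lessThan[of _ n] coeff_map_poly)
    then show "poly (map_poly cnj (e i)) x * poly (e i) u
       = (\<Sum>a<n. \<Sum>b<n. x ^ a * u ^ b * (cnj (coeff (e i) a) * coeff (e i) b))"
      by (simp only: sum_product) (simp add: mult_ac)
  qed
  also have "\<dots> = (\<Sum>a<n. \<Sum>i<n. \<Sum>b<n. x ^ a * u ^ b * (cnj (coeff (e i) a) * coeff (e i) b))"
    by (rule sum.swap)
  also have "\<dots> = (\<Sum>a<n. \<Sum>b<n. \<Sum>i<n. x ^ a * u ^ b * (cnj (coeff (e i) a) * coeff (e i) b))"
    by (intro sum.cong refl sum.swap)
  finally show ?thesis by (simp add: sum_distrib_left)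
qed

lemma orthonormal_kernel_poly_unique:
  assumes "\<And>i. i < n \<Longrightarrow> degree (e i) < n" "\<And>i. i < n \<Longrightarrow> degree (d i) < n"
    and "\<And>i j. i < n \<Longrightarrow> j < n \<Longrightarrow> coeff_form F n (e j) (e i) = (if i = j then 1 else 0)"
    and "\<And>i j. i < n \<Longrightarrow> j < n \<Longrightarrow> coeff_form F n (d j) (d i) = (if i = j then 1 else 0)"
  shows "(\<Sum>i<n. poly (map_poly cnj (e i)) x * poly (e i) u)
    = (\<Sum>i<n. poly (map_poly cnj (d i)) x * poly (d i) u)"
proof -
  have "(\<Sum>i<n. cnj (coeff (e i) a) * coeff (e i) b) = (\<Sum>i<n. cnj (coeff (d i) a) * coeff (d i) b)"
    if "a < n" "b < n" for a b
    using assms(3,4) that by (rule orthonormal_kernel_unique)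
  then have "(\<Sum>a<n. \<Sum>b<n. x ^ a * u ^ b * (\<Sum>i<n. cnj (coeff (e i) a) * coeff (e i) b))
      = (\<Sum>a<n. \<Sum>b<n. x ^ a * u ^ b * (\<Sum>i<n. cnj (coeff (d i) a) * coeff (d i) b))"
    by (intro sum.cong refl) simp
  moreover note kernel_eq_coeff_sum[of n e x u] kernel_eq_coeff_sum[of n d x u]
  ultimately show ?thesis using assms(1,2) by presburger
qed

text \<open>The polynomials of degree at most \<open>N\<close> have two orthonormal bases: \<open>\<phi>\<^sub>0, \<dots>, \<phi>\<^sub>N\<close> and
  \<open>z \<phi>\<^sub>0, \<dots>, z \<phi>\<^sub>N\<^sub>-\<^sub>1\<close> together with the reversal of \<open>\<phi>\<^sub>N\<close>. Indeed multiplication by \<open>z\<close> preserves the inner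
  product on the circle, and orthogonality of the reversal to multiples of \<open>z\<close> is, after conjugation,
  orthogonality of \<open>\<phi>\<^sub>N\<close> to lower degrees. If \<open>S\<close> is the sum in question, the first basis has
  the reproducing kernel \<open>S\<close> plus the term of \<open>\<phi>\<^sub>N\<close>, and the second has \<open>(u / z) S\<close> plus the term of the
  reversal. The two kernels are equal.\<close>

theorem christoffel_darboux:
  assumes f: "continuous_on (sphere 0 1) f" and on: "orthonormal_polys f \<phi>"
    and zu: "z \<noteq> 0" "u \<noteq> 0"
  shows "(1 - u / z) * (\<Sum>j<N. poly (map_poly cnj (\<phi> j)) (inverse z) * poly (\<phi> j) u)
    = u ^ N / z ^ N * poly (\<phi> N) z * poly (map_poly cnj (\<phi> N)) (inverse u)
      - poly (map_poly cnj (\<phi> N)) (inverse z) * poly (\<phi> N) u"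
proof -
  have deg: "degree (\<phi> j) = j" for j
    using on by (simp add: orthonormal_polys_def)
  have ip: "circle_mean (\<lambda>z. poly (\<phi> j) z * cnj (poly (\<phi> l) z) * f z) = (if j = l then 1 else 0)" for j l
    using on by (simp add: orthonormal_polys_def circle_mean_def)
  let ?F = "\<lambda>l m. circle_mean (\<lambda>z. z ^ m * cnj (z ^ l) * f z)"
  define d where "d i = (if i < N then pCons 0 (\<phi> i) else reversed_poly (\<phi> N))" for i
  have deg_d: "degree (d i) < Suc N" if "i < Suc N" for i
    using that degree_reversed_poly[of "\<phi> N"] degree_pCons_le[of 0 "\<phi> i"]
    by (auto simp: d_def deg)
  have rev_circle: "poly (reversed_poly (\<phi> i)) z = z ^ i * cnj (poly (\<phi> i) z)" if "cmod z = 1" for z i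
  proof -
    have "z \<noteq> 0" using that by auto
    then show ?thesis by (simp add: poly_reversed_poly deg poly_cnj_circle[OF that])
  qed
  have circ: "z * cnj z = 1" if "cmod z = 1" for z
    using that by (simp add: complex_norm_square[symmetric])
  have circ_pow: "z ^ m * cnj z ^ m = 1" if "cmod z = 1" for z m
    using circ[OF that] by (metis power_mult_distrib power_one)
  \<comment> \<open>On the circle \<open>z \<psi>\<^sub>i(z)\<close> is \<open>z\<^sup>N\<close> times the conjugate of \<open>\<phi>\<^sub>i(z)\<close>, and \<open>\<psi>\<^sub>i\<close> has degree below \<open>N\<close>.\<close>
  define \<psi> where "\<psi> i = monom 1 (N - 1 - i) * reversed_poly (\<phi> i)" for i
  have deg_\<psi>: "degree (\<psi> i) < N" if "i < N" for i
  proof -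
    have "degree (\<psi> i) \<le> (N - 1 - i) + i"
      unfolding \<psi>_def
      by (rule order_trans[OF degree_mult_le add_mono])
         (use degree_reversed_poly[of "\<phi> i"] in \<open>auto simp: deg degree_monom_eq\<close>)
    then show ?thesis using that by simp
  qed
  have \<psi>_circle: "z * poly (\<psi> i) z = z ^ N * cnj (poly (\<phi> i) z)" if "cmod z = 1" "i < N" for z i
  proof -
    have "z ^ N = z * (z ^ (N - 1 - i) * z ^ i)"
      using that by (simp flip: power_add power_Suc)
    then show ?thesis using that by (simp add: \<psi>_def poly_monom rev_circle)
  qed
  have gram_e: "coeff_form ?F (Suc N) (\<phi> j) (\<phi> i) = (if i = j then 1 else 0)"
    if "i < Suc N" "j < Suc N" for i j
    using that by (subst coeff_form_circle[OF f]) (auto simp: deg ip)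
  have gram_d: "coeff_form ?F (Suc N)  (d j) (d i) = (if i = j then 1 else 0)"
    if ij: "i < Suc N" "j < Suc N" for i j
  proof -
    have "circle_mean (\<lambda>z. poly (d j) z * cnj (poly (d i) z) * f z) = (if i = j then 1 else 0)"
    proof -
      consider "i < N" "j < N" | "i < N" "j = N" | "i = N" "j < N" | "i = N" "j = N"
        using ij less_Suc_eq by blast
      then show ?thesis
      proof cases
        case 1
        then have "circle_mean (\<lambda>z. poly (d j) z * cnj (poly (d i) z) * f z)
          = circle_mean (\<lambda>z. poly (\<phi> j) z * cnj (poly (\<phi> i) z) * f z)"
          by (intro circle_mean_cong) (simp add: d_def mult_ac, metis circ mult.assoc mult.commute mult_1)
        then show ?thesis by (simp add: ip)
      next
        case 2
        have "poly (d j) z * cnj (poly (d i) z) * f z = poly (\<psi> i) z * cnj (poly (\<phi> N) z) * f z"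
          if z: "cmod z = 1" for z
        proof -
          have "poly (d j) z * cnj (poly (d i) z) = cnj z * (z ^ N * cnj (poly (\<phi> i) z)) * cnj (poly (\<phi> N) z)"
            using 2 z by (simp add: d_def rev_circle mult_ac)
          also have "\<dots> = (z * cnj z) * poly (\<psi> i) z * cnj (poly (\<phi> N) z)"
            unfolding \<psi>_circle[OF z 2(1), symmetric] by (simp add: mult_ac)
          finally show ?thesis by (simp add: circ[OF z])
        qed
        then have "circle_mean (\<lambda>z. poly (d j) z * cnj (poly (d i) z) * f z)
          = circle_mean (\<lambda>z. poly (\<psi> i) z * cnj (poly (\<phi> N) z) * f z)"
          by (intro circle_mean_cong)
        then show ?thesis
          using 2 orthogonal_to_lower_degree(2)[OF f on deg_\<psi>] by simp
      next
        case 3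
        have "poly (d j) z * cnj (poly (d i) z) * f z = poly (\<phi> N) z * cnj (poly (\<psi> j) z) * f z"
          if z: "cmod z = 1" for z
        proof -
          have "poly (d j) z * cnj (poly (d i) z) = z * cnj (z ^ N * cnj (poly (\<phi> j) z)) * poly (\<phi> N) z"
            using 3 z by (simp add: d_def rev_circle mult_ac)
          also have "\<dots> = (z * cnj z) * cnj (poly (\<psi> j) z) * poly (\<phi> N) z"
            unfolding \<psi>_circle[OF z 3(2), symmetric] by (simp add: mult_ac)
          finally show ?thesis by (simp add: circ[OF z] mult_ac)
        qed
        then have "circle_mean (\<lambda>z. poly (d j) z * cnj (poly (d i) z) * f z)
          = circle_mean (\<lambda>z. poly (\<phi> N) z * cnj (poly (\<psi> j) z) * f z)"
          by (intro circle_mean_cong)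
        then show ?thesis
          using 3 orthogonal_to_lower_degree(1)[OF f on deg_\<psi>] by simp
      next
        case 4
        have "poly (d j) z * cnj (poly (d i) z) * f z = poly (\<phi> N) z * cnj (poly (\<phi> N) z) * f z"
          if z: "cmod z = 1" for z
        proof -
          have "poly (d j) z * cnj (poly (d i) z)
             = (z ^ N * cnj z ^ N) * (poly (\<phi> N) z * cnj (poly (\<phi> N) z))"
            using 4 z by (simp add: d_def rev_circle mult_ac)
          then show ?thesis by (simp add: circ_pow[OF z])
        qed
        then have "circle_mean (\<lambda>z. poly (d j) z * cnj (poly (d i) z) * f z)
          = circle_mean (\<lambda>z. poly (\<phi> N) z * cnj (poly (\<phi> N) z) * f z)"
          by (intro circle_mean_cong)
        then show ?thesis using 4 by (simp add: ip)
      qed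
    qed
    then show ?thesis
      using deg_d that by (subst coeff_form_circle[OF f]) auto
  qed
  let ?x = "inverse z"
  define S where "S = (\<Sum>j<N. poly (map_poly cnj (\<phi> j)) ?x * poly (\<phi> j) u)"
  have "(\<Sum>i<Suc N. poly (map_poly cnj (\<phi> i)) ?x * poly (\<phi> i) u)
      = (\<Sum>i<Suc N. poly (map_poly cnj (d i)) ?x * poly (d i) u)"
    by (rule orthonormal_kernel_poly_unique[OF _ deg_d gram_e gram_d]) (simp_all add: deg)
  also have "\<dots> = (\<Sum>i<N. poly (map_poly cnj (d i)) ?x * poly (d i) u)
      + poly (map_poly cnj (reversed_poly (\<phi> N))) ?x * poly (reversed_poly (\<phi> N)) u"
    by (simp add: d_def)
  also have "(\<Sum>i<N. poly (map_poly cnj (d i)) ?x * poly (d i) u) = ?x * u * S"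
    unfolding S_def sum_distrib_left
    by (rule sum.cong) (auto simp: d_def map_poly_pCons mult_ac)
  finally have "S + poly (map_poly cnj (\<phi> N)) ?x * poly (\<phi> N) u
      = ?x * u * S + (?x ^ N * poly (\<phi> N) z) * (u ^ N * poly (map_poly cnj (\<phi> N)) (inverse u))"
    using zu by (simp add: S_def poly_cnj_reversed_poly poly_reversed_poly deg)
  then have "(1 - ?x * u) * S = (?x ^ N * poly (\<phi> N) z) * (u ^ N * poly (map_poly cnj (\<phi> N)) (inverse u))
      - poly (map_poly cnj (\<phi> N)) ?x * poly (\<phi> N) u"
    by (simp add: algebra_simps)
  then show ?thesis
    unfolding S_def by (simp add: field_simps)
qed

text \<open>Off the diagonal this is the Christoffel--Darboux formula; the sum is continuous in \<open>u\<close>, which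
  gives the value of the limit on the diagonal.\<close>

lemma K_CD_eq_sum:
  assumes f: "continuous_on (sphere 0 1) f" and on: "orthonormal_polys f \<phi>"
    and zu: "z \<noteq> 0" "u \<noteq> 0"
  shows "K_CD N (\<phi> N) z u = (\<Sum>j<N. poly (map_poly cnj (\<phi> j)) (inverse z) * poly (\<phi> j) u)"
proof -
  define S where "S u = (\<Sum>j<N. poly (map_poly cnj (\<phi> j)) (inverse z) * poly (\<phi> j) u)" for u
  have quot: "CD_quotient N (\<phi> N) z u = S u" if "u \<noteq> 0" "u \<noteq> z" for u
  proof -
    have "1 - u / z \<noteq> 0"
    proof
      assume "1 - u / z = 0"
      then have "u / z = 1" by simp
      moreover have "u = (u / z) * z" using zu(1) by simp
      ultimately have "u = z" by (metis mult_1)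
      then show False using that(2) by blast
    qed
    then have "S u = (1 - u / z) * S u / (1 - u / z)" by simp
    also have "\<dots> = CD_quotient N (\<phi> N) z u"
      unfolding CD_quotient_def S_def christoffel_darboux[OF f on zu(1) that(1)] ..
    finally show ?thesis ..
  qed
  have "K_CD N (\<phi> N) z u = S u"
  proof (cases "u = z")
    case True
    have "continuous (at z) S" unfolding S_def by (intro continuous_intros)
    then have "(S \<longlongrightarrow> S z) (at z)" by (simp add: isCont_def)
    moreover have "\<forall>\<^sub>F u in at z. S u = CD_quotient N (\<phi> N) z u"
      using eventually_at_ball'[of "cmod z" z UNIV] zu(1)
      by (auto elim!: eventually_mono intro!: quot[symmetric])
    ultimately have "(CD_quotient N (\<phi> N) z \<longlongrightarrow> S z) (at z)" by (rule Lim_transform_eventually)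
    then have "Lim (at z) (CD_quotient N (\<phi> N) z) = S z" by (intro tendsto_Lim) simp_all
    then show ?thesis using True by (simp add: K_CD_def)
  next
    case False
    then show ?thesis using quot[OF zu(2) False] by (simp add: K_CD_def)
  qed
  then show ?thesis by (simp only: S_def)
qed

section \<open>Integration over the parameter space of the contours\<close>

lemma integral_count_space_pair:
  fixes F :: "'a \<times> 'b \<Rightarrow> 'c::{banach, second_countable_topology}"
  assumes A: "finite A" and M: "sigma_finite_measure M"
    and F: "\<And>a. a \<in> A \<Longrightarrow> integrable M (\<lambda>y. F (a, y))"
  shows "integrable (count_space A \<Otimes>\<^sub>M M) F"
    and "(LINT x|(count_space A \<Otimes>\<^sub>M M). F x) = (\<Sum>a\<in>A. LINT y|M. F (a, y))"
proof -
  interpret M: sigma_finite_measure M by fact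
  interpret A: sigma_finite_measure "count_space A"
    by (rule sigma_finite_measure_count_space_finite[OF A])
  interpret pair_sigma_finite "count_space A" M ..
  have meas: "F \<in> borel_measurable (count_space A \<Otimes>\<^sub>M M)"
    by (rule measurable_pair_measure_countable1)
       (use A F in \<open>auto intro: countable_finite borel_measurable_integrable\<close>)
  show int: "integrable (count_space A \<Otimes>\<^sub>M M) F"
    by (rule Fubini_integrable[OF meas])
       (use A F in \<open>auto intro: integrable_count_space simp: AE_count_space\<close>)
  show "(LINT x|(count_space A \<Otimes>\<^sub>M M). F x) = (\<Sum>a\<in>A. LINT y|M. F (a, y))"
    using integral_fst'[OF int] A by (simp add: lebesgue_integral_count_space_finite)
qed

abbreviation unit_interval :: "real measure" where
  "unit_interval \<equiv> restrict_space lborel {0<..<1}"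

lemma UNIV_edge: "(UNIV :: edge set) = {Ray_Start, Outer_Arc, Ray_End, Inner_Arc}"
  using edge.exhaust by auto

lemma finite_UNIV_edge [simp]: "finite (UNIV :: edge set)"
  by (simp add: UNIV_edge)

lemma sigma_finite_unit_interval: "sigma_finite_measure unit_interval"
  by (rule sigma_finite_measure_restrict_space) (auto intro: lborel.sigma_finite_measure_axioms)

lemma sigma_finite_param_measure: "sigma_finite_measure (param_measure k)"
proof -
  interpret a: sigma_finite_measure "count_space {1..k}"
    by (rule sigma_finite_measure_count_space_finite) simp
  interpret b: sigma_finite_measure "count_space (UNIV :: edge set)"
    by (rule sigma_finite_measure_count_space_finite) simp
  interpret c: sigma_finite_measure unit_interval
    by (rule sigma_finite_unit_interval)
  interpret bc: pair_sigma_finite "count_space (UNIV :: edge set)" unit_interval ..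
  interpret abc: pair_sigma_finite "count_space {1..k}" "count_space (UNIV :: edge set) \<Otimes>\<^sub>M unit_interval" ..
  show ?thesis
    unfolding param_measure_def by (rule abc.sigma_finite_measure_axioms)
qed

lemma space_param_measure: "space (param_measure k) = {1..k} \<times> UNIV \<times> {0<..<1}"
  by (simp add: param_measure_def space_pair_measure)

lemma measurable_param_measure:
  assumes "\<And>j e. j \<in> {1..k} \<Longrightarrow> (\<lambda>t. F (j, e, t)) \<in> measurable unit_interval N"
  shows "F \<in> measurable (param_measure k) N"
  unfolding param_measure_def
  by (intro measurable_pair_measure_countable1) (use assms in \<open>auto intro: countable_finite\<close>)

lemma integral_param_measure:
  fixes F :: "cpoint \<Rightarrow> complex"
  assumes "\<And>j e. j \<in> {1..k} \<Longrightarrow> set_integrable lborel {0<..<1} (\<lambda>t. F (j, e, t))"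
  shows "integrable (param_measure k) F"
    and "(LINT x|param_measure k. F x) = (\<Sum>j=1..k. \<Sum>e\<in>UNIV. LINT t:{0<..<1}|lborel. F (j, e, t))" (is ?claim2)
proof -
  have 1: "integrable unit_interval (\<lambda>t. F (j, e, t))" if "j \<in> {1..k}" for j e
    using assms[OF that, of e] by (simp add: integrable_restrict_space set_integrable_def)
  interpret b: sigma_finite_measure "count_space (UNIV :: edge set)"
    by (rule sigma_finite_measure_count_space_finite) simp
  interpret c: sigma_finite_measure unit_interval
    by (rule sigma_finite_unit_interval)
  interpret bc: pair_sigma_finite "count_space (UNIV :: edge set)" unit_interval ..
  note 2 = integral_count_space_pair[of UNIV unit_interval "\<lambda>y. F (j, y)" for j,
      OF finite_UNIV_edge sigma_finite_unit_interval 1]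
  note 3 = integral_count_space_pair[of "{1..k}" _ F, OF finite_atLeastAtMost bc.sigma_finite_measure_axioms 2(1)]
  show "integrable (param_measure k) F"
    unfolding param_measure_def using 3(1) by simp
  have "(LINT x|param_measure k. F x)
      = (\<Sum>j=1..k. LINT y|(count_space UNIV \<Otimes>\<^sub>M unit_interval). F (j, y))"
    unfolding param_measure_def using 3(2) by simp
  also have "\<dots> = (\<Sum>j=1..k. \<Sum>e\<in>UNIV. LINT t|unit_interval. F (j, e, t))"
    using 2(2) by (intro sum.cong refl) blast
  also have "\<dots> = (\<Sum>j=1..k. \<Sum>e\<in>UNIV. LINT t:{0<..<1}|lborel. F (j, e, t))"
    by (simp add: integral_restrict_space set_lebesgue_integral_def)
  finally show ?claim2 .
qed

lemma integrable_count_space_pair_section: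
  fixes F :: "'a \<times> 'b \<Rightarrow> 'c::{banach, second_countable_topology}"
  assumes A: "finite A" and M: "sigma_finite_measure M"
    and F: "integrable (count_space A \<Otimes>\<^sub>M M) F" and a: "a \<in> A"
  shows "integrable M (\<lambda>y. F (a, y))"
proof -
  interpret M: sigma_finite_measure M by fact
  interpret A: sigma_finite_measure "count_space A"
    by (rule sigma_finite_measure_count_space_finite[OF A])
  interpret pair_sigma_finite "count_space A" M ..
  show ?thesis
    using AE_integrable_fst'[OF F] a by (simp add: AE_count_space)
qed

text \<open>For integrands known to be integrable only as a whole, such as those containing an arbitrary
  square integrable function, the integrability of the sections comes from Fubini's theorem.\<close>

lemma integral_param_measure_sections:
  fixes F :: "cpoint \<Rightarrow> complex"
  assumes F: "integrable (param_measure k) F"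
  shows "(LINT x|param_measure k. F x) = (\<Sum>j=1..k. \<Sum>e\<in>UNIV. LINT t:{0<..<1}|lborel. F (j, e, t))"
proof (rule integral_param_measure(2))
  fix j e assume j: "j \<in> {1..k}"
  interpret b: sigma_finite_measure "count_space (UNIV :: edge set)"
    by (rule sigma_finite_measure_count_space_finite) simp
  interpret c: sigma_finite_measure unit_interval
    by (rule sigma_finite_unit_interval)
  interpret bc: pair_sigma_finite "count_space (UNIV :: edge set)" unit_interval ..
  have "integrable (count_space UNIV \<Otimes>\<^sub>M unit_interval) (\<lambda>y. F (j, y))"
    using F unfolding param_measure_def
    by (intro integrable_count_space_pair_section[OF _ bc.sigma_finite_measure_axioms _ j]) auto
  then have "integrable unit_interval (\<lambda>t. F (j, e, t))"
    by (intro integrable_count_space_pair_section[OF _ sigma_finite_unit_interval, where F = "\<lambda>y. F (j, y)"]) auto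
  then show "set_integrable lborel {0<..<1} (\<lambda>t. F (j, e, t))"
    by (simp add: integrable_restrict_space set_integrable_def)
qed

section \<open>Cauchy theory on sectors in logarithmic coordinates\<close>

text \<open>The edges of a contour in the coordinate \<open>\<zeta>\<close> with \<open>z = exp \<zeta>\<close>, for the sector between the angles
  \<open>a\<close> and \<open>b\<close>, run through with the parameter of the contour itself. The sector becomes a rectangle, \<open>dz / z\<close>
  becomes \<open>d\<zeta>\<close>, and the two sides of a slit are different edges.\<close>

fun edge_log :: "real \<Rightarrow> real \<Rightarrow> real \<Rightarrow> edge \<Rightarrow> real \<Rightarrow> complex" where
  "edge_log \<epsilon> a b Ray_Start t = Complex (ln (1 - \<epsilon> + 2 * \<epsilon> * t)) a"
| "edge_log \<epsilon> a b Outer_Arc t = Complex (ln (1 + \<epsilon>)) (a + (b - a) * t)"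
| "edge_log \<epsilon> a b Ray_End t = Complex (ln (1 + \<epsilon> - 2 * \<epsilon> * t)) b"
| "edge_log \<epsilon> a b Inner_Arc t = Complex (ln (1 - \<epsilon>)) (b - (b - a) * t)"

fun edge_deriv :: "real \<Rightarrow> real \<Rightarrow> real \<Rightarrow> edge \<Rightarrow> real \<Rightarrow> complex" where
  "edge_deriv \<epsilon> a b Ray_Start t = of_real (2 * \<epsilon> / (1 - \<epsilon> + 2 * \<epsilon> * t))"
| "edge_deriv \<epsilon> a b Outer_Arc t = \<i> * of_real (b - a)"
| "edge_deriv \<epsilon> a b Ray_End t = of_real (- (2 * \<epsilon>) / (1 + \<epsilon> - 2 * \<epsilon> * t))"
| "edge_deriv \<epsilon> a b Inner_Arc t = - (\<i> * of_real (b - a))"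

abbreviation log_rect :: "real \<Rightarrow> real \<Rightarrow> real \<Rightarrow> complex set" where
  "log_rect \<epsilon> a b \<equiv> cbox (Complex (ln (1 - \<epsilon>)) a) (Complex (ln (1 + \<epsilon>)) b)"

abbreviation open_log_rect :: "real \<Rightarrow> real \<Rightarrow> real \<Rightarrow> complex set" where
  "open_log_rect \<epsilon> a b \<equiv> box (Complex (ln (1 - \<epsilon>)) a) (Complex (ln (1 + \<epsilon>)) b)"

lemma edge_radius_pos:
  fixes \<epsilon> t :: real
  assumes "0 < \<epsilon>" "\<epsilon> < 1" "0 \<le> t" "t \<le> 1"
  shows "0 < 1 - \<epsilon> + 2 * \<epsilon> * t" "0 < 1 + \<epsilon> - 2 * \<epsilon> * t"
    "1 - \<epsilon> \<le> 1 - \<epsilon> + 2 * \<epsilon> * t" "1 - \<epsilon> \<le> 1 + \<epsilon> - 2 * \<epsilon> * t"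
    "1 - \<epsilon> + 2 * \<epsilon> * t \<le> 1 + \<epsilon>" "1 + \<epsilon> - 2 * \<epsilon> * t \<le> 1 + \<epsilon>"
proof -
  have "0 \<le> \<epsilon> * t" "\<epsilon> * t \<le> \<epsilon>"
    using assms by (simp_all add: mult_left_le)
  then show "0 < 1 - \<epsilon> + 2 * \<epsilon> * t" "0 < 1 + \<epsilon> - 2 * \<epsilon> * t"
    "1 - \<epsilon> \<le> 1 - \<epsilon> + 2 * \<epsilon> * t" "1 - \<epsilon> \<le> 1 + \<epsilon> - 2 * \<epsilon> * t"
    "1 - \<epsilon> + 2 * \<epsilon> * t \<le> 1 + \<epsilon>" "1 + \<epsilon> - 2 * \<epsilon> * t \<le> 1 + \<epsilon>"
    using assms by linarith+
qed

lemma edge_ln_bounds: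
  fixes \<epsilon> t :: real
  assumes "0 < \<epsilon>" "\<epsilon> < 1" "0 \<le> t" "t \<le> 1"
  shows "ln (1 - \<epsilon>) \<le> ln (1 - \<epsilon> + 2 * \<epsilon> * t)" "ln (1 - \<epsilon>) \<le> ln (1 + \<epsilon> - 2 * \<epsilon> * t)"
    "ln (1 - \<epsilon> + 2 * \<epsilon> * t) \<le> ln (1 + \<epsilon>)" "ln (1 + \<epsilon> - 2 * \<epsilon> * t) \<le> ln (1 + \<epsilon>)"
  by (rule ln_mono; use edge_radius_pos[OF assms] assms in linarith)+

lemma has_vector_derivative_Complex:
  assumes "(f has_real_derivative f') (at x within S)" "(g has_real_derivative g') (at x within S)"
  shows "((\<lambda>t. Complex (f t) (g t)) has_vector_derivative Complex f' g') (at x within S)"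
proof -
  have "((\<lambda>t. of_real (f t) + \<i> * of_real (g t)) has_vector_derivative (of_real f' + \<i> * of_real g')) (at x within S)"
    using assms by (auto intro!: derivative_eq_intros simp: has_real_derivative_iff_has_vector_derivative)
  then show ?thesis by (simp add: Complex_eq)
qed

lemma edge_log_has_vector_derivative:
  assumes "0 < \<epsilon>" "\<epsilon> < 1" "0 \<le> t" "t \<le> 1"
  shows "(edge_log \<epsilon> a b e has_vector_derivative edge_deriv \<epsilon> a b e t) (at t within S)"
proof -
  note r = edge_radius_pos[OF assms]
  have eq: "edge_log \<epsilon> a b Ray_Start = (\<lambda>t. Complex (ln (1 - \<epsilon> + 2 * \<epsilon> * t)) a)"
    "edge_log \<epsilon> a b Outer_Arc = (\<lambda>t. Complex (ln (1 + \<epsilon>)) (a + (b - a) * t))"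
    "edge_log \<epsilon> a b Ray_End = (\<lambda>t. Complex (ln (1 + \<epsilon> - 2 * \<epsilon> * t)) b)"
    "edge_log \<epsilon> a b Inner_Arc = (\<lambda>t. Complex (ln (1 - \<epsilon>)) (b - (b - a) * t))"
    by (simp_all add: fun_eq_iff)
  show ?thesis
  proof (cases e)
    case Ray_Start
    have "((\<lambda>t. Complex (ln (1 - \<epsilon> + 2 * \<epsilon> * t)) a) has_vector_derivative
        Complex (2 * \<epsilon> / (1 - \<epsilon> + 2 * \<epsilon> * t)) 0) (at t within S)"
      by (rule has_vector_derivative_Complex) (use r in \<open>auto intro!: derivative_eq_intros\<close>)
    then show ?thesis using Ray_Start by (simp add: eq complex_of_real_def)
  next
    case Outer_Arc
    have "((\<lambda>t. Complex (ln (1 + \<epsilon>)) (a + (b - a) * t)) has_vector_derivative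
        Complex 0 (b - a)) (at t within S)"
      by (rule has_vector_derivative_Complex) (auto intro!: derivative_eq_intros)
    also have "Complex 0 (b - a) = \<i> * of_real (b - a)" by (simp add: complex_eq_iff)
    finally show ?thesis using Outer_Arc by (simp add: eq)
  next
    case Ray_End
    have "((\<lambda>t. Complex (ln (1 + \<epsilon> - 2 * \<epsilon> * t)) b) has_vector_derivative
        Complex (- (2 * \<epsilon>) / (1 + \<epsilon> - 2 * \<epsilon> * t)) 0) (at t within S)"
      by (rule has_vector_derivative_Complex) (use r in \<open>auto intro!: derivative_eq_intros\<close>)
    then show ?thesis using Ray_End by (simp add: eq complex_of_real_def)
  next
    case Inner_Arc
    have "((\<lambda>t. Complex (ln (1 - \<epsilon>)) (b - (b - a) * t)) has_vector_derivative
        Complex 0 (- (b - a))) (at t within S)"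
      by (rule has_vector_derivative_Complex) (auto intro!: derivative_eq_intros)
    also have "Complex 0 (- (b - a)) = - (\<i> * of_real (b - a))" by (simp add: complex_eq_iff)
    finally show ?thesis using Inner_Arc by (simp add: eq)
  qed
qed

lemma continuous_on_edge_log:
  assumes "0 < \<epsilon>" "\<epsilon> < 1"
  shows "continuous_on {0..1} (edge_log \<epsilon> a b e)"
  by (rule continuous_on_vector_derivative)
     (use edge_log_has_vector_derivative[OF assms] in auto)

lemma continuous_on_edge_deriv:
  assumes "0 < \<epsilon>" "\<epsilon> < 1"
  shows "continuous_on {0..1} (edge_deriv \<epsilon> a b e)"
proof -
  have eq: "edge_deriv \<epsilon> a b Ray_Start = (\<lambda>t. of_real (2 * \<epsilon> / (1 - \<epsilon> + 2 * \<epsilon> * t)))"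
    "edge_deriv \<epsilon> a b Outer_Arc = (\<lambda>t. \<i> * of_real (b - a))"
    "edge_deriv \<epsilon> a b Ray_End = (\<lambda>t. of_real (- (2 * \<epsilon>) / (1 + \<epsilon> - 2 * \<epsilon> * t)))"
    "edge_deriv \<epsilon> a b Inner_Arc = (\<lambda>t. - (\<i> * of_real (b - a)))"
    by (simp_all add: fun_eq_iff)
  have nz: "1 - \<epsilon> + 2 * \<epsilon> * t \<noteq> 0" "1 + \<epsilon> - 2 * \<epsilon> * t \<noteq> 0" if "t \<in> {0..1}" for t
    using edge_radius_pos[OF assms, of t] that by auto
  show ?thesis
    by (cases e) (auto simp only: eq intro!: continuous_intros dest: nz)
qed

lemma edge_log_in_rect:
  assumes "0 < \<epsilon>" "\<epsilon> < 1" "a \<le> b" "0 \<le> t" "t \<le> 1"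
  shows "edge_log \<epsilon> a b e t \<in> log_rect \<epsilon> a b"
proof -
  note r = edge_radius_pos[OF assms(1,2,4,5)]
  have "0 \<le> (b - a) * t" "(b - a) * t \<le> b - a"
    using assms by (auto simp: mult_left_le)
  then show ?thesis
    using r assms edge_ln_bounds[OF assms(1,2,4,5)] by (cases e) (auto simp: in_cbox_complex_iff)
qed

definition edge_integral :: "real \<Rightarrow> real \<Rightarrow> real \<Rightarrow> edge \<Rightarrow> (complex \<Rightarrow> complex) \<Rightarrow> complex" where
  "edge_integral \<epsilon> a b e G = (LINT t:{0<..<1}|lborel. G (edge_log \<epsilon> a b e t) * edge_deriv \<epsilon> a b e t)"

definition edge_integrable :: "real \<Rightarrow> real \<Rightarrow> real \<Rightarrow> edge \<Rightarrow> (complex \<Rightarrow> complex) \<Rightarrow> bool" where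
  "edge_integrable \<epsilon> a b e G \<longleftrightarrow>
     set_integrable lborel {0<..<1} (\<lambda>t. G (edge_log \<epsilon> a b e t) * edge_deriv \<epsilon> a b e t)"

lemma continuous_set_integrable_Ioo:
  fixes f :: "real \<Rightarrow> complex"
  assumes "continuous_on {c..d} f"
  shows "set_integrable lborel {c<..<d} f"
    and "(LINT t:{c<..<d}|lborel. f t) = integral {c..d} f"
proof -
  show i: "set_integrable lborel {c<..<d} f"
    by (rule set_integrable_subset[OF borel_integrable_atLeastAtMost'[OF assms]]) auto
  show "(LINT t:{c<..<d}|lborel. f t) = integral {c..d} f"
    using set_borel_integral_eq_integral(2)[OF i] by (simp add: integral_open_interval_real)
qed

lemma edge_integrand_continuous:
  assumes eps: "0 < \<epsilon>" "\<epsilon> < 1" and G: "continuous_on S G"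
    and S: "\<And>t. t \<in> {c..d} \<Longrightarrow> edge_log \<epsilon> a b e t \<in> S" and cd: "0 \<le> c" "d \<le> 1"
  shows "continuous_on {c..d} (\<lambda>t. G (edge_log \<epsilon> a b e t) * edge_deriv \<epsilon> a b e t)"
proof -
  have sub: "{c..d} \<subseteq> {0..1}" using cd by auto
  show ?thesis
    by (intro continuous_intros continuous_on_compose2[OF G]
        continuous_on_subset[OF continuous_on_edge_log[OF eps] sub]
        continuous_on_subset[OF continuous_on_edge_deriv[OF eps] sub])
       (use S in auto)
qed

lemma edge_integral_primitive:
  assumes eps: "0 < \<epsilon>" "\<epsilon> < 1" and G: "continuous_on S G"
    and h: "\<And>x. x \<in> S \<Longrightarrow> (h has_field_derivative G x) (at x within S)"
    and S: "\<And>t. t \<in> {c..d} \<Longrightarrow> edge_log \<epsilon> a b e t \<in> S" and cd: "0 \<le> c" "c \<le> d" "d \<le> 1"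
  shows "set_integrable lborel {c<..<d} (\<lambda>t. G (edge_log \<epsilon> a b e t) * edge_deriv \<epsilon> a b e t)" (is ?claim1)
    and "(LINT t:{c<..<d}|lborel. G (edge_log \<epsilon> a b e t) * edge_deriv \<epsilon> a b e t)
       = h (edge_log \<epsilon> a b e d) - h (edge_log \<epsilon> a b e c)" (is ?claim2)
proof -
  let ?L = "edge_log \<epsilon> a b" and ?D = "edge_deriv \<epsilon> a b"
  have cont: "continuous_on {c..d} (\<lambda>t. G (?L e t) * ?D e t)"
    by (rule edge_integrand_continuous[OF eps G S cd(1,3)])
  show ?claim1
    by (rule continuous_set_integrable_Ioo(1)[OF cont])
  have "((\<lambda>t. G (?L e t) * ?D e t) has_integral
      (h \<circ> ?L e) d - (h \<circ> ?L e) c) {c..d}"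
  proof (rule fundamental_theorem_of_calculus[OF cd(2)])
    fix t assume t: "t \<in> {c..d}"
    have "(h has_field_derivative G (?L e t))
        (at (?L e t) within ?L e ` {c..d})"
      by (rule DERIV_subset[OF h]) (use S t in auto)
    from field_vector_diff_chain_within[OF edge_log_has_vector_derivative[OF eps] this]
    show "(h \<circ> ?L e has_vector_derivative
        G (?L e t) * ?D e t) (at t within {c..d})"
      using t cd by (auto simp: mult.commute)
  qed
  then show ?claim2
    unfolding continuous_set_integrable_Ioo(2)[OF cont] by (simp add: integral_unique)
qed

text \<open>The rays are not parametrized linearly in \<open>\<zeta>\<close>. A segment has empty interior, so every continuous
  function on it has a primitive along it, and its integral depends on the end points only.\<close>

lemma edge_integral_linepath:
  assumes eps: "0 < \<epsilon>" "\<epsilon> < 1" and ab: "a \<le> b"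
    and G: "continuous_on (closed_segment (edge_log \<epsilon> a b e 0) (edge_log \<epsilon> a b e 1)) G"
  shows "edge_integrable \<epsilon> a b e G"
    and "(G has_contour_integral edge_integral \<epsilon> a b e G) (linepath (edge_log \<epsilon> a b e 0) (edge_log \<epsilon> a b e 1))" (is ?claim2)
proof -
  let ?L = "edge_log \<epsilon> a b"
  let ?S = "closed_segment (?L e 0) (?L e 1)"
  have mem: "?L e t \<in> ?S" if "t \<in> {0..1}" for t
  proof -
    note r = edge_radius_pos[OF eps, of t]
    have "0 \<le> (b - a) * t" "(b - a) * t \<le> b - a"
      using ab that by (auto simp: mult_left_le)
    then show ?thesis
      using r edge_ln_bounds[OF eps, of t] that eps ab
      by (cases e) (auto simp: closed_segment_same_Re closed_segment_same_Im
          closed_segment_eq_real_ivl add.commute[of \<epsilon> 1])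
  qed
  have "interior ?S = {}" by (rule interior_closed_segment_ge2) simp
  then obtain h where h: "\<And>x. x \<in> ?S \<Longrightarrow> (h has_field_derivative G x) (at x within ?S)"
    using holomorphic_convex_primitive[of ?S "{}" G] G by auto
  note p = edge_integral_primitive[OF eps G h mem, of 0 1, simplified]
  show "edge_integrable \<epsilon> a b e G"
    using p(1) by (simp add: edge_integrable_def)
  have "(G has_contour_integral (h (pathfinish (linepath (?L e 0) (?L e 1)))
      - h (pathstart (linepath (?L e 0) (?L e 1)))))
      (linepath (?L e 0) (?L e 1))"
    by (rule contour_integral_primitive[of ?S h G]) (auto intro: h)
  then show ?claim2
    using p(2) by (simp add: edge_integral_def)
qed


lemma sum_edge: "(\<Sum>e\<in>UNIV. f e) = f Ray_Start + f Outer_Arc + f Ray_End + (f Inner_Arc :: complex)"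
  by (simp add: UNIV_edge add.assoc)

lemma rectpath_edges:
  assumes eps: "0 < \<epsilon>" "\<epsilon> < 1" and ab: "a \<le> b"
    and G: "continuous_on (path_image (rectpath (Complex (ln (1 - \<epsilon>)) a) (Complex (ln (1 + \<epsilon>)) b))) G"
  shows "edge_integrable \<epsilon> a b e G"
    and "(G has_contour_integral (\<Sum>e\<in>UNIV. edge_integral \<epsilon> a b e G))
       (rectpath (Complex (ln (1 - \<epsilon>)) a) (Complex (ln (1 + \<epsilon>)) b))" (is ?claim2)
proof -
  have le: "ln (1 - \<epsilon>) \<le> ln (1 + \<epsilon>)" using eps by simp
  have "closed_segment (edge_log \<epsilon> a b e 0) (edge_log \<epsilon> a b e 1)
      \<subseteq> path_image (rectpath (Complex (ln (1 - \<epsilon>)) a) (Complex (ln (1 + \<epsilon>)) b))" for e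
    using le ab by (cases e) (auto simp: path_image_rectpath closed_segment_same_Re
        closed_segment_same_Im closed_segment_eq_real_ivl add.commute[of \<epsilon> 1])
  note l = edge_integral_linepath[OF eps ab continuous_on_subset[OF G this]]
  show "edge_integrable \<epsilon> a b e G" by (rule l(1))
  have "(G has_contour_integral (edge_integral \<epsilon> a b Ray_Start G + (edge_integral \<epsilon> a b Outer_Arc G
      + (edge_integral \<epsilon> a b Ray_End G + edge_integral \<epsilon> a b Inner_Arc G))))
       (rectpath (Complex (ln (1 - \<epsilon>)) a) (Complex (ln (1 + \<epsilon>)) b))"
    unfolding rectpath_def Let_def
    using l(2)[of Ray_Start] l(2)[of Outer_Arc] l(2)[of Ray_End] l(2)[of Inner_Arc]
    by (intro has_contour_integral_join) (auto intro!: valid_path_join simp: add.commute[of \<epsilon> 1])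
  then show ?claim2
    by (simp add: sum_edge add.assoc)
qed

lemma cauchy_edges:
  assumes eps: "0 < \<epsilon>" "\<epsilon> < 1" and ab: "a \<le> b"
    and G: "continuous_on (log_rect \<epsilon> a b) G" "G holomorphic_on open_log_rect \<epsilon> a b"
  shows "(\<Sum>e\<in>UNIV. edge_integral \<epsilon> a b e G) = 0"
proof -
  let ?g = "rectpath (Complex (ln (1 - \<epsilon>)) a) (Complex (ln (1 + \<epsilon>)) b)"
  have sub: "path_image ?g \<subseteq> log_rect \<epsilon> a b"
    by (rule path_image_rectpath_subset_cbox) (use eps ab in auto)
  have "(G has_contour_integral 0) ?g"
    by (rule Cauchy_theorem_convex[of _ G "{}"])
       (use G sub in \<open>auto simp: interior_cbox intro: holomorphic_on_imp_differentiable_at[OF G(2) open_box]\<close>)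
  with rectpath_edges(2)[OF eps ab continuous_on_subset[OF G(1) sub]] show ?thesis
    by (rule has_contour_integral_unique)
qed

lemma cauchy_formula_edges:
  assumes eps: "0 < \<epsilon>" "\<epsilon> < 1" and z: "z \<in> open_log_rect \<epsilon> a b"
    and G: "continuous_on (log_rect \<epsilon> a b) G" "G holomorphic_on open_log_rect \<epsilon> a b"
  shows "edge_integrable \<epsilon> a b e (\<lambda>w. G w / (w - z))"
    and "(\<Sum>e\<in>UNIV. edge_integral \<epsilon> a b e (\<lambda>w. G w / (w - z))) = 2 * pi * \<i> * G z" (is ?claim2)
proof -
  let ?g = "rectpath (Complex (ln (1 - \<epsilon>)) a) (Complex (ln (1 + \<epsilon>)) b)"
  have ab: "a \<le> b" using z by (auto simp: in_box_complex_iff)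
  have le: "ln (1 - \<epsilon>) \<le> ln (1 + \<epsilon>)" using eps by simp
  have sub: "path_image ?g \<subseteq> log_rect \<epsilon> a b - {z}"
    using path_image_rectpath_cbox_minus_box[of "Complex (ln (1 - \<epsilon>)) a" "Complex (ln (1 + \<epsilon>)) b"]
      le ab z by auto
  have cont: "continuous_on (path_image ?g) (\<lambda>w. G w / (w - z))"
    by (rule continuous_on_subset[OF _ sub])
       (auto intro!: continuous_intros continuous_on_subset[OF G(1)])
  show "edge_integrable \<epsilon> a b e (\<lambda>w. G w / (w - z))"
    by (rule rectpath_edges(1)[OF eps ab cont])
  have "((\<lambda>w. G w / (w - z)) has_contour_integral 2 * pi * \<i> * winding_number ?g z * G z) ?g"
    by (rule Cauchy_integral_formula_weak[of "log_rect \<epsilon> a b" "{}"])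
       (use G sub z in \<open>auto simp: interior_cbox intro: holomorphic_on_imp_differentiable_at[OF G(2) open_box]\<close>)
  then show ?claim2
    using rectpath_edges(2)[OF eps ab cont] winding_number_rectpath[OF z]
    by (auto dest: has_contour_integral_unique)
qed

section \<open>Simple poles on the unit circle\<close>

text \<open>This is \<open>- 2 \<i> sinh (x / 2)\<close>, normalized to have the value \<open>2 sin (\<theta> / 2)\<close> at \<open>x = \<i> \<theta>\<close>.\<close>

definition half_sine :: "complex \<Rightarrow> complex" where
  "half_sine x = - \<i> * (exp (x / 2) - exp (- (x / 2)))"

text \<open>In terms of \<open>z = exp \<zeta>\<close> this is \<open>z / (z - cis \<alpha>)\<close>.\<close>

definition circle_pole :: "real \<Rightarrow> complex \<Rightarrow> complex" where
  "circle_pole \<alpha> \<zeta> = exp (\<zeta> - \<i> * of_real \<alpha>) / (exp (\<zeta> - \<i> * of_real \<alpha>) - 1)"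

lemma Re_half_sine: "Re (half_sine x) = (exp (Re x / 2) + exp (- (Re x / 2))) * sin (Im x / 2)"
  by (simp add: half_sine_def Re_exp Im_exp algebra_simps)

lemma Re_half_sine_nonneg: "0 \<le> Im x \<Longrightarrow> Im x \<le> 2 * pi \<Longrightarrow> 0 \<le> Re (half_sine x)"
  unfolding Re_half_sine by (intro mult_nonneg_nonneg sin_ge_zero) (auto intro: add_nonneg_nonneg)

lemma Re_half_sine_pos: "0 < Im x \<Longrightarrow> Im x < 2 * pi \<Longrightarrow> 0 < Re (half_sine x)"
  unfolding Re_half_sine by (intro mult_pos_pos sin_gt_zero) (auto intro: add_pos_pos)

lemma exp_minus_one_half_sine: "exp x - 1 = \<i> * exp (x / 2) * half_sine x"
proof -
  have "exp x = exp (x / 2) * exp (x / 2)" by (simp flip: exp_add)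
  moreover have "exp (x / 2) * exp (- (x / 2)) = 1" by (simp flip: exp_add)
  ultimately show ?thesis by (simp add: half_sine_def algebra_simps)
qed

lemma circle_pole_half_sine:
  "circle_pole \<alpha> \<zeta> = - \<i> * exp ((\<zeta> - \<i> * of_real \<alpha>) / 2) / half_sine (\<zeta> - \<i> * of_real \<alpha>)"
proof -
  let ?x = "\<zeta> - \<i> * of_real \<alpha>"
  have "exp ?x = exp (?x / 2) * exp (?x / 2)" by (simp only: exp_add[symmetric]) simp
  then have "circle_pole \<alpha> \<zeta> = (exp (?x / 2) * exp (?x / 2)) / (\<i> * exp (?x / 2) * half_sine ?x)"
    unfolding circle_pole_def exp_minus_one_half_sine by simp
  also have "\<dots> = exp (?x / 2) / (\<i> * half_sine ?x)" by simp
  also have "\<dots> = - \<i> * exp (?x / 2) / half_sine ?x"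
    by (cases "half_sine ?x = 0") (auto simp: field_simps)
  finally show ?thesis .
qed

lemma half_sine_nonzero: "exp x \<noteq> 1 \<Longrightarrow> half_sine x \<noteq> 0"
  using exp_minus_one_half_sine[of x] by auto

lemma continuous_on_half_sine [continuous_intros]:
  "continuous_on S f \<Longrightarrow> continuous_on S (\<lambda>x. half_sine (f x))"
  unfolding half_sine_def by (intro continuous_intros) auto

lemma holomorphic_on_half_sine [holomorphic_intros]:
  "f holomorphic_on S \<Longrightarrow> (\<lambda>x. half_sine (f x)) holomorphic_on S"
  unfolding half_sine_def by (intro holomorphic_intros) auto

lemma Re_edge_log_eq_0:
  assumes eps: "0 < \<epsilon>" "\<epsilon> < 1" and t: "0 < t" "t < 1" and "Re (edge_log \<epsilon> a b e t) = 0"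
  shows "t = 1 / 2" "e = Ray_Start \<or> e = Ray_End"
proof -
  note r = edge_radius_pos[OF eps, of t]
  show "t = 1 / 2" using assms r by (cases e) auto
  show "e = Ray_Start \<or> e = Ray_End" using assms by (cases e) auto
qed


lemma edge_integral_cong:
  assumes "\<And>t. 0 < t \<Longrightarrow> t < 1 \<Longrightarrow> F (edge_log \<epsilon> a b e t) = G (edge_log \<epsilon> a b e t)"
  shows "edge_integral \<epsilon> a b e F = edge_integral \<epsilon> a b e G"
  unfolding edge_integral_def
  by (intro set_lebesgue_integral_cong) (use assms in auto)

text \<open>The pole at \<open>\<i> \<alpha>\<close>, or its translate by \<open>2\<pi>\<i>\<close>, may lie on the boundary of the rectangle. Adding
  \<open>1 / (n + 1)\<close> to \<open>half_sine\<close> moves the denominator into the open right half-plane on the whole closed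
  rectangle and increases its modulus, so that Cauchy's theorem holds for the modified integrand and the
  original one is an integrable bound.\<close>

lemma edge_integral_pole_outside:
  assumes eps: "0 < \<epsilon>" "\<epsilon> < 1" and ab: "a \<le> b" and \<alpha>: "\<alpha> \<le> a" "b \<le> \<alpha> + 2 * pi"
    and H: "continuous_on (log_rect \<epsilon> a b) H" "H holomorphic_on open_log_rect \<epsilon> a b"
    and int: "\<And>e. edge_integrable \<epsilon> a b e (\<lambda>\<zeta>. H \<zeta> * circle_pole \<alpha> \<zeta>)"
  shows "(\<Sum>e\<in>UNIV. edge_integral \<epsilon> a b e (\<lambda>\<zeta>. H \<zeta> * circle_pole \<alpha> \<zeta>)) = 0"
proof -
  let ?L = "edge_log \<epsilon> a b"
  let ?Q = "\<lambda>\<zeta>. H \<zeta> * circle_pole \<alpha> \<zeta>"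
  let ?I = "\<lambda>e F t. indicator {0<..<1} t *\<^sub>R (F (?L e t) * edge_deriv \<epsilon> a b e t)"
  let ?x = "\<lambda>\<zeta>. \<zeta> - \<i> * of_real \<alpha>"
  define G where "G n \<zeta> = H \<zeta> * (- \<i> * exp (?x \<zeta> / 2) / (half_sine (?x \<zeta>) + of_real (1 / real (Suc n))))"
    for n \<zeta>
  have nonneg: "0 \<le> Re (half_sine (?x \<zeta>))" if "\<zeta> \<in> log_rect \<epsilon> a b" for \<zeta>
    using that \<alpha> by (intro Re_half_sine_nonneg) (auto simp: in_cbox_complex_iff)
  have nz: "half_sine (?x \<zeta>) + of_real (1 / real (Suc n)) \<noteq> 0" if "\<zeta> \<in> log_rect \<epsilon> a b" for \<zeta> n
  proof -
    have "0 < Re (half_sine (?x \<zeta>) + of_real (1 / real (Suc n)))"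
      using nonneg[OF that] by (simp add: add_nonneg_pos)
    then show ?thesis by (metis less_irrefl zero_complex.simps(1))
  qed
  have contG: "continuous_on (log_rect \<epsilon> a b) (G n)" for n
    unfolding G_def by (intro continuous_intros H ballI nz) auto
  have sub: "open_log_rect \<epsilon> a b \<subseteq> log_rect \<epsilon> a b" by (rule box_subset_cbox)
  have zero: "(\<Sum>e\<in>UNIV. edge_integral \<epsilon> a b e (G n)) = 0" for n
  proof (rule cauchy_edges[OF eps ab contG])
    show "G n holomorphic_on open_log_rect \<epsilon> a b"
      unfolding G_def by (intro holomorphic_intros H nz subsetD[OF sub]) simp_all
  qed
  have lim: "(\<lambda>n. edge_integral \<epsilon> a b e (G n)) \<longlonglongrightarrow> edge_integral \<epsilon> a b e (\<lambda>\<zeta>. H \<zeta> * circle_pole \<alpha> \<zeta>)" for e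
    unfolding edge_integral_def set_lebesgue_integral_def
  proof (rule integral_dominated_convergence[where w = "\<lambda>t. norm (?I e ?Q t)"])
    show "integrable lborel (\<lambda>t. norm (?I e ?Q t))"
      using int[of e] unfolding edge_integrable_def set_integrable_def by (rule integrable_norm)
    show "(\<lambda>t. ?I e ?Q t) \<in> borel_measurable lborel"
      using int[of e] unfolding edge_integrable_def set_integrable_def by (rule borel_measurable_integrable)
    have "continuous_on {0..1} (\<lambda>t. G n (?L e t) * edge_deriv \<epsilon> a b e t)" for n
      by (rule edge_integrand_continuous[OF eps contG[of n]]) (auto intro: edge_log_in_rect[OF eps ab])
    then show "(\<lambda>t. ?I e (G n) t)
        \<in> borel_measurable lborel" for n
      using continuous_set_integrable_Ioo(1) unfolding set_integrable_def
      by (blast intro: borel_measurable_integrable)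
    have S_nz: "half_sine (?x (?L e t)) \<noteq> 0" if t: "0 < t" "t < 1" "t \<noteq> 1 / 2" for t
    proof (rule half_sine_nonzero, rule)
      assume "exp (?x (?L e t)) = 1"
      then have "cmod (exp (?x (?L e t))) = 1" by simp
      then have "Re (?L e t) = 0" by simp
      from Re_edge_log_eq_0(1)[OF eps t(1,2) this] t(3) show False by simp
    qed
    have ae: "AE t in lborel. t \<noteq> (1 / 2 :: real)" by (rule AE_lborel_singleton)
    show "AE t in lborel. (\<lambda>n. ?I e (G n) t)
       \<longlonglongrightarrow> ?I e ?Q t"
      using ae
    proof (eventually_elim)
      fix t :: real assume t: "t \<noteq> 1 / 2"
      show "(\<lambda>n. ?I e (G n) t)
       \<longlonglongrightarrow> ?I e ?Q t"
      proof (cases "t \<in> {0<..<1}")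
        case True
        have "(\<lambda>n. 1 / real (Suc n)) \<longlonglongrightarrow> 0"
          using LIMSEQ_inverse_real_of_nat by (simp add: inverse_eq_divide)
        then have "(\<lambda>n. half_sine (?x (?L e t)) + of_real (1 / real (Suc n)))
            \<longlonglongrightarrow> half_sine (?x (?L e t)) + of_real 0"
          by (intro tendsto_add tendsto_const tendsto_of_real)
        then have "(\<lambda>n. half_sine (?x (?L e t)) + of_real (1 / real (Suc n)))
            \<longlonglongrightarrow> half_sine (?x (?L e t))"
          by simp
        moreover have "half_sine (?x (?L e t)) \<noteq> 0"
          using S_nz[of t] True t by simp
        ultimately show ?thesis
          unfolding G_def circle_pole_half_sine
          by (intro tendsto_scaleR tendsto_mult tendsto_divide tendsto_const)
      qed simp
    qed
    show "AE t in lborel. norm (?I e (G n) t)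
       \<le> norm (?I e ?Q t)" for n
      using ae
    proof (eventually_elim)
      fix t :: real assume t: "t \<noteq> 1 / 2"
      let ?z = "?L e t"
      show "norm (?I e (G n) t)
       \<le> norm (?I e ?Q t)"
      proof (cases "t \<in> {0<..<1}")
        case True
        then have z: "?z \<in> log_rect \<epsilon> a b" by (intro edge_log_in_rect[OF eps ab]) auto
        have "cmod (half_sine (?x ?z)) \<le> cmod (half_sine (?x ?z) + of_real (1 / real (Suc n)))"
        proof -
          have "(Re (half_sine (?x ?z)))\<^sup>2 \<le> (Re (half_sine (?x ?z)) + 1 / real (Suc n))\<^sup>2"
            using nonneg[OF z] by (intro power_mono) auto
          then show ?thesis by (simp add: cmod_def)
        qed
        moreover have "0 < cmod (half_sine (?x ?z))" using S_nz[of t] True t by simp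
        ultimately have "cmod (G n ?z) \<le> cmod (H ?z * circle_pole \<alpha> ?z)"
          unfolding G_def circle_pole_half_sine norm_mult norm_divide
          by (intro mult_left_mono divide_left_mono mult_pos_pos) auto
        then show ?thesis using True by (simp add: norm_mult mult_right_mono)
      qed simp
    qed
  qed
  have "(\<lambda>n. \<Sum>e\<in>UNIV. edge_integral \<epsilon> a b e (G n))
      \<longlonglongrightarrow> (\<Sum>e\<in>UNIV. edge_integral \<epsilon> a b e (\<lambda>\<zeta>. H \<zeta> * circle_pole \<alpha> \<zeta>))"
    by (intro tendsto_sum lim)
  then show ?thesis
    unfolding zero using LIMSEQ_unique tendsto_const by blast
qed

text \<open>The product of \<open>\<zeta> - \<i> \<alpha>\<close> and \<open>circle_pole \<alpha> \<zeta>\<close> extends holomorphically with the value \<open>1\<close> at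
  \<open>\<i> \<alpha>\<close>, and the height of the rectangle, at most \<open>2\<pi>\<close>, keeps all other poles away.\<close>

lemma edge_integral_pole_inside:
  assumes eps: "0 < \<epsilon>" "\<epsilon> < 1" and \<alpha>: "a < \<alpha>" "\<alpha> < b" and ab: "b \<le> a + 2 * pi"
    and H: "continuous_on (log_rect \<epsilon> a b) H" "H holomorphic_on open_log_rect \<epsilon> a b"
  shows "(\<Sum>e\<in>UNIV. edge_integral \<epsilon> a b e (\<lambda>\<zeta>. H \<zeta> * circle_pole \<alpha> \<zeta>)) = 2 * pi * \<i> * H (\<i> * of_real \<alpha>)"
proof -
  let ?L = "edge_log \<epsilon> a b"
  let ?c = "\<i> * of_real \<alpha>"
  let ?U = "{\<zeta>. Im \<zeta> < \<alpha> + 2 * pi} \<inter> {\<zeta>. Im \<zeta> > \<alpha> - 2 * pi}"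
  define E where "E \<zeta> = (if \<zeta> = ?c then 1 else (\<zeta> - ?c) * circle_pole \<alpha> \<zeta>)" for \<zeta>
  have nz: "exp (\<zeta> - ?c) - 1 \<noteq> 0" if "\<zeta> \<in> ?U" "\<zeta> \<noteq> ?c" for \<zeta>
  proof
    assume "exp (\<zeta> - ?c) - 1 = 0"
    then obtain n :: int where n: "Re \<zeta> = 0" "Im \<zeta> - \<alpha> = of_int (2 * n) * pi"
      by (auto simp: exp_eq_1)
    have "\<bar>of_int (2 * n) * pi\<bar> < 2 * pi" using that n by auto
    then have "\<bar>real_of_int n\<bar> * (2 * pi) < 1 * (2 * pi)" by (simp add: abs_mult mult_ac)
    then have "n = 0" by (simp only: mult_less_cancel_right) auto
    then show False using n that by (simp add: complex_eq_iff)
  qed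
  have openU: "open ?U" by (intro open_Int open_halfspace_Im_lt open_halfspace_Im_gt)
  have holE: "E holomorphic_on ?U"
  proof (rule no_isolated_singularity'[where K = "{?c}"])
    have "E holomorphic_on ?U - {?c} \<longleftrightarrow> (\<lambda>\<zeta>. (\<zeta> - ?c) * circle_pole \<alpha> \<zeta>) holomorphic_on ?U - {?c}"
      by (rule holomorphic_cong) (auto simp: E_def)
    also have \<dots>
      unfolding circle_pole_def by (intro holomorphic_intros) (use nz in auto)
    finally show "E holomorphic_on ?U - {?c}" .
    fix z assume "z \<in> {?c}"
    then have z: "z = ?c" by simp
    have "(exp has_field_derivative exp 0) (at (0::complex))" by (rule DERIV_exp)
    then have "((\<lambda>x. (exp x - 1) / x) \<longlongrightarrow> 1) (at (0::complex))"
      by (simp add: has_field_derivative_iff)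
    then have "((\<lambda>x. exp x / ((exp x - 1) / x)) \<longlongrightarrow> exp 0 / 1) (at (0::complex))"
      by (intro tendsto_intros) auto
    then have "((\<lambda>\<zeta>. exp (\<zeta> - ?c) / ((exp (\<zeta> - ?c) - 1) / (\<zeta> - ?c))) \<longlongrightarrow> 1) (at ?c)"
      by (simp add: at_to_0[of ?c] filterlim_filtermap)
    then have "(E \<longlongrightarrow> 1) (at ?c)"
      by (rule Lim_transform_eventually)
         (auto simp: E_def circle_pole_def eventually_at_filter mult.commute)
    then show "(E \<longlongrightarrow> E z) (at z within ?U)"
      unfolding z by (simp add: E_def tendsto_within_subset[OF _ subset_UNIV])
  qed (use openU in auto)
  have rectU: "log_rect \<epsilon> a b \<subseteq> ?U"
    using \<alpha> ab by (auto simp: in_cbox_complex_iff)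
  have c: "?c \<in> open_log_rect \<epsilon> a b"
    using \<alpha> eps by (auto simp: in_box_complex_iff)
  have "(\<Sum>e\<in>UNIV. edge_integral \<epsilon> a b e (\<lambda>\<zeta>. H \<zeta> * E \<zeta> / (\<zeta> - ?c))) = 2 * pi * \<i> * (H ?c * E ?c)"
  proof (rule cauchy_formula_edges(2)[OF eps c])
    show "continuous_on (log_rect \<epsilon> a b) (\<lambda>\<zeta>. H \<zeta> * E \<zeta>)"
      by (intro continuous_intros H continuous_on_subset[OF holomorphic_on_imp_continuous_on[OF holE] rectU])
    show "(\<lambda>\<zeta>. H \<zeta> * E \<zeta>) holomorphic_on open_log_rect \<epsilon> a b"
      by (intro holomorphic_intros H holomorphic_on_subset[OF holE] order_trans[OF box_subset_cbox rectU])
  qed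
  also have "(\<Sum>e\<in>UNIV. edge_integral \<epsilon> a b e (\<lambda>\<zeta>. H \<zeta> * E \<zeta> / (\<zeta> - ?c)))
      = (\<Sum>e\<in>UNIV. edge_integral \<epsilon> a b e (\<lambda>\<zeta>. H \<zeta> * circle_pole \<alpha> \<zeta>))"
  proof (intro sum.cong refl edge_integral_cong)
    fix e and t :: real assume t: "0 < t" "t < 1"
    have "?L e t \<noteq> ?c"
    proof
      assume eq: "?L e t = ?c"
      then have "e = Ray_Start \<or> e = Ray_End"
        by (intro Re_edge_log_eq_0(2)[OF eps t, of a b]) simp
      then show False using eq \<alpha> by (auto simp: complex_eq_iff)
    qed
    then show "H (?L e t) * E (?L e t) / (?L e t - ?c)
        = H (?L e t) * circle_pole \<alpha> (?L e t)"
      by (simp add: E_def)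
  qed
  finally show ?thesis by (simp add: E_def)
qed

text \<open>With a primitive of \<open>H\<close> on the closed rectangle the integral telescopes to the difference of its
  values at the points \<open>\<i> b\<close> and \<open>\<i> a\<close>, where the rays cross the unit circle. The integral along the
  circle has the same value.\<close>

lemma edge_integral_outer_half:
  assumes eps: "0 < \<epsilon>" "\<epsilon> < 1" and ab: "a \<le> b"
    and H: "continuous_on (log_rect \<epsilon> a b) H" "H holomorphic_on open_log_rect \<epsilon> a b"
  shows "edge_integrable \<epsilon> a b e (\<lambda>\<zeta>. if Re \<zeta> > 0 then H \<zeta> else 0)" (is ?claim1)
    and "(\<Sum>e\<in>UNIV. edge_integral \<epsilon> a b e (\<lambda>\<zeta>. if Re \<zeta> > 0 then H \<zeta> else 0))
      = \<i> * integral {a..b} (\<lambda>\<theta>. H (Complex 0 \<theta>))" (is ?claim2)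
proof -
  let ?L = "edge_log \<epsilon> a b" and ?D = "edge_deriv \<epsilon> a b"
  let ?R = "log_rect \<epsilon> a b"
  obtain h where h: "\<And>x. x \<in> ?R \<Longrightarrow> (h has_field_derivative H x) (at x within ?R)"
    using holomorphic_convex_primitive[of ?R "{}" H] H
    by (auto simp: interior_cbox intro: holomorphic_on_imp_differentiable_at[OF H(2) open_box])
  define G where "G \<zeta> = (if Re \<zeta> > 0 then H \<zeta> else 0)" for \<zeta>
  define I where "I e t = H (?L e t) * ?D e t" for e t
  have in_rect: "?L e t \<in> ?R" if "0 \<le> t" "t \<le> 1" for e t
    using edge_log_in_rect[OF eps ab that] .
  have prim: "set_integrable lborel {c<..<d} (I e)"
    "(LINT t:{c<..<d}|lborel. I e t) = h (?L e d) - h (?L e c)"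
    if "0 \<le> c" "c \<le> d" "d \<le> 1" for c d e
    unfolding I_def
    using edge_integral_primitive[OF eps H(1) h, of c d a b e] that in_rect by auto
  have pos: "0 < Re (?L Ray_Start t) \<longleftrightarrow> 1 / 2 < t"
    "0 < Re (?L Ray_End t) \<longleftrightarrow> t < 1 / 2"
    "0 < Re (?L Outer_Arc t)" "\<not> 0 < Re (?L Inner_Arc t)"
    if "0 < t" "t < 1" for t
  proof -
    have eq: "1 - \<epsilon> + 2 * \<epsilon> * t = 1 + \<epsilon> * (2 * t - 1)" "1 + \<epsilon> - 2 * \<epsilon> * t = 1 + \<epsilon> * (1 - 2 * t)"
      by (simp_all add: algebra_simps)
    have r: "0 < 1 + \<epsilon> * (2 * t - 1)" "0 < 1 + \<epsilon> * (1 - 2 * t)"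
      using edge_radius_pos(1,2)[OF eps, of t] that unfolding eq by auto
    have "0 < \<epsilon> * (2 * t - 1) \<longleftrightarrow> 1 / 2 < t" "0 < \<epsilon> * (1 - 2 * t) \<longleftrightarrow> t < 1 / 2"
      using eps by (auto simp: zero_less_mult_iff)
    then show "0 < Re (?L Ray_Start t) \<longleftrightarrow> 1 / 2 < t"
      "0 < Re (?L Ray_End t) \<longleftrightarrow> t < 1 / 2"
      unfolding edge_log.simps complex.sel eq ln_gt_zero_iff[OF r(1)] ln_gt_zero_iff[OF r(2)] by simp_all
    show "0 < Re (?L Outer_Arc t)" "\<not> 0 < Re (?L Inner_Arc t)"
      using eps by (auto simp: ln_gt_zero_iff)
  qed
  have ind: "indicator {0<..<1} t *\<^sub>R (G (?L Ray_Start t) * ?D Ray_Start t)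
      = indicator {1/2<..<1} t *\<^sub>R I Ray_Start t"
    "indicator {0<..<1} t *\<^sub>R (G (?L Outer_Arc t) * ?D Outer_Arc t)
      = indicator {0<..<1} t *\<^sub>R I Outer_Arc t"
    "indicator {0<..<1} t *\<^sub>R (G (?L Ray_End t) * ?D Ray_End t)
      = indicator {0<..<1/2} t *\<^sub>R I Ray_End t"
    "indicator {0<..<1} t *\<^sub>R (G (?L Inner_Arc t) * ?D Inner_Arc t)
      = indicator {0<..<0} t *\<^sub>R I Inner_Arc t" for t :: real
    using pos[of t] by (auto simp: G_def I_def indicator_def simp del: edge_log.simps edge_deriv.simps)
  have "edge_integrable \<epsilon> a b e G"
    unfolding edge_integrable_def set_integrable_def
    by (cases e; simp only: ind; fold set_integrable_def; rule prim; simp)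
  then show ?claim1
    by (simp add: G_def[abs_def])
  have "(\<Sum>e\<in>UNIV. edge_integral \<epsilon> a b e G) = (LINT t:{1/2<..<1}|lborel. I Ray_Start t)
      + (LINT t:{0<..<1}|lborel. I Outer_Arc t) + (LINT t:{0<..<1/2}|lborel. I Ray_End t)
      + (LINT t:{0<..<0}|lborel. I Inner_Arc t)"
    unfolding sum_edge edge_integral_def set_lebesgue_integral_def ind ..
  also have "\<dots> = h (Complex 0 b) - h (Complex 0 a)"
    by (simp add: prim add.commute[of \<epsilon> 1] set_lebesgue_integral_def[of _ "{}"])
  also have "h (Complex 0 b) - h (Complex 0 a) = integral {a..b} (\<lambda>\<theta>. \<i> * H (Complex 0 \<theta>))"
  proof (rule integral_unique[symmetric])
    have "((\<lambda>\<theta>. \<i> * H (Complex 0 \<theta>)) has_integral (h \<circ> Complex 0) b - (h \<circ> Complex 0) a) {a..b}"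
    proof (rule fundamental_theorem_of_calculus[OF ab])
      fix \<theta> assume \<theta>: "\<theta> \<in> {a..b}"
      have "Complex 0 ` {a..b} \<subseteq> ?R" using eps by (auto simp: in_cbox_complex_iff)
      then have "(h has_field_derivative H (Complex 0 \<theta>)) (at (Complex 0 \<theta>) within Complex 0 ` {a..b})"
        by (intro DERIV_subset[OF h]) (use \<theta> in auto)
      moreover have "((\<lambda>\<theta>. Complex 0 \<theta>) has_vector_derivative Complex 0 1) (at \<theta> within {a..b})"
        by (rule has_vector_derivative_Complex) (auto intro!: derivative_eq_intros)
      ultimately have "(h \<circ> Complex 0 has_vector_derivative Complex 0 1 * H (Complex 0 \<theta>)) (at \<theta> within {a..b})"
        by (intro field_vector_diff_chain_within)
      then show "(h \<circ> Complex 0 has_vector_derivative \<i> * H (Complex 0 \<theta>)) (at \<theta> within {a..b})"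
        by (simp add: Complex_eq)
    qed
    then show "((\<lambda>\<theta>. \<i> * H (Complex 0 \<theta>)) has_integral h (Complex 0 b) - h (Complex 0 a)) {a..b}"
      by simp
  qed
  finally show ?claim2
    by (simp add: G_def[abs_def])
qed

section \<open>The discrete measure as a contour integral over one sector\<close>

lemma absolute_powr_integrable:
  fixes \<beta> :: real assumes "\<beta> > 0"
  shows "set_integrable lborel {0<..<1} (\<lambda>t. \<bar>2 * t - 1\<bar> powr (\<beta> - 1))"
proof -
  let ?f = "\<lambda>x::real. \<bar>x\<bar> powr (\<beta> - 1)"
  have "((\<lambda>x. x powr (\<beta> - 1)) has_integral (1 powr (\<beta> - 1 + 1) / (\<beta> - 1 + 1))) {0..1}"
    using assms by (intro has_integral_powr_from_0) auto
  then have "?f integrable_on {0..1}"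
    by (intro has_integral_integrable, subst has_integral_cong[where g = "\<lambda>x. x powr (\<beta> - 1)"]) auto
  then have "?f absolutely_integrable_on {0..1}"
    by (rule nonnegative_absolutely_integrable_1) auto
  then have i: "integrable lborel (\<lambda>x. indicator {0..1} x *\<^sub>R ?f x)"
    unfolding set_integrable_def by (subst (asm) integrable_completion) auto
  \<comment> \<open>The halves \<open>t > 1/2\<close> and \<open>t < 1/2\<close> are affine images of \<open>(0, 1)\<close>; at \<open>t = 1/2\<close> both powers are \<open>0\<close>.\<close>
  have "integrable lborel (\<lambda>t. indicator {0..1} (- 1 + 2 * t) *\<^sub>R ?f (- 1 + 2 * t)
      + indicator {0..1} (1 + - 2 * t) *\<^sub>R ?f (1 + - 2 * t))"
    using lborel_integrable_real_affine[OF i, of 2 "- 1"] lborel_integrable_real_affine[OF i, of "- 2" 1]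
    by (intro Bochner_Integration.integrable_add) auto
  also have "(\<lambda>t. indicator {0..1} (- 1 + 2 * t) *\<^sub>R ?f (- 1 + 2 * t)
      + indicator {0..1} (1 + - 2 * t) *\<^sub>R ?f (1 + - 2 * t))
      = (\<lambda>t. indicator {0..1} t *\<^sub>R \<bar>2 * t - 1\<bar> powr (\<beta> - 1))"
  proof
    fix t :: real
    have "\<bar>1 + - 2 * t\<bar> = \<bar>2 * t - 1\<bar>" "\<bar>- 1 + 2 * t\<bar> = \<bar>2 * t - 1\<bar>" by linarith+
    moreover consider "t < 0" | "0 \<le> t" "t < 1 / 2" | "t = 1 / 2" | "1 / 2 < t" "t \<le> 1" | "1 < t"
      by linarith
    then have "indicator {0..1} (- 1 + 2 * t) + indicator {0..1} (1 + - 2 * t) = (indicator {0..1} t :: real) \<or> t = 1 / 2"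
      by cases (auto simp: indicator_def)
    ultimately show "indicator {0..1} (- 1 + 2 * t) *\<^sub>R ?f (- 1 + 2 * t)
      + indicator {0..1} (1 + - 2 * t) *\<^sub>R ?f (1 + - 2 * t) = indicator {0..1} t *\<^sub>R \<bar>2 * t - 1\<bar> powr (\<beta> - 1)"
      by (auto simp flip: distrib_right)
  qed
  finally have "set_integrable lborel {0..1} (\<lambda>t. \<bar>2 * t - 1\<bar> powr (\<beta> - 1))"
    by (simp add: set_integrable_def)
  then show ?thesis
    by (rule set_integrable_subset) auto
qed

lemma norm_circle_pole_le:
  assumes "cmod (exp \<zeta>) \<noteq> 1"
  shows "cmod (circle_pole \<alpha> \<zeta>) \<le> cmod (exp \<zeta>) / \<bar>cmod (exp \<zeta>) - 1\<bar>"
proof -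
  let ?w = "exp (\<zeta> - \<i> * of_real \<alpha>)"
  have w: "cmod ?w = cmod (exp \<zeta>)" by simp
  have "\<bar>cmod ?w - 1\<bar> \<le> cmod (?w - 1)"
    using norm_triangle_ineq3[of ?w 1] by simp
  moreover have "0 < \<bar>cmod ?w - 1\<bar>" using assms w by simp
  ultimately show ?thesis
    unfolding circle_pole_def norm_divide w by (intro divide_left_mono mult_pos_pos) auto
qed

lemma ray_radius:
  assumes eps: "0 < \<epsilon>" "\<epsilon> < 1" and t: "0 < t" "t < 1" and e: "e \<in> {Ray_Start, Ray_End}"
  shows "\<bar>cmod (exp (edge_log \<epsilon> a b e t)) - 1\<bar> = \<epsilon> * \<bar>2 * t - 1\<bar>" (is ?claim1)
    "cmod (exp (edge_log \<epsilon> a b e t)) \<le> 2" "cmod (edge_deriv \<epsilon> a b e t) \<le> 2 * \<epsilon> / (1 - \<epsilon>)"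
proof -
  note r = edge_radius_pos[OF eps, of t]
  have "\<bar>2 * \<epsilon> * t - \<epsilon>\<bar> = \<epsilon> * \<bar>2 * t - 1\<bar>" "\<bar>\<epsilon> - 2 * \<epsilon> * t\<bar> = \<epsilon> * \<bar>2 * t - 1\<bar>"
    using eps by (auto simp: abs_if algebra_simps)
  then show ?claim1
    using e r t eps by auto
  show "cmod (exp (edge_log \<epsilon> a b e t)) \<le> 2"
    using e r t eps by auto
  show "cmod (edge_deriv \<epsilon> a b e t) \<le> 2 * \<epsilon> / (1 - \<epsilon>)"
    using e r t eps by (auto simp: norm_divide abs_of_pos simp del: of_real_divide
        simp flip: of_real_minus intro!: divide_left_mono mult_pos_pos)
qed

text \<open>On a ray the pole term is at most \<open>|z| / ||z| - 1|\<close> wherever it sits on the circle, and \<open>||z| - 1|\<close> is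
  \<open>\<epsilon> |2 t - 1|\<close>. Together with the decay of \<open>H\<close> this leaves the integrable power \<open>\<beta> - 1\<close> of
  \<open>|2 t - 1|\<close>.\<close>

lemma edge_integrable_pole:
  assumes eps: "0 < \<epsilon>" "\<epsilon> < 1" and ab: "a \<le> b"
    and H: "continuous_on (log_rect \<epsilon> a b) H"
    and \<beta>: "\<beta> > 0"
    and ray: "\<And>e t. e \<in> {Ray_Start, Ray_End} \<Longrightarrow> 0 < t \<Longrightarrow> t < 1 \<Longrightarrow>
        cmod (H (edge_log \<epsilon> a b e t)) \<le> C * \<bar>2 * t - 1\<bar> powr \<beta>"
  shows "edge_integrable \<epsilon> a b e (\<lambda>\<zeta>. H \<zeta> * circle_pole \<alpha> \<zeta>)"
proof (cases "e \<in> {Ray_Start, Ray_End}")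
  case False
  have "continuous_on {0..1} (\<lambda>t. H (edge_log \<epsilon> a b e t) * circle_pole \<alpha> (edge_log \<epsilon> a b e t) * edge_deriv \<epsilon> a b e t)"
  proof (rule edge_integrand_continuous[OF eps, where S = "log_rect \<epsilon> a b \<inter> {\<zeta>. Re \<zeta> \<noteq> 0}"])
    have "exp (\<zeta> - \<i> * of_real \<alpha>) - 1 \<noteq> 0" if "Re \<zeta> \<noteq> 0" for \<zeta>
      using that by (auto simp: exp_eq_1)
    then show "continuous_on (log_rect \<epsilon> a b \<inter> {\<zeta>. Re \<zeta> \<noteq> 0}) (\<lambda>\<zeta>. H \<zeta> * circle_pole \<alpha> \<zeta>)"
      unfolding circle_pole_def
      by (intro continuous_intros continuous_on_subset[OF H]) auto
    fix t :: real assume "t \<in> {0..1}"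
    then show "edge_log \<epsilon> a b e t \<in> log_rect \<epsilon> a b \<inter> {\<zeta>. Re \<zeta> \<noteq> 0}"
      using edge_log_in_rect[OF eps ab, of t e] False eps by (cases e) auto
  qed auto
  from continuous_set_integrable_Ioo(1)[OF this] show ?thesis
    by (simp add: edge_integrable_def)
next
  case True
  let ?f = "\<lambda>t. H (edge_log \<epsilon> a b e t) * circle_pole \<alpha> (edge_log \<epsilon> a b e t) * edge_deriv \<epsilon> a b e t"
  define P where "P t = H (edge_log \<epsilon> a b e t) * edge_deriv \<epsilon> a b e t * exp (edge_log \<epsilon> a b e t - \<i> * of_real \<alpha>)" for t
  define D where "D t = exp (edge_log \<epsilon> a b e t - \<i> * of_real \<alpha>) - 1" for t
  have contP: "continuous_on {0..1} P" and contD: "continuous_on {0..1} D"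
    unfolding P_def D_def
    by (intro continuous_intros continuous_on_compose2[OF H] continuous_on_edge_log[OF eps]
        continuous_on_edge_deriv[OF eps]; use edge_log_in_rect[OF eps ab] in auto)+
  have [measurable]: "(\<lambda>t. indicator {0..1} t *\<^sub>R P t) \<in> borel_measurable borel"
      "(\<lambda>t. indicator {0..1} t *\<^sub>R D t) \<in> borel_measurable borel"
    by (intro borel_measurable_continuous_on_indicator contP contD; simp)+
  have eq: "indicator {0<..<1} t *\<^sub>R ?f t
      = indicator {0<..<1} t *\<^sub>R ((indicator {0..1} t *\<^sub>R P t) / (indicator {0..1} t *\<^sub>R D t))" for t
    by (auto simp: indicator_def P_def D_def circle_pole_def)
  let ?K = "\<bar>C\<bar> * (2 / \<epsilon>) * (2 * \<epsilon> / (1 - \<epsilon>))"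
  show ?thesis
    unfolding edge_integrable_def set_integrable_def
  proof (rule Bochner_Integration.integrable_bound)
    show "integrable lborel (\<lambda>t. indicator {0<..<1} t *\<^sub>R (?K * \<bar>2 * t - 1\<bar> powr (\<beta> - 1)))"
      unfolding set_integrable_def[symmetric]
      by (intro set_integrable_mult_right absolute_powr_integrable \<beta>)
    show "(\<lambda>t. indicator {0<..<1} t *\<^sub>R ?f t) \<in> borel_measurable lborel"
      unfolding eq by measurable
    have bound: "cmod (?f t)
        \<le> ?K * \<bar>2 * t - 1\<bar> powr (\<beta> - 1)" if t: "0 < t" "t < 1" "t \<noteq> 1 / 2" for t
    proof -
      let ?z = "edge_log \<epsilon> a b e t"
      note r = ray_radius[OF eps t(1,2) True]
      have pos: "0 < \<bar>2 * t - 1\<bar>" using t by simp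
      have "cmod (circle_pole \<alpha> ?z) \<le> cmod (exp ?z) / (\<epsilon> * \<bar>2 * t - 1\<bar>)"
      proof -
        have ne: "cmod (exp ?z) \<noteq> 1"
        proof
          assume "cmod (exp ?z) = 1"
          then have "\<epsilon> * \<bar>2 * t - 1\<bar> = 0" unfolding r(1)[of a b, symmetric] by linarith
          then show False using pos eps by simp
        qed
        show ?thesis using norm_circle_pole_le[OF ne, of \<alpha>] unfolding r(1)[of a b] .
      qed
      also have "\<dots> \<le> 2 / (\<epsilon> * \<bar>2 * t - 1\<bar>)"
        using r(2)[of a b] pos eps by (intro divide_right_mono) auto
      finally have q: "cmod (circle_pole \<alpha> ?z) \<le> 2 / (\<epsilon> * \<bar>2 * t - 1\<bar>)" .
      have "cmod (H ?z) \<le> C * \<bar>2 * t - 1\<bar> powr \<beta>" using ray True t by auto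
      also have "\<dots> \<le> \<bar>C\<bar> * \<bar>2 * t - 1\<bar> powr \<beta>" by (intro mult_right_mono) auto
      finally have h: "cmod (H ?z) \<le> \<bar>C\<bar> * \<bar>2 * t - 1\<bar> powr \<beta>" .
      have "cmod (H ?z * circle_pole \<alpha> ?z * edge_deriv \<epsilon> a b e t)
          \<le> (\<bar>C\<bar> * \<bar>2 * t - 1\<bar> powr \<beta>) * (2 / (\<epsilon> * \<bar>2 * t - 1\<bar>)) * (2 * \<epsilon> / (1 - \<epsilon>))"
        unfolding norm_mult using h q r(3)[of a b] eps
        by (intro mult_mono mult_nonneg_nonneg divide_nonneg_nonneg) auto
      also have "\<dots> = ?K * \<bar>2 * t - 1\<bar> powr (\<beta> - 1)"
        using pos eps by (simp add: powr_diff mult_ac)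
      finally show ?thesis .
    qed
    show "AE t in lborel. norm (indicator {0<..<1} t *\<^sub>R ?f t)
        \<le> norm (indicator {0<..<1} t *\<^sub>R (?K * \<bar>2 * t - 1\<bar> powr (\<beta> - 1)))"
      using AE_lborel_singleton[of "1 / 2 :: real"]
    proof eventually_elim
      fix t :: real assume t: "t \<noteq> 1 / 2"
      show "norm (indicator {0<..<1} t *\<^sub>R ?f t)
        \<le> norm (indicator {0<..<1} t *\<^sub>R (?K * \<bar>2 * t - 1\<bar> powr (\<beta> - 1)))"
      proof (cases "t \<in> {0<..<1}")
        case True
        then have "cmod (?f t)
            \<le> \<bar>?K * \<bar>2 * t - 1\<bar> powr (\<beta> - 1)\<bar>"
          using bound[of t] t by (intro order_trans[OF _ abs_ge_self]) auto
        then show ?thesis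
          unfolding indicator_simps(1)[OF True] scaleR_one real_norm_def .
      qed simp
    qed
  qed
qed

lemma sum_roots_unity_power:
  assumes "0 < m" "m < M"
  shows "(\<Sum>\<rho> | \<rho> ^ M = (1::complex). \<rho> ^ m) = 0"
proof -
  have M: "M > 0" using assms by simp
  let ?q = "cis (2 * pi * real m / real M)"
  have bij: "bij_betw (\<lambda>k. cis (2 * pi * real k / real M)) {..<M} {z. z ^ M = 1}"
    by (rule Complex.bij_betw_roots_unity[OF M])
  have "?q \<noteq> cis (2 * pi * real 0 / real M)"
    using inj_onD[OF bij_betw_imp_inj_on[OF bij], of m 0] assms by auto
  then have q: "?q \<noteq> 1" by simp
  have "?q ^ M = 1" using bij assms by (auto simp: bij_betw_def)
  have "(\<Sum>\<rho> | \<rho> ^ M = (1::complex). \<rho> ^ m) = (\<Sum>k<M. cis (2 * pi * real k / real M) ^ m)"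
    by (rule sum.reindex_bij_betw[OF bij, symmetric])
  also have "\<dots> = (\<Sum>k<M. ?q ^ k)"
    by (intro sum.cong) (simp_all add: Complex.DeMoivre mult_ac)
  also have "\<dots> = 0"
    using geometric_sum[OF q, of M] \<open>?q ^ M = 1\<close> by simp
  finally show ?thesis .
qed

text \<open>Expand \<open>(z\<^sup>M - 1) / (z - \<rho>)\<close> as a geometric sum. After summation over \<open>\<rho>\<close> only the power of
  \<open>\<rho>\<close> with exponent \<open>0\<close> survives.\<close>

lemma partial_fractions_roots_unity:
  fixes z :: complex
  assumes M: "M > 0" and z: "z ^ M \<noteq> 1"
  shows "(\<Sum>\<rho> | \<rho> ^ M = 1. z / (z - \<rho>)) = of_nat M * z ^ M / (z ^ M - 1)"
proof -
  have "(\<Sum>\<rho> | \<rho> ^ M = 1. z / (z - \<rho>)) * (z ^ M - 1)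
      = (\<Sum>\<rho> | \<rho> ^ M = 1. \<Sum>i<M. z ^ Suc i * \<rho> ^ (M - Suc i))"
    unfolding sum_distrib_right
  proof (rule sum.cong[OF refl])
    fix \<rho> :: complex assume "\<rho> \<in> {\<rho>. \<rho> ^ M = 1}"
    then have \<rho>: "\<rho> ^ M = 1" by simp
    then have "z - \<rho> \<noteq> 0" using z by auto
    moreover have "z ^ M - 1 = (z - \<rho>) * (\<Sum>i<M. \<rho> ^ (M - Suc i) * z ^ i)"
      using power_diff_sumr2[of z M \<rho>] \<rho> by simp
    ultimately have "z / (z - \<rho>) * (z ^ M - 1) = z * (\<Sum>i<M. \<rho> ^ (M - Suc i) * z ^ i)"
      by simp
    then show "z / (z - \<rho>) * (z ^ M - 1) = (\<Sum>i<M. z ^ Suc i * \<rho> ^ (M - Suc i))"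
      by (simp add: sum_distrib_left mult_ac)
  qed
  also have "\<dots> = (\<Sum>i<M. z ^ Suc i * (\<Sum>\<rho> | \<rho> ^ M = (1::complex). \<rho> ^ (M - Suc i)))"
    by (subst sum.swap) (simp add: sum_distrib_left)
  also have "\<dots> = (\<Sum>i\<in>{M - 1}. z ^ Suc i * (\<Sum>\<rho> | \<rho> ^ M = (1::complex). \<rho> ^ (M - Suc i)))"
  proof (rule sum.mono_neutral_right)
    show "\<forall>i\<in>{..<M} - {M - 1}. z ^ Suc i * (\<Sum>\<rho> | \<rho> ^ M = 1. \<rho> ^ (M - Suc i)) = 0"
    proof
      fix i assume "i \<in> {..<M} - {M - 1}"
      then have "0 < M - Suc i" "M - Suc i < M" by auto
      then show "z ^ Suc i * (\<Sum>\<rho> | \<rho> ^ M = 1. \<rho> ^ (M - Suc i)) = 0"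
        by (simp add: sum_roots_unity_power)
    qed
  qed (use M in auto)
  also have "\<dots> = of_nat M * z ^ M"
    using M card_roots_unity_eq[OF M] by simp
  finally show ?thesis using z by (simp add: field_simps)
qed

lemma v_fun_partial_fractions:
  assumes M: "M > 0" and z: "z \<noteq> 0" "cmod z \<noteq> 1"
  shows "v_fun M z = (\<Sum>\<rho> | \<rho> ^ M = 1. z / (z - \<rho>)) / of_nat M - (if cmod z > 1 then 1 else 0)"
proof -
  have "cmod (z ^ M) \<noteq> 1"
    using z M power_eq_imp_eq_base[of "cmod z" M 1] by (auto simp: norm_power)
  then have zM: "z ^ M \<noteq> 1" by auto
  have "(\<Sum>\<rho> | \<rho> ^ M = 1. z / (z - \<rho>)) / of_nat M = z ^ M / (z ^ M - 1)"
    using M by (simp add: partial_fractions_roots_unity[OF M zM])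
  moreover have "v_fun M z = z ^ M / (z ^ M - 1) - (if cmod z > 1 then 1 else 0)"
  proof (cases "cmod z < 1")
    case True
    then show ?thesis
      by (simp add: v_fun_def minus_divide_right)
  next
    case False
    then have "cmod z > 1" using z by simp
    then show ?thesis using zM z(1)
      by (simp add: v_fun_def power_int_minus field_simps)
  qed
  ultimately show ?thesis by simp
qed

lemma circle_angle_exists:
  assumes "cmod z = 1"
  shows "\<exists>\<theta>\<in>{a..<a + 2 * pi}. cis \<theta> = z"
proof -
  let ?n = "\<lfloor>(Arg2pi z - a) / (2 * pi)\<rfloor>"
  let ?\<theta> = "Arg2pi z - 2 * pi * of_int ?n"
  have "of_int ?n * (2 * pi) \<le> Arg2pi z - a" "Arg2pi z - a < (of_int ?n + 1) * (2 * pi)"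
    by (rule floor_divide_lower floor_divide_upper; simp)+
  then have "?\<theta> \<in> {a..<a + 2 * pi}" by (simp add: algebra_simps)
  moreover have "cis ?\<theta> = cis (Arg2pi z)"
    by (simp flip: cis_divide add: cis_multiple_2pi)
  moreover have "cis (Arg2pi z) = z"
    using assms by (simp add: complex_norm_eq_1_exp cis_conv_exp)
  ultimately show ?thesis by metis
qed

lemma cis_inj_on_period: "inj_on cis {a..<a + 2 * pi}"
proof (rule inj_onI)
  fix x y assume xy: "x \<in> {a..<a + 2 * pi}" "y \<in> {a..<a + 2 * pi}" and "cis x = cis y"
  then have "exp (\<i> * of_real x) = exp (\<i> * of_real y)" by (simp add: cis_conv_exp)
  then have "\<i> * of_real x = \<i> * of_real y"
    by (rule exp_complex_eqI[rotated]) (use xy in auto)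
  then show "x = y" by simp
qed

lemma bij_betw_cis_roots_unity:
  assumes "M > 0"
  shows "bij_betw cis {\<theta>\<in>{a..<a + 2 * pi}. cis \<theta> ^ M = 1} {\<rho>. \<rho> ^ M = 1}"
  unfolding bij_betw_def
proof
  show "inj_on cis {\<theta>\<in>{a..<a + 2 * pi}. cis \<theta> ^ M = 1}"
    by (rule inj_on_subset[OF cis_inj_on_period]) auto
  have "\<rho> \<in> cis ` {\<theta>\<in>{a..<a + 2 * pi}. cis \<theta> ^ M = 1}" if "\<rho> ^ M = 1" for \<rho>
  proof -
    have "cmod \<rho> ^ M = 1" using that by (metis norm_power norm_one)
    then have "cmod \<rho> = 1" using assms power_eq_imp_eq_base[of "cmod \<rho>" M 1] by simp
    from circle_angle_exists[OF this, of a] show ?thesis using that by auto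
  qed
  then show "cis ` {\<theta>\<in>{a..<a + 2 * pi}. cis \<theta> ^ M = 1} = {\<rho>. \<rho> ^ M = 1}" by auto
qed

lemma circle_pole_eq: "circle_pole \<alpha> \<zeta> = exp \<zeta> / (exp \<zeta> - cis \<alpha>)"
proof -
  have "exp (\<zeta> - \<i> * of_real \<alpha>) = exp \<zeta> / cis \<alpha>"
    by (simp add: exp_diff cis_conv_exp)
  moreover have "exp \<zeta> / cis \<alpha> - 1 = (exp \<zeta> - cis \<alpha>) / cis \<alpha>"
    by (simp add: diff_divide_distrib)
  ultimately show ?thesis
    by (simp add: circle_pole_def)
qed

lemma edge_integral_add:
  assumes "edge_integrable \<epsilon> a b e F" "edge_integrable \<epsilon> a b e G"
  shows "edge_integrable \<epsilon> a b e (\<lambda>\<zeta>. F \<zeta> + G \<zeta>)"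
    "edge_integral \<epsilon> a b e (\<lambda>\<zeta>. F \<zeta> + G \<zeta>) = edge_integral \<epsilon> a b e F + edge_integral \<epsilon> a b e G"
  using set_integral_add[OF assms[unfolded edge_integrable_def]]
  by (simp_all add: edge_integrable_def edge_integral_def algebra_simps)

lemma edge_integral_scale:
  assumes "edge_integrable \<epsilon> a b e F"
  shows "edge_integrable \<epsilon> a b e (\<lambda>\<zeta>. c * F \<zeta>)"
    "edge_integral \<epsilon> a b e (\<lambda>\<zeta>. c * F \<zeta>) = c * edge_integral \<epsilon> a b e F"
  using assms set_integrable_mult_right[of c lborel "{0<..<1}" "\<lambda>t. F (edge_log \<epsilon> a b e t) * edge_deriv \<epsilon> a b e t"]
  by (simp_all add: edge_integrable_def edge_integral_def mult.assoc)

lemma edge_integral_sum: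
  assumes "finite A" "\<And>i. i \<in> A \<Longrightarrow> edge_integrable \<epsilon> a b e (F i)"
  shows "edge_integrable \<epsilon> a b e (\<lambda>\<zeta>. \<Sum>i\<in>A. F i \<zeta>) \<and>
    edge_integral \<epsilon> a b e (\<lambda>\<zeta>. \<Sum>i\<in>A. F i \<zeta>) = (\<Sum>i\<in>A. edge_integral \<epsilon> a b e (F i))"
  using assms
proof (induction A rule: finite_induct)
  case empty
  show ?case by (simp add: edge_integrable_def edge_integral_def set_integrable_def set_lebesgue_integral_def)
next
  case (insert i A)
  then show ?case by (simp add: edge_integral_add)
qed

text \<open>Apply the partial fractions of \<open>v\<close> term by term. Every root of unity has one argument in
  \<open>[a, a + 2\<pi>)\<close>; it contributes a residue if the argument lies in \<open>(a, b)\<close> and nothing otherwise.\<close>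

lemma sector_formula:
  assumes eps: "0 < \<epsilon>" "\<epsilon> < 1" and ab: "a < b" "b \<le> a + 2 * pi" and M: "M > 0"
    and H: "continuous_on (log_rect \<epsilon> a b) H" "H holomorphic_on open_log_rect \<epsilon> a b"
    and \<beta>: "\<beta> > 0"
    and ray: "\<And>e t. e \<in> {Ray_Start, Ray_End} \<Longrightarrow> 0 < t \<Longrightarrow> t < 1 \<Longrightarrow>
        cmod (H (edge_log \<epsilon> a b e t)) \<le> C * \<bar>2 * t - 1\<bar> powr \<beta>"
  shows "edge_integrable \<epsilon> a b e (\<lambda>\<zeta>. H \<zeta> * v_fun M (exp \<zeta>))"
    and "(\<Sum>e\<in>UNIV. edge_integral \<epsilon> a b e (\<lambda>\<zeta>. H \<zeta> * v_fun M (exp \<zeta>)))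
      = 2 * pi * \<i> / of_nat M * (\<Sum>\<theta> | \<theta> \<in> {a<..<b} \<and> cis \<theta> ^ M = 1. H (\<i> * of_real \<theta>))
        - \<i> * integral {a..b} (\<lambda>\<theta>. H (Complex 0 \<theta>))" (is ?claim2)
proof -
  let ?L = "edge_log \<epsilon> a b"
  let ?A = "{\<theta>\<in>{a..<a + 2 * pi}. cis \<theta> ^ M = 1}"
  have bij: "bij_betw cis ?A {\<rho>. \<rho> ^ M = 1}" by (rule bij_betw_cis_roots_unity[OF M])
  have finA: "finite ?A"
    using bij_betw_finite[OF bij] M by (simp add: finite_roots_unity)
  have pole_int: "edge_integrable \<epsilon> a b e (\<lambda>\<zeta>. H \<zeta> * circle_pole \<alpha> \<zeta>)" for \<alpha> e
    by (rule edge_integrable_pole[OF eps less_imp_le[OF ab(1)] H(1) \<beta> ray])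
  have pole: "(\<Sum>e\<in>UNIV. edge_integral \<epsilon> a b e (\<lambda>\<zeta>. H \<zeta> * circle_pole \<alpha> \<zeta>))
      = (if \<alpha> \<in> {a<..<b} then 2 * pi * \<i> * H (\<i> * of_real \<alpha>) else 0)" if \<alpha>: "\<alpha> \<in> ?A" for \<alpha>
  proof -
    consider "\<alpha> \<in> {a<..<b}" | "\<alpha> = a" | "b \<le> \<alpha>" "\<alpha> < a + 2 * pi"
      using \<alpha> by fastforce
    then show ?thesis
    proof cases
      case 1
      then show ?thesis using edge_integral_pole_inside[OF eps _ _ ab(2) H] by simp
    next
      case 2
      then show ?thesis
        using edge_integral_pole_outside[OF eps less_imp_le[OF ab(1)] _ _ H pole_int, of a] ab by simp
    next
      \<comment> \<open>Lowering the argument by \<open>2\<pi>\<close> puts it below the rectangle.\<close>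
      case 3
      have "cis (\<alpha> - 2 * pi) = cis \<alpha>" by (simp flip: cis_divide)
      then have "circle_pole (\<alpha> - 2 * pi) = circle_pole \<alpha>" by (simp add: fun_eq_iff circle_pole_eq)
      then show ?thesis
        using edge_integral_pole_outside[OF eps less_imp_le[OF ab(1)] _ _ H pole_int, of "\<alpha> - 2 * pi"] 3 by simp
    qed
  qed
  let ?V = "\<lambda>\<zeta>. (1 / of_nat M) * (\<Sum>\<alpha>\<in>?A. H \<zeta> * circle_pole \<alpha> \<zeta>) + (- 1) * (if Re \<zeta> > 0 then H \<zeta> else 0)"
  let ?f = "\<lambda>e t. H (?L e t) * v_fun M (exp (?L e t)) * edge_deriv \<epsilon> a b e t"
  let ?g = "\<lambda>e t. ?V (?L e t) * edge_deriv \<epsilon> a b e t"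
  note half = edge_integral_outer_half[OF eps less_imp_le[OF ab(1)] H]
  note sum = edge_integral_sum[OF finA pole_int]
  have V: "H \<zeta> * v_fun M (exp \<zeta>) = ?V \<zeta>" if "Re \<zeta> \<noteq> 0" for \<zeta>
  proof -
    have "v_fun M (exp \<zeta>) = (\<Sum>\<rho> | \<rho> ^ M = 1. exp \<zeta> / (exp \<zeta> - \<rho>)) / of_nat M - (if Re \<zeta> > 0 then 1 else 0)"
      using that by (subst v_fun_partial_fractions[OF M]) auto
    also have "(\<Sum>\<rho> | \<rho> ^ M = 1. exp \<zeta> / (exp \<zeta> - \<rho>)) = (\<Sum>\<alpha>\<in>?A. circle_pole \<alpha> \<zeta>)"
      unfolding circle_pole_eq by (rule sum.reindex_bij_betw[OF bij, symmetric])
    finally show ?thesis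
      by (simp add: sum_distrib_left[symmetric] right_diff_distrib)
  qed
  have intV: "edge_integrable \<epsilon> a b e ?V"
    and eqV: "edge_integral \<epsilon> a b e ?V = (1 / of_nat M) * (\<Sum>\<alpha>\<in>?A. edge_integral \<epsilon> a b e (\<lambda>\<zeta>. H \<zeta> * circle_pole \<alpha> \<zeta>))
        + (- 1) * edge_integral \<epsilon> a b e (\<lambda>\<zeta>. if Re \<zeta> > 0 then H \<zeta> else 0)" for e
  proof -
    note s = edge_integral_scale[OF conjunct1[OF sum[where e = e]], of "1 / of_nat M"]
    note h = edge_integral_scale[OF half(1)[of e], of "- 1"]
    show "edge_integrable \<epsilon> a b e ?V" by (rule edge_integral_add(1)[OF s(1) h(1)])
    show "edge_integral \<epsilon> a b e ?V = (1 / of_nat M) * (\<Sum>\<alpha>\<in>?A. edge_integral \<epsilon> a b e (\<lambda>\<zeta>. H \<zeta> * circle_pole \<alpha> \<zeta>))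
        + (- 1) * edge_integral \<epsilon> a b e (\<lambda>\<zeta>. if Re \<zeta> > 0 then H \<zeta> else 0)"
      unfolding edge_integral_add(2)[OF s(1) h(1)] s(2) h(2) conjunct2[OF sum[where e = e]] ..
  qed
  \<comment> \<open>At \<open>t = 1/2\<close> the rays cross the unit circle, where \<open>v\<close> is not given by the partial fractions.\<close>
  have ae: "AE t in lborel. t \<in> {0<..<1} \<longrightarrow>
      ?f e t
      = ?g e t" for e
    using AE_lborel_singleton[of "1 / 2 :: real"]
  proof eventually_elim
    case (elim t)
    show ?case
    proof
      assume "t \<in> {0<..<1}"
      then have "Re (?L e t) \<noteq> 0"
        using Re_edge_log_eq_0(1)[OF eps, of t a b e] elim by auto
      from V[OF this] show "?f e t
          = ?g e t" by simp
    qed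
  qed
  have meas: "set_borel_measurable lborel {0<..<1}
      (\<lambda>t. ?f e t)" for e
  proof -
    have "(\<lambda>t. indicator {0<..<1} t *\<^sub>R ?g e t) \<in> borel_measurable lborel"
      using intV[of e] unfolding edge_integrable_def set_integrable_def by (rule borel_measurable_integrable)
    then show ?thesis
      unfolding set_borel_measurable_def
    proof (rule measurable_discrete_difference[where X = "{1 / 2}"])
      fix t :: real assume "t \<notin> {1 / 2}"
      then show "indicator {0<..<1} t *\<^sub>R ?g e t
          = indicator {0<..<1} t *\<^sub>R ?f e t"
      proof (cases "t \<in> {0<..<1}")
        case True
        then have "Re (?L e t) \<noteq> 0"
          using Re_edge_log_eq_0(1)[OF eps, of t a b e] \<open>t \<notin> {1 / 2}\<close> by auto
        from V[OF this] show ?thesis by argo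
      qed simp
    qed auto
  qed
  have measV: "set_borel_measurable lborel {0<..<1} (\<lambda>t. ?g e t)" for e
    using intV[of e] unfolding edge_integrable_def set_integrable_def set_borel_measurable_def
    by (rule borel_measurable_integrable)
  have int: "edge_integrable \<epsilon> a b e (\<lambda>\<zeta>. H \<zeta> * v_fun M (exp \<zeta>))" for e
    using intV[of e] meas[of e] measV[of e] ae[of e]
    unfolding edge_integrable_def set_integrable_def set_borel_measurable_def
    by (subst integrable_cong_AE) (auto elim!: eventually_mono simp: indicator_def)
  then show "edge_integrable \<epsilon> a b e (\<lambda>\<zeta>. H \<zeta> * v_fun M (exp \<zeta>))" .
  have eq: "edge_integral \<epsilon> a b e (\<lambda>\<zeta>. H \<zeta> * v_fun M (exp \<zeta>)) = edge_integral \<epsilon> a b e ?V" for e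
    unfolding edge_integral_def set_lebesgue_integral_def
    by (rule integral_cong_AE)
       (use meas[of e] measV[of e] ae[of e] in
          \<open>auto simp: set_borel_measurable_def indicator_def elim!: eventually_mono\<close>)
  have "(\<Sum>e\<in>UNIV. edge_integral \<epsilon> a b e (\<lambda>\<zeta>. H \<zeta> * v_fun M (exp \<zeta>)))
      = (1 / of_nat M) * (\<Sum>e\<in>UNIV. \<Sum>\<alpha>\<in>?A. edge_integral \<epsilon> a b e (\<lambda>\<zeta>. H \<zeta> * circle_pole \<alpha> \<zeta>))
        + (- 1) * (\<Sum>e\<in>UNIV. edge_integral \<epsilon> a b e (\<lambda>\<zeta>. if Re \<zeta> > 0 then H \<zeta> else 0))"
    unfolding eq eqV by (simp only: sum.distrib sum_distrib_left)
  also have "(\<Sum>e\<in>UNIV. \<Sum>\<alpha>\<in>?A. edge_integral \<epsilon> a b e (\<lambda>\<zeta>. H \<zeta> * circle_pole \<alpha> \<zeta>))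
      = (\<Sum>\<alpha>\<in>?A. if \<alpha> \<in> {a<..<b} then 2 * pi * \<i> * H (\<i> * of_real \<alpha>) else 0)"
    by (subst sum.swap) (intro sum.cong refl pole)
  also have "\<dots> = (\<Sum>\<theta> | \<theta> \<in> {a<..<b} \<and> cis \<theta> ^ M = 1. 2 * pi * \<i> * H (\<i> * of_real \<theta>))"
    using finA ab(2) by (intro sum.mono_neutral_cong_right) auto
  finally show ?claim2
    unfolding half(2) by (simp add: sum_distrib_left)
qed

lemma consecutive_le:
  fixes s :: "nat \<Rightarrow> real"
  shows "(\<And>j. j \<in> {1..n} \<Longrightarrow> s j \<le> s (j + 1)) \<Longrightarrow> s 1 \<le> s (n + 1)"
  by (induction n) (force intro: order_trans)+

lemma integral_combine_consecutive:
  fixes g :: "real \<Rightarrow> complex" and s :: "nat \<Rightarrow> real"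
  assumes "\<And>a b. g integrable_on {a..b}" "\<And>j. j \<in> {1..n} \<Longrightarrow> s j \<le> s (j + 1)"
  shows "(\<Sum>j=1..n. integral {s j..s (j + 1)} g) = integral {s 1..s (n + 1)} g"
  using assms(2)
proof (induction n)
  case (Suc n)
  have "s 1 \<le> s (n + 1)"
    by (rule consecutive_le) (use Suc.prems in auto)
  then show ?case
    using Suc Henstock_Kurzweil_Integration.integral_combine[OF _ _ assms(1), of "s 1" "s (n + 1)" "s (n + 2)"] by simp
qed simp

text \<open>The open arcs miss only the points \<open>cis (s j)\<close>, at which \<open>G\<close> vanishes.\<close>

lemma sum_arcs_roots:
  fixes G :: "complex \<Rightarrow> complex" and s :: "nat \<Rightarrow> real"
  assumes fin: "\<And>n. finite {\<theta>\<in>{s 1..<s n}. cis \<theta> ^ M = 1}"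
    and s: "\<And>j. j \<in> {1..n} \<Longrightarrow> s j < s (j + 1)" and G: "\<And>j. j \<in> {1..n} \<Longrightarrow> G (cis (s j)) = 0"
  shows "(\<Sum>j=1..n. \<Sum>\<theta> | \<theta> \<in> {s j<..<s (j + 1)} \<and> cis \<theta> ^ M = 1. G (cis \<theta>))
    = (\<Sum>\<theta> | \<theta> \<in> {s 1..<s (n + 1)} \<and> cis \<theta> ^ M = 1. G (cis \<theta>))"
  using s G
proof (induction n)
  case (Suc n)
  have le: "s 1 \<le> s (n + 1)"
    by (rule consecutive_le) (use Suc.prems(1) in \<open>auto intro: less_imp_le\<close>)
  have lt: "s (n + 1) < s (n + 2)" using Suc.prems(1)[of "n + 1"] by simp
  let ?A = "{\<theta>. \<theta> \<in> {s 1..<s (n + 1)} \<and> cis \<theta> ^ M = 1}"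
  let ?B = "{\<theta>. \<theta> \<in> {s (n + 1)<..<s (n + 2)} \<and> cis \<theta> ^ M = 1}"
  let ?C = "{\<theta>. \<theta> \<in> {s 1..<s (n + 2)} \<and> cis \<theta> ^ M = 1}"
  have fC: "finite ?C" by (rule fin)
  have "(\<Sum>\<theta>\<in>?C. G (cis \<theta>)) = (\<Sum>\<theta>\<in>?A \<union> ?B. G (cis \<theta>))"
  proof (rule sum.mono_neutral_right[OF fC])
    show "?A \<union> ?B \<subseteq> ?C" using le lt by auto
    have "\<theta> = s (n + 1)" if "\<theta> \<in> ?C - (?A \<union> ?B)" for \<theta> using that by force
    then show "\<forall>\<theta>\<in>?C - (?A \<union> ?B). G (cis \<theta>) = 0" using Suc.prems(2)[of "n + 1"] by auto
  qed
  also have "\<dots> = (\<Sum>\<theta>\<in>?A. G (cis \<theta>)) + (\<Sum>\<theta>\<in>?B. G (cis \<theta>))"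
    by (rule sum.union_disjoint) (use fC le lt in \<open>auto intro: finite_subset[OF _ fC]\<close>)
  finally show ?case using Suc by simp
qed simp

lemma integral_over_period:
  assumes G: "continuous_on (sphere 0 1) G" and a: "0 \<le> a" "a \<le> 2 * pi"
  shows "integral {a..a + 2 * pi} (\<lambda>\<theta>. G (cis \<theta>) :: complex) = integral {0..2 * pi} (\<lambda>\<theta>. G (cis \<theta>))"
proof -
  let ?g = "\<lambda>\<theta>. G (cis \<theta>)"
  have int: "?g integrable_on {x..y}" for x y by (rule continuous_on_circle_integrable[OF G])
  have "?g \<circ> (+) (2 * pi) = ?g" by (simp add: fun_eq_iff flip: cis_mult)
  then have "integral {0..a} ?g = integral {2 * pi..a + 2 * pi} ?g"
    using integral_shift_Icc_real[of 0 a ?g "2 * pi"] by simp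
  moreover have "integral {a..2 * pi} ?g + integral {2 * pi..a + 2 * pi} ?g = integral {a..a + 2 * pi} ?g"
    by (rule Henstock_Kurzweil_Integration.integral_combine[OF _ _ int]) (use a in auto)
  moreover have "integral {0..a} ?g + integral {a..2 * pi} ?g = integral {0..2 * pi} ?g"
    by (rule Henstock_Kurzweil_Integration.integral_combine[OF _ _ int]) (use a in auto)
  ultimately show ?thesis by (simp add: add.commute)
qed

section \<open>The analytic continuation of the symbol\<close>

lemma half_sine_minus: "half_sine (- x) = - half_sine x"
  by (simp add: half_sine_def algebra_simps)

text \<open>The product of the two bases is the square of \<open>half_sine x\<close>, and their imaginary parts have
  opposite signs. Their principal logarithms therefore add up without a jump, to twice the logarithm of
  \<open>half_sine x\<close>.\<close>

lemma powr_factor_half_sine: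
  assumes x: "0 < Im x" "Im x < 2 * pi"
  shows "(1 - exp x) powr of_real (b / 2) * (1 - exp (- x)) powr of_real (b / 2) = half_sine x powr of_real b"
proof -
  let ?u = "1 - exp x" and ?v = "1 - exp (- x)" and ?S = "half_sine x"
  have S: "0 < Re ?S" by (rule Re_half_sine_pos[OF x])
  then have S0: "?S \<noteq> 0" by auto
  have u: "?u = - (\<i> * exp (x / 2) * ?S)" and v: "?v = \<i> * exp (- (x / 2)) * ?S"
    using exp_minus_one_half_sine[of x] exp_minus_one_half_sine[of "- x"]
    by (simp_all add: half_sine_minus algebra_simps)
  have uv: "?u * ?v = ?S * ?S"
  proof -
    have "exp (x / 2) * exp (- (x / 2)) = 1" by (simp flip: exp_add)
    then show ?thesis unfolding u v by (simp add: algebra_simps)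
  qed
  have u0: "?u \<noteq> 0" and v0: "?v \<noteq> 0" using uv S0 by (metis mult_eq_0_iff)+
  have Im_u: "Im ?u = - exp (Re x) * sin (Im x)" and Im_v: "Im ?v = exp (- Re x) * sin (Im x)"
    by (simp_all add: Im_exp)
  have arg: "- pi < Im (Ln ?u) + Im (Ln ?v) \<and> Im (Ln ?u) + Im (Ln ?v) < pi"
  proof -
    consider "0 < sin (Im x)" | "sin (Im x) < 0" | "sin (Im x) = 0" by linarith
    then show ?thesis
    proof cases
      case 1
      then have "Im ?u < 0" "0 < Im ?v" unfolding Im_u Im_v by simp_all
      then have "\<not> (0 \<le> Im (Ln ?u))" "0 < Im (Ln ?v)" "Im (Ln ?v) < pi"
        using Im_Ln_pos_le[OF u0] Im_Ln_pos_lt[OF v0] Im_Ln_le_pi[OF u0] by auto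
      then show ?thesis using mpi_less_Im_Ln[OF u0] by linarith
    next
      case 2
      then have "0 < Im ?u" "Im ?v < 0"
        unfolding Im_u Im_v by (simp_all add: mult_neg_pos mult_pos_neg)
      then have "\<not> (0 \<le> Im (Ln ?v))" "0 < Im (Ln ?u)" "Im (Ln ?u) < pi"
        using Im_Ln_pos_le[OF v0] Im_Ln_pos_lt[OF u0] Im_Ln_le_pi[OF v0] by auto
      then show ?thesis using mpi_less_Im_Ln[OF v0] by linarith
    next
      case 3
      have "Im x = pi"
      proof -
        have "sin (Im x) \<noteq> 0" if "Im x < pi" using sin_gt_zero[OF x(1) that] by simp
        moreover have "sin (Im x) \<noteq> 0" if "pi < Im x"
          using sin_lt_zero[OF that x(2)] by simp
        ultimately show ?thesis using 3 by linarith
      qed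
      then have "Re ?u > 0" "Re ?v > 0" by (simp_all add: Re_exp add_pos_pos)
      moreover have "Im ?u = 0" "Im ?v = 0" unfolding Im_u Im_v using 3 by simp_all
      ultimately have "Im (Ln ?u) = 0" "Im (Ln ?v) = 0"
        using Im_Ln_eq_0[OF u0] Im_Ln_eq_0[OF v0] by blast+
      then show ?thesis by simp
    qed
  qed
  have "Ln ?u + Ln ?v = Ln (?u * ?v)"
    using arg by (intro Ln_times_simple[OF u0 v0, symmetric]) auto
  also have "\<dots> = Ln ?S + Ln ?S"
    unfolding uv using Re_Ln_pos_lt[OF S0] S by (intro Ln_times_simple[OF S0 S0]) auto
  finally have L: "Ln ?u + Ln ?v = 2 * Ln ?S" by simp
  have "?u powr of_real (b / 2) * ?v powr of_real (b / 2) = exp (of_real (b / 2) * (Ln ?u + Ln ?v))"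
    using u0 v0 by (simp only: powr_def if_False exp_add[symmetric] distrib_left)
  also have "\<dots> = ?S powr of_real b"
    unfolding L using S0 by (simp add: powr_def)
  finally show ?thesis .
qed

lemma half_sine_imaginary: "half_sine (\<i> * of_real x) = of_real (2 * sin (x / 2))"
  by (simp add: half_sine_def complex_eq_iff Re_exp Im_exp)

lemma norm_exp_minus_one: "cmod (exp x - 1) = exp (Re x / 2) * cmod (half_sine x)"
  unfolding exp_minus_one_half_sine by (simp add: norm_mult)

lemma laurent_V_exp:
  "laurent_V p c (exp \<zeta>) = (\<Sum>j\<le>p. c j * exp \<zeta> ^ j + cnj (c j) * exp (- \<zeta>) ^ j)"
  unfolding laurent_V_def by (intro sum.cong refl) (simp add: power_int_minus power_inverse exp_minus)

locale contour_data =
  fixes k :: nat and w :: "nat \<Rightarrow> complex" and \<beta> :: "nat \<Rightarrow> real" and \<epsilon> :: real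
    and p :: nat and c :: "nat \<Rightarrow> complex"
  assumes k: "1 \<le> k"
    and w: "\<And>j. j \<in> {1..k} \<Longrightarrow> cmod (w j) = 1"
    and mono: "strict_mono_on {1..k} (\<lambda>j. Arg2pi (w j))"
    and \<beta>: "\<And>j. j \<in> {1..k} \<Longrightarrow> \<beta> j > 0"
    and eps: "0 < \<epsilon>" "\<epsilon> < 1"
begin

abbreviation "ang \<equiv> angle k w"

text \<open>The argument of \<open>w m\<close> shifted such that the whole strip over the \<open>j\<close>-th arc lies between it and
  its translate by \<open>2\<pi>\<close>, the range in which \<open>half_sine\<close> has nonnegative real part.\<close>

definition lifted_angle :: "nat \<Rightarrow> nat \<Rightarrow> real" where
  "lifted_angle j m = (if m \<le> j then Arg2pi (w m) else Arg2pi (w m) - 2 * pi)"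

text \<open>The symbol on the strip over the \<open>j\<close>-th arc. In this form it makes sense on the closed strip,
  where the boundary values are the limits from the inside.\<close>

definition lifted_symbol :: "nat \<Rightarrow> complex \<Rightarrow> complex" where
  "lifted_symbol j \<zeta> = exp (laurent_V p c (exp \<zeta>)) *
     (\<Prod>m=1..k. half_sine (\<zeta> - \<i> * of_real (lifted_angle j m)) powr of_real (\<beta> m))"

lemma Arg2pi_mono: "i \<in> {1..k} \<Longrightarrow> j \<in> {1..k} \<Longrightarrow> i \<le> j \<Longrightarrow> Arg2pi (w i) \<le> Arg2pi (w j)"
  using mono by (metis le_less less_imp_le strict_mono_onD)

lemma angle_less:
  assumes "j \<in> {1..k}"
  shows "ang j < ang (j + 1)" "ang (j + 1) \<le> ang j + 2 * pi"
proof -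
  have 1: "ang j = Arg2pi (w j)" using assms by (simp add: angle_def)
  have A: "0 \<le> Arg2pi (w i)" "Arg2pi (w i) < 2 * pi" for i using Arg2pi by auto
  show "ang j < ang (j + 1)"
  proof (cases "j = k")
    case True
    then show ?thesis unfolding 1 using A[of j] A[of 1] by (simp add: angle_def)
  next
    case False
    then have "Arg2pi (w j) < Arg2pi (w (j + 1))"
      using assms by (intro strict_mono_onD[OF mono]) auto
    then show ?thesis unfolding 1 using False by (simp add: angle_def)
  qed
  show "ang (j + 1) \<le> ang j + 2 * pi"
  proof (cases "j = k")
    case True
    then show ?thesis unfolding 1 using Arg2pi_mono[of 1 j] k by (simp add: angle_def)
  next
    case False
    then show ?thesis unfolding 1 using A[of "j + 1"] A[of j] by (simp add: angle_def)
  qed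
qed

lemma lifted_angle_bounds:
  assumes "j \<in> {1..k}" "m \<in> {1..k}"
  shows "lifted_angle j m \<le> ang j" "ang (j + 1) \<le> lifted_angle j m + 2 * pi"
proof -
  have 1: "ang j = Arg2pi (w j)" using assms by (simp add: angle_def)
  have A: "0 \<le> Arg2pi (w i)" "Arg2pi (w i) < 2 * pi" for i using Arg2pi by auto
  show "lifted_angle j m \<le> ang j"
    using Arg2pi_mono[OF assms(2,1)] A(2)[of m] A(1)[of j] by (auto simp: 1 lifted_angle_def)
  show "ang (j + 1) \<le> lifted_angle j m + 2 * pi"
    using Arg2pi_mono[of 1 m] Arg2pi_mono[of "j + 1" m] A(2)[of "j + 1"] A(1)[of m] assms
    by (auto simp: lifted_angle_def angle_def)
qed

lemma cis_lifted_angle: "m \<in> {1..k} \<Longrightarrow> cis (lifted_angle j m) = w m"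
proof -
  assume "m \<in> {1..k}"
  then have "cis (Arg2pi (w m)) = w m"
    using w complex_norm_eq_1_exp by (simp add: cis_conv_exp)
  then show ?thesis by (simp add: lifted_angle_def flip: cis_divide)
qed

lemma exp_diff_lifted_angle:
  assumes "m \<in> {1..k}"
  shows "exp (\<zeta> - \<i> * of_real (lifted_angle j m)) = exp \<zeta> / w m"
    "exp (- (\<zeta> - \<i> * of_real (lifted_angle j m))) = w m / exp \<zeta>"
  using cis_lifted_angle[OF assms, of j] by (simp_all add: exp_diff cis_conv_exp)

lemma lifted_symbol_inside:
  assumes j: "j \<in> {1..k}" and "ang j < Im \<zeta>" "Im \<zeta> < ang (j + 1)"
  shows "symbol_ext (laurent_V p c) k w \<beta> (exp \<zeta>) = lifted_symbol j \<zeta>"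
  unfolding symbol_ext_def lifted_symbol_def
proof (intro arg_cong2[where f = "(*)"] refl prod.cong)
  fix m assume m: "m \<in> {1..k}"
  have "(1 - exp (\<zeta> - \<i> * of_real (lifted_angle j m))) powr of_real (\<beta> m / 2)
      * (1 - exp (- (\<zeta> - \<i> * of_real (lifted_angle j m)))) powr of_real (\<beta> m / 2)
      = half_sine (\<zeta> - \<i> * of_real (lifted_angle j m)) powr of_real (\<beta> m)"
    using lifted_angle_bounds[OF j m] assms by (intro powr_factor_half_sine) auto
  then show "(1 - exp \<zeta> / w m) powr of_real (\<beta> m / 2) * (1 - w m / exp \<zeta>) powr of_real (\<beta> m / 2)
      = half_sine (\<zeta> - \<i> * of_real (lifted_angle j m)) powr of_real (\<beta> m)"
    unfolding exp_diff_lifted_angle[OF m] .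
qed

lemma continuous_lifted_factor:
  assumes "j \<in> {1..k}" "m \<in> {1..k}"
  shows "continuous_on {\<zeta>. ang j \<le> Im \<zeta> \<and> Im \<zeta> \<le> ang (j + 1)}
    (\<lambda>\<zeta>. half_sine (\<zeta> - \<i> * of_real (lifted_angle j m)) powr of_real (\<beta> m))"
proof (rule continuous_on_powr_complex)
  have "0 \<le> Re (half_sine (\<zeta> - \<i> * of_real (lifted_angle j m)))"
    if "ang j \<le> Im \<zeta>" "Im \<zeta> \<le> ang (j + 1)" for \<zeta>
    using lifted_angle_bounds[OF assms] that by (intro Re_half_sine_nonneg) auto
  then show "{\<zeta>. ang j \<le> Im \<zeta> \<and> Im \<zeta> \<le> ang (j + 1)} \<subseteq>
      {z. 0 \<le> Re (half_sine (z - \<i> * of_real (lifted_angle j m))) \<or> Im (half_sine (z - \<i> * of_real (lifted_angle j m))) \<noteq> 0}"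
    by auto
qed (use \<beta> assms in \<open>auto intro!: continuous_intros\<close>)

lemma continuous_lifted_symbol:
  assumes "j \<in> {1..k}"
  shows "continuous_on {\<zeta>. ang j \<le> Im \<zeta> \<and> Im \<zeta> \<le> ang (j + 1)} (lifted_symbol j)"
  unfolding lifted_symbol_def laurent_V_exp
  by (intro continuous_intros continuous_lifted_factor assms)

lemma holomorphic_lifted_symbol:
  assumes "j \<in> {1..k}"
  shows "lifted_symbol j holomorphic_on {\<zeta>. ang j < Im \<zeta> \<and> Im \<zeta> < ang (j + 1)}"
  unfolding lifted_symbol_def laurent_V_exp
proof (intro holomorphic_intros)
  fix m \<zeta> assume m: "m \<in> {1..k}" and \<zeta>: "\<zeta> \<in> {\<zeta>. ang j < Im \<zeta> \<and> Im \<zeta> < ang (j + 1)}"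
  have "0 < Re (half_sine (\<zeta> - \<i> * of_real (lifted_angle j m)))"
    using lifted_angle_bounds[OF assms m] \<zeta> by (intro Re_half_sine_pos) auto
  then show "half_sine (\<zeta> - \<i> * of_real (lifted_angle j m)) \<notin> \<real>\<^sub>\<le>\<^sub>0"
    by (auto elim!: nonpos_Reals_cases)
qed

lemma lifted_symbol_circle:
  assumes j: "j \<in> {1..k}" and \<theta>: "ang j \<le> \<theta>" "\<theta> \<le> ang (j + 1)"
  shows "lifted_symbol j (Complex 0 \<theta>) = symbol_circle (laurent_V p c) k w \<beta> (cis \<theta>)"
proof -
  have e: "exp (Complex 0 \<theta>) = cis \<theta>" by (simp add: cis_conv_exp Complex_eq)
  have "half_sine (Complex 0 \<theta> - \<i> * of_real (lifted_angle j m)) powr of_real (\<beta> m)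
      = of_real (cmod (cis \<theta> - w m) powr \<beta> m)" if m: "m \<in> {1..k}" for m
  proof -
    let ?x = "\<theta> - lifted_angle j m"
    have eq: "Complex 0 \<theta> - \<i> * of_real (lifted_angle j m) = \<i> * of_real ?x"
      by (simp add: complex_eq_iff)
    have s: "0 \<le> 2 * sin (?x / 2)"
      using lifted_angle_bounds[OF j m] \<theta> by (auto intro!: sin_ge_zero)
    have "cis \<theta> - w m = w m * (exp (\<i> * of_real ?x) - 1)"
    proof -
      have "w m \<noteq> 0" using w[OF m] by auto
      then show ?thesis
        using exp_diff_lifted_angle(1)[OF m, of "Complex 0 \<theta>" j] unfolding eq e
        by (simp add: right_diff_distrib)
    qed
    moreover have "cmod (half_sine (\<i> * of_real ?x)) = 2 * sin (?x / 2)"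
      using s by (simp only: half_sine_imaginary norm_of_real abs_of_nonneg)
    ultimately have "cmod (cis \<theta> - w m) = 2 * sin (?x / 2)"
      using w[OF m] norm_exp_minus_one[of "\<i> * of_real ?x"] by (simp only: norm_mult) simp
    then show ?thesis
      unfolding eq half_sine_imaginary using s by (simp add: powr_of_real del: of_real_mult)
  qed
  then show ?thesis
    unfolding lifted_symbol_def symbol_circle_def e by (simp add: of_real_prod)
qed

text \<open>Each ray carries one point \<open>w m\<close>: the \<open>j\<close>-th at the start of the sector, the next one at its end.
  There the imaginary part of the argument of \<open>half_sine\<close> is \<open>0\<close> or \<open>2\<pi>\<close>, its exponential is
  the radius \<open>|z|\<close>, and \<open>||z| - 1|\<close> is \<open>\<epsilon> |2 t - 1|\<close>.\<close>

lemma half_sine_at_ray: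
  assumes e: "e \<in> {Ray_Start, Ray_End}" and j: "j \<in> {1..k}"
  shows "\<exists>m\<in>{1..k}. \<forall>t. 0 < t \<longrightarrow> t < 1 \<longrightarrow>
    cmod (half_sine (edge_log \<epsilon> (ang j) (ang (j + 1)) e t - \<i> * of_real (lifted_angle j m)))
      \<le> (\<epsilon> / exp (ln (1 - \<epsilon>) / 2)) * \<bar>2 * t - 1\<bar>"
proof -
  define m where "m = (if e = Ray_Start then j else if j = k then 1 else j + 1)"
  have m: "m \<in> {1..k}" using j k by (auto simp: m_def)
  have bound: "cmod (half_sine (edge_log \<epsilon> (ang j) (ang (j + 1)) e t - \<i> * of_real (lifted_angle j m)))
      \<le> (\<epsilon> / exp (ln (1 - \<epsilon>) / 2)) * \<bar>2 * t - 1\<bar>" if t: "0 < t" "t < 1" for t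
  proof -
    let ?x = "edge_log \<epsilon> (ang j) (ang (j + 1)) e t - \<i> * of_real (lifted_angle j m)"
    note r = edge_radius_pos[OF eps, of t]
    have Re: "Re ?x = Re (edge_log \<epsilon> (ang j) (ang (j + 1)) e t)" by simp
    have lnge: "ln (1 - \<epsilon>) \<le> Re ?x"
      unfolding Re using e edge_ln_bounds[OF eps, of t] t by auto
    have "Im ?x = 0 \<or> Im ?x = 2 * pi"
      using e j by (auto simp: m_def lifted_angle_def angle_def)
    then have "exp ?x = of_real (exp (Re ?x))"
      by (auto simp: complex_eq_iff Re_exp Im_exp)
    then have "cmod (exp ?x - 1) = \<bar>exp (Re ?x) - 1\<bar>"
      by (metis norm_of_real of_real_1 of_real_diff)
    also have "\<dots> = \<epsilon> * \<bar>2 * t - 1\<bar>"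
      using ray_radius(1)[OF eps t e, of "ang j" "ang (j + 1)"] unfolding Re by simp
    finally have "exp (Re ?x / 2) * cmod (half_sine ?x) = \<epsilon> * \<bar>2 * t - 1\<bar>"
      unfolding norm_exp_minus_one .
    then have "cmod (half_sine ?x) = \<epsilon> * \<bar>2 * t - 1\<bar> / exp (Re ?x / 2)"
      by (simp add: field_simps)
    also have "\<dots> \<le> \<epsilon> * \<bar>2 * t - 1\<bar> / exp (ln (1 - \<epsilon>) / 2)"
      using lnge eps by (intro divide_left_mono) auto
    finally show ?thesis by simp
  qed
  then show ?thesis using m by blast
qed

text \<open>The factor of the point on the ray decays; all others are continuous on the compact closed
  rectangle and hence bounded.\<close>

lemma ray_bound:
  assumes j: "j \<in> {1..k}" and e: "e \<in> {Ray_Start, Ray_End}"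
    and g: "continuous_on UNIV g"
  shows "\<exists>C. \<exists>b>0. \<forall>t. 0 < t \<longrightarrow> t < 1 \<longrightarrow>
    cmod (g (edge_log \<epsilon> (ang j) (ang (j + 1)) e t) * lifted_symbol j (edge_log \<epsilon> (ang j) (ang (j + 1)) e t))
      \<le> C * \<bar>2 * t - 1\<bar> powr b"
proof -
  let ?z = "edge_log \<epsilon> (ang j) (ang (j + 1)) e"
  let ?F = "\<lambda>m \<zeta>. half_sine (\<zeta> - \<i> * of_real (lifted_angle j m)) powr of_real (\<beta> m)"
  let ?R = "log_rect \<epsilon> (ang j) (ang (j + 1))"
  let ?L = "\<epsilon> / exp (ln (1 - \<epsilon>) / 2)"
  obtain m where m: "m \<in> {1..k}" and bound: "\<And>t. 0 < t \<Longrightarrow> t < 1 \<Longrightarrow>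
      cmod (half_sine (?z t - \<i> * of_real (lifted_angle j m))) \<le> ?L * \<bar>2 * t - 1\<bar>"
    using half_sine_at_ray[OF e j] by blast
  define B where "B \<zeta> = g \<zeta> * exp (laurent_V p c (exp \<zeta>)) * (\<Prod>i\<in>{1..k} - {m}. ?F i \<zeta>)" for \<zeta>
  have sub: "?R \<subseteq> {\<zeta>. ang j \<le> Im \<zeta> \<and> Im \<zeta> \<le> ang (j + 1)}" by (auto simp: in_cbox_complex_iff)
  have "continuous_on ?R B"
    unfolding B_def laurent_V_exp
    by (intro continuous_intros continuous_on_subset[OF g] continuous_on_subset[OF continuous_lifted_factor sub] j) auto
  then have "bounded (B ` ?R)" by (intro compact_imp_bounded compact_continuous_image compact_cbox)
  then obtain D where D: "D > 0" "\<And>\<zeta>. \<zeta> \<in> ?R \<Longrightarrow> cmod (B \<zeta>) \<le> D"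
    by (auto simp: bounded_pos)
  have "cmod (g (?z t) * lifted_symbol j (?z t)) \<le> (D * ?L powr \<beta> m) * \<bar>2 * t - 1\<bar> powr \<beta> m"
    if t: "0 < t" "t < 1" for t
  proof -
    have "?z t \<in> ?R"
      using edge_log_in_rect[OF eps less_imp_le[OF angle_less(1)[OF j]], of t e] t by auto
    then have D': "cmod (B (?z t)) \<le> D" by (rule D)
    have "g (?z t) * lifted_symbol j (?z t) = B (?z t) * ?F m (?z t)"
      unfolding lifted_symbol_def B_def using m by (subst prod.remove[of _ m]) (auto simp: mult_ac)
    then have "cmod (g (?z t) * lifted_symbol j (?z t))
        = cmod (B (?z t)) * cmod (half_sine (?z t - \<i> * of_real (lifted_angle j m))) powr \<beta> m"
      by (simp add: norm_mult norm_powr_real_powr')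
    also have "\<dots> \<le> D * (?L * \<bar>2 * t - 1\<bar>) powr \<beta> m"
      using D' D(1) bound[OF t] \<beta>[OF m] by (intro mult_mono powr_mono2) auto
    also have "\<dots> = (D * ?L powr \<beta> m) * \<bar>2 * t - 1\<bar> powr \<beta> m"
      using eps by (subst powr_mult) auto
    finally show ?thesis .
  qed
  then show ?thesis using \<beta>[OF m] by blast
qed

end

section \<open>The contours in logarithmic coordinates\<close>

text \<open>The value of \<open>I\<close> on an edge.\<close>

fun edge_unit :: "edge \<Rightarrow> complex" where
  "edge_unit Ray_Start = - \<i>"
| "edge_unit Outer_Arc = 1"
| "edge_unit Ray_End = - \<i>"
| "edge_unit Inner_Arc = 1"

lemma norm_edge_unit [simp]: "cmod (edge_unit e) = 1"
  by (cases e) auto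

lemma csqrt_measurable [measurable]: "csqrt \<in> borel_measurable borel"
proof -
  have "csqrt = (\<lambda>z. of_real (sqrt ((cmod z + Re z) / 2))
      + \<i> * of_real ((if Im z = 0 then 1 else if 0 < Im z then 1 else - 1) * sqrt ((cmod z - Re z) / 2)))"
    by (auto simp: fun_eq_iff complex_eq_iff sgn_if)
  also have "\<dots> \<in> borel_measurable borel" by measurable
  finally show ?thesis .
qed

lemma v_fun_measurable [measurable]: "v_fun M \<in> borel_measurable borel"
proof -
  have "v_fun M = (\<lambda>z. if cmod z < 1 then - (z ^ M / (1 - z ^ M)) else inverse (z ^ M) / (1 - inverse (z ^ M)))"
    by (auto simp: fun_eq_iff v_fun_def power_int_minus)
  also have "\<dots> \<in> borel_measurable borel" by measurable
  finally show ?thesis .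
qed

lemma continuous_Ioo_measurable:
  fixes f :: "real \<Rightarrow> 'a::topological_space"
  assumes "continuous_on {0<..<1} f"
  shows "f \<in> borel_measurable unit_interval"
proof -
  have "sets unit_interval = sets (restrict_space borel {0<..<1})"
    by (rule sets_restrict_space_cong) simp
  from measurable_cong_sets[OF this refl] show ?thesis
    using borel_measurable_continuous_on_restrict[OF assms] by blast
qed

context contour_data
begin

abbreviation "log_deriv j \<equiv> edge_deriv \<epsilon> (ang j) (ang (j + 1))"

abbreviation "sector_integral j \<equiv> edge_integral \<epsilon> (ang j) (ang (j + 1))"

abbreviation "ext_symbol \<equiv> symbol_ext (laurent_V p c) k w \<beta>"

abbreviation "log_path j \<equiv> edge_log \<epsilon> (ang j) (ang (j + 1))"

lemma polar_path_log:
  assumes t: "0 \<le> t" "t \<le> 1"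
  shows "polar_path \<epsilon> k w j e t = (exp (Re (log_path j e t)), Im (log_path j e t))"
proof -
  note r = edge_radius_pos[OF eps t]
  show ?thesis
    using exp_ln[OF r(1)] exp_ln[OF r(2)] eps by (cases e) (simp_all add: linepath_def algebra_simps)
qed

lemma contour_path_log:
  assumes "0 \<le> t" "t \<le> 1"
  shows "contour_path \<epsilon> k w j e t = exp (log_path j e t)"
  unfolding contour_path_def polar_path_log[OF assms] by (simp add: rcis_def exp_eq_polar)

lemma cpt_log: "0 < t \<Longrightarrow> t < 1 \<Longrightarrow> cpt \<epsilon> k w (j, e, t) = exp (log_path j e t)"
  by (simp add: cpt_def contour_path_log)

lemma vector_derivative_contour_path:
  assumes t: "0 < t" "t < 1"
  shows "vector_derivative (contour_path \<epsilon> k w j e) (at t)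
    = exp (log_path j e t) * log_deriv j e t"
proof (rule vector_derivative_at)
  have "((exp \<circ> log_path j e) has_vector_derivative
      (log_deriv j e t * exp (log_path j e t))) (at t)"
    using t by (intro field_vector_diff_chain_at edge_log_has_vector_derivative eps DERIV_exp) auto
  then have "(contour_path \<epsilon> k w j e has_vector_derivative
      (log_deriv j e t * exp (log_path j e t))) (at t)"
    by (rule has_vector_derivative_transform_within_open[where S = "{0<..<1}"])
       (use t in \<open>auto simp: contour_path_log\<close>)
  then show "(contour_path \<epsilon> k w j e has_vector_derivative
      exp (log_path j e t) * log_deriv j e t) (at t)"
    by (simp add: mult.commute)
qed

lemma cmod_on_arcs:
  assumes t: "0 < t" "t < 1"
  shows "cmod (exp (log_path j e t)) = 1 + \<epsilon> \<or> cmod (exp (log_path j e t)) = 1 - \<epsilon>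
    \<longleftrightarrow> e = Outer_Arc \<or> e = Inner_Arc"
proof -
  have "0 < \<epsilon> * t" "\<epsilon> * t < \<epsilon>" using eps t by auto
  then show ?thesis
    using edge_radius_pos[OF eps, of t] eps t by (cases e) (auto simp: mult.assoc)
qed

lemma I_fun_log:
  assumes t: "0 < t" "t < 1"
  shows "I_fun \<epsilon> (cpt \<epsilon> k w (j, e, t)) = edge_unit e"
  unfolding I_fun_def cpt_log[OF t] cmod_on_arcs[OF t] by (cases e) auto

text \<open>The factor \<open>I\<close> compensates the different normalizations of \<open>\<sigma>\<close> on arcs and rays: on every
  edge \<open>I d\<sigma>\<close> is \<open>dz / (2\<pi>\<i> z)\<close>, that is, \<open>d\<zeta> / (2\<pi>\<i>)\<close>.\<close>

lemma sigma_density_log: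
  assumes t: "0 < t" "t < 1"
  shows "edge_unit e * of_real (sigma_density \<epsilon> k w (j, e, t))
    = log_deriv j e t / (2 * of_real pi * \<i>)"
proof -
  let ?z = "exp (log_path j e t)" and ?d = "log_deriv j e t"
  have "sigma_density \<epsilon> k w (j, e, t) = Re (if e = Outer_Arc \<or> e = Inner_Arc
      then ?z * ?d / (2 * of_real pi * \<i> * ?z) else ?z * ?d / (2 * of_real pi * ?z))"
    unfolding sigma_density_def Let_def prod.case vector_derivative_contour_path[OF t]
      contour_path_log[OF less_imp_le[OF t(1)] less_imp_le[OF t(2)]] cmod_on_arcs[OF t] ..
  also have "\<dots> = Re (if e = Outer_Arc \<or> e = Inner_Arc
      then ?d / (2 * of_real pi * \<i>) else ?d / (2 * of_real pi))"
    by simp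
  finally have \<sigma>: "sigma_density \<epsilon> k w (j, e, t) = Re (if e = Outer_Arc \<or> e = Inner_Arc
      then ?d / (2 * of_real pi * \<i>) else ?d / (2 * of_real pi))" .
  obtain D where D: "?d = \<i> * edge_unit e * of_real D"
  proof (cases e)
    case Ray_Start
    then show thesis by (intro that[of "2 * \<epsilon> / (1 - \<epsilon> + 2 * \<epsilon> * t)"]) simp
  next
    case Outer_Arc
    then show thesis by (intro that[of "ang (j + 1) - ang j"]) simp
  next
    case Ray_End
    then show thesis by (intro that[of "- (2 * \<epsilon>) / (1 + \<epsilon> - 2 * \<epsilon> * t)"]) simp
  next
    case Inner_Arc
    then show thesis by (intro that[of "- (ang (j + 1) - ang j)"]) (simp add: algebra_simps)
  qed
  have "sigma_density \<epsilon> k w (j, e, t) = D / (2 * pi)"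
    unfolding \<sigma> D by (cases e) (simp_all add: complex_eq_iff Re_divide_of_real)
  then show ?thesis unfolding D by simp
qed

lemma sigma_density_eq:
  assumes t: "0 < t" "t < 1"
  shows "sigma_density \<epsilon> k w (j, e, t)
    = Re (log_deriv j e t / (2 * of_real pi * \<i> * edge_unit e))"
proof -
  have "edge_unit e \<noteq> 0" by (cases e) auto
  then have "of_real (sigma_density \<epsilon> k w (j, e, t))
      = log_deriv j e t / (2 * of_real pi * \<i> * edge_unit e)"
    using sigma_density_log[OF t, of e j] by (simp add: field_simps)
  then show ?thesis by (metis Re_complex_of_real)
qed

lemma sigma_density_measurable: "sigma_density \<epsilon> k w \<in> borel_measurable (param_measure k)"
proof (rule measurable_param_measure)
  fix j e
  have "continuous_on {0<..<1} (\<lambda>t. Re (log_deriv j e t / (2 * of_real pi * \<i> * edge_unit e)))"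
    by (intro continuous_intros continuous_on_subset[OF continuous_on_edge_deriv[OF eps]])
       (cases e; auto)+
  from continuous_Ioo_measurable[OF this]
  show "(\<lambda>t. sigma_density \<epsilon> k w (j, e, t)) \<in> borel_measurable unit_interval"
    by (rule measurable_cong[THEN iffD1, rotated]) (auto simp: sigma_density_eq space_restrict_space)
qed

text \<open>In polar coordinates the sector is an open rectangle, and the lifted symbol is continuous on the
  closed strip over it, so the limit from the inside is its value.\<close>

lemma inside_limit_log:
  assumes j: "j \<in> {1..k}" and t: "0 < t" "t < 1"
  shows "inside_limit \<epsilon> k w (ext_symbol) (j, e, t) = lifted_symbol j (log_path j e t)"
proof -
  let ?S = "sector \<epsilon> k w j" and ?x = "(exp (Re (log_path j e t)), Im (log_path j e t))"
  let ?T = "{1 - \<epsilon>..1 + \<epsilon>} \<times> {ang j..ang (j + 1)}"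
  have lt: "ang j < ang (j + 1)" by (rule angle_less[OF j])
  have openS: "open ?S" unfolding sector_def by (intro open_Times) auto
  have clS: "closure ?S = ?T"
    unfolding sector_def closure_Times using eps lt by simp
  have xT: "?x \<in> ?T"
  proof -
    have "log_path j e t \<in> log_rect \<epsilon> (ang j) (ang (j + 1))"
      using edge_log_in_rect[OF eps less_imp_le[OF lt], of t e] t by auto
    then have *: "ln (1 - \<epsilon>) \<le> Re (log_path j e t)" "Re (log_path j e t) \<le> ln (1 + \<epsilon>)"
        "Im (log_path j e t) \<in> {ang j..ang (j + 1)}"
      by (auto simp: in_cbox_complex_iff)
    from *(1,2) have "1 - \<epsilon> \<le> exp (Re (log_path j e t))" "exp (Re (log_path j e t)) \<le> 1 + \<epsilon>"
      using exp_le_cancel_iff[of "ln (1 - \<epsilon>)" "Re (log_path j e t)"]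
        exp_le_cancel_iff[of "Re (log_path j e t)" "ln (1 + \<epsilon>)"] eps by simp_all
    then show ?thesis using *(3) by simp
  qed
  have lim: "((\<lambda>(r, \<theta>). lifted_symbol j (Complex (ln r) \<theta>)) \<longlongrightarrow> lifted_symbol j (log_path j e t)) (at ?x within ?T)"
  proof -
    have "continuous_on ?T (\<lambda>y. lifted_symbol j (Complex (ln (fst y)) (snd y)))"
      using eps by (intro continuous_on_compose2[OF continuous_lifted_symbol[OF j]])
         (auto simp: Complex_eq intro!: continuous_intros)
    from this[unfolded continuous_on_def, rule_format, OF xT]
    show ?thesis by (simp add: case_prod_unfold)
  qed
  have "((\<lambda>(r, \<theta>). ext_symbol (rcis r \<theta>)) \<longlongrightarrow> lifted_symbol j (log_path j e t)) (at ?x within ?S)"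
  proof (rule Lim_transform_eventually)
    show "((\<lambda>(r, \<theta>). lifted_symbol j (Complex (ln r) \<theta>)) \<longlongrightarrow> lifted_symbol j (log_path j e t)) (at ?x within ?S)"
      by (rule tendsto_within_subset[OF lim]) (use closure_subset[of ?S] in \<open>simp add: clS\<close>)
    show "\<forall>\<^sub>F y in at ?x within ?S. (case y of (r, \<theta>) \<Rightarrow> lifted_symbol j (Complex (ln r) \<theta>))
        = (case y of (r, \<theta>) \<Rightarrow> ext_symbol (rcis r \<theta>))"
      unfolding eventually_at_filter
    proof (intro always_eventually allI impI)
      fix y assume y: "y \<in> ?S"
      obtain r \<theta> where y': "y = (r, \<theta>)" by fastforce
      have r: "0 < r" "ang j < \<theta>" "\<theta> < ang (j + 1)" using y eps by (auto simp: y' sector_def)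
      have "rcis r \<theta> = exp (Complex (ln r) \<theta>)" using r by (simp add: rcis_def exp_eq_polar)
      then show "(case y of (r, \<theta>) \<Rightarrow> lifted_symbol j (Complex (ln r) \<theta>))
        = (case y of (r, \<theta>) \<Rightarrow> ext_symbol (rcis r \<theta>))"
        using lifted_symbol_inside[OF j, of "Complex (ln r) \<theta>"] r by (simp add: y')
    qed
  qed
  \<comment> \<open>The limit is unique because the point is an accumulation point of the sector.\<close>
  moreover have "at ?x within ?S \<noteq> bot"
  proof -
    have "?x islimpt ?S"
    proof (cases "?x \<in> ?S")
      case True
      then show ?thesis using openS by (intro interior_limit_point) (simp add: interior_open)
    next
      case False
      have "?x \<in> closure ?S" unfolding clS by (rule xT)
      with False show ?thesis unfolding closure_def by blast
    qed
    then show ?thesis by (simp add: trivial_limit_within)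
  qed
  ultimately show ?thesis
    unfolding inside_limit_def prod.case polar_path_log[OF less_imp_le[OF t(1)] less_imp_le[OF t(2)]]
    by (intro tendsto_Lim)
qed

end

section \<open>The discrete Toeplitz determinant as a Fredholm determinant\<close>

context contour_data
begin

abbreviation "circle_symbol \<equiv> symbol_circle (laurent_V p c) k w \<beta>"

lemma continuous_circle_symbol: "continuous_on (sphere 0 1) circle_symbol"
proof -
  have z: "z \<noteq> 0" if "z \<in> sphere 0 1" for z :: complex using that by auto
  have "continuous_on (sphere 0 1) (laurent_V p c)"
    unfolding laurent_V_def by (intro continuous_intros) (use z in auto)
  moreover have "continuous_on (sphere 0 1) (\<lambda>z. \<Prod>j=1..k. cmod (z - w j) powr \<beta> j)"
    using \<beta> by (intro continuous_on_prod continuous_on_powr' continuous_intros) auto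
  ultimately show ?thesis
    unfolding symbol_circle_def
    by (intro continuous_on_mult continuous_on_exp continuous_on_of_real)
qed

lemma circle_symbol_zero: "j \<in> {1..k} \<Longrightarrow> circle_symbol (w j) = 0"
  unfolding symbol_circle_def by (auto intro!: prod_zero bexI[of _ j])

lemma lifted_formula:
  fixes P Q :: "complex poly"
  defines "g \<equiv> \<lambda>z. poly P (inverse z) * poly Q z"
  assumes j: "j \<in> {1..k}" and M: "M > 0"
  shows "edge_integrable \<epsilon> (ang j) (ang (j + 1)) e (\<lambda>\<zeta>. g (exp \<zeta>) * lifted_symbol j \<zeta> * v_fun M (exp \<zeta>))" (is ?claim1)
    and "(\<Sum>e\<in>UNIV. sector_integral j e (\<lambda>\<zeta>. g (exp \<zeta>) * lifted_symbol j \<zeta> * v_fun M (exp \<zeta>)))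
      = 2 * pi * \<i> / of_nat M * (\<Sum>\<theta> | \<theta> \<in> {ang j<..<ang (j + 1)} \<and> cis \<theta> ^ M = 1. g (cis \<theta>) * circle_symbol (cis \<theta>))
        - \<i> * integral {ang j..ang (j + 1)} (\<lambda>\<theta>. g (cis \<theta>) * circle_symbol (cis \<theta>))" (is ?claim2)
proof -
  let ?H = "\<lambda>\<zeta>. g (exp \<zeta>) * lifted_symbol j \<zeta>"
  let ?A = "{\<theta>. \<theta> \<in> {ang j<..<ang (j + 1)} \<and> cis \<theta> ^ M = 1}"
  let ?R = "log_rect \<epsilon> (ang j) (ang (j + 1))"
  have g: "(\<lambda>\<zeta>. g (exp \<zeta>)) holomorphic_on S" for S
  proof -
    have "(\<lambda>\<zeta>. g (exp \<zeta>)) = (\<lambda>\<zeta>. (\<Sum>i\<le>degree P. coeff P i * exp (- \<zeta>) ^ i) * (\<Sum>i\<le>degree Q. coeff Q i * exp \<zeta> ^ i))"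
      by (simp add: g_def fun_eq_iff poly_altdef exp_minus)
    then show ?thesis by (auto intro!: holomorphic_intros)
  qed
  have contH: "continuous_on ?R ?H"
    by (intro continuous_intros holomorphic_on_imp_continuous_on[OF g]
        continuous_on_subset[OF continuous_lifted_symbol[OF j]]) (auto simp: in_cbox_complex_iff)
  have holH: "?H holomorphic_on open_log_rect \<epsilon> (ang j) (ang (j + 1))"
    by (intro holomorphic_intros g holomorphic_on_subset[OF holomorphic_lifted_symbol[OF j]])
       (auto simp: in_box_complex_iff)
  note gc = holomorphic_on_imp_continuous_on[OF g[of UNIV]]
  obtain C1 b1 where b1: "b1 > 0" "\<And>t. 0 < t \<Longrightarrow> t < 1 \<Longrightarrow> cmod (?H (log_path j Ray_Start t)) \<le> C1 * \<bar>2 * t - 1\<bar> powr b1"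
    using ray_bound[OF j _ gc, of Ray_Start] by auto
  obtain C2 b2 where b2: "b2 > 0" "\<And>t. 0 < t \<Longrightarrow> t < 1 \<Longrightarrow> cmod (?H (log_path j Ray_End t)) \<le> C2 * \<bar>2 * t - 1\<bar> powr b2"
    using ray_bound[OF j _ gc, of Ray_End] by auto
  \<comment> \<open>The smaller exponent serves both rays because \<open>|2 t - 1| \<le> 1\<close>.\<close>
  have ray: "cmod (?H (log_path j e t)) \<le> max \<bar>C1\<bar> \<bar>C2\<bar> * \<bar>2 * t - 1\<bar> powr (min b1 b2)"
    if e: "e \<in> {Ray_Start, Ray_End}" and t: "0 < t" "t < 1" for e t
  proof -
    have le1: "\<bar>2 * t - 1\<bar> \<le> 1" using t by auto
    have mono: "C * \<bar>2 * t - 1\<bar> powr b \<le> max \<bar>C1\<bar> \<bar>C2\<bar> * \<bar>2 * t - 1\<bar> powr (min b1 b2)"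
      if "C \<le> max \<bar>C1\<bar> \<bar>C2\<bar>" "min b1 b2 \<le> b" for C b
    proof -
      have "C * \<bar>2 * t - 1\<bar> powr b \<le> max \<bar>C1\<bar> \<bar>C2\<bar> * \<bar>2 * t - 1\<bar> powr b"
        using that by (intro mult_right_mono) auto
      also have "\<dots> \<le> max \<bar>C1\<bar> \<bar>C2\<bar> * \<bar>2 * t - 1\<bar> powr (min b1 b2)"
        using that le1 by (intro mult_left_mono powr_mono') auto
      finally show ?thesis .
    qed
    from e show ?thesis
    proof
      assume "e = Ray_Start"
      then show ?thesis by (simp only:) (rule order_trans[OF b1(2)[OF t] mono], auto)
    next
      assume "e \<in> {Ray_End}"
      then show ?thesis by (simp only: singleton_iff) (rule order_trans[OF b2(2)[OF t] mono], auto)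
    qed
  qed
  have minb: "min b1 b2 > 0" using b1 b2 by simp
  have sf: "edge_integrable \<epsilon> (ang j) (ang (j + 1)) e (\<lambda>\<zeta>. ?H \<zeta> * v_fun M (exp \<zeta>))"
    "(\<Sum>e\<in>UNIV. sector_integral j e (\<lambda>\<zeta>. ?H \<zeta> * v_fun M (exp \<zeta>)))
      = 2 * pi * \<i> / of_nat M * (\<Sum>\<theta>\<in>?A. ?H (\<i> * of_real \<theta>))
        - \<i> * integral {ang j..ang (j + 1)} (\<lambda>\<theta>. ?H (Complex 0 \<theta>))"
    by (rule sector_formula[OF eps angle_less[OF j] M contH holH minb ray]; assumption)+
  show ?claim1
    by (rule sf(1))
  have H_circle: "?H (Complex 0 \<theta>) = g (cis \<theta>) * circle_symbol (cis \<theta>)" if "ang j \<le> \<theta>" "\<theta> \<le> ang (j + 1)" for \<theta>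
    using lifted_symbol_circle[OF j that] by (simp add: cis_conv_exp Complex_eq)
  have "(\<Sum>\<theta>\<in>?A. ?H (\<i> * of_real \<theta>))
      = (\<Sum>\<theta>\<in>?A. g (cis \<theta>) * circle_symbol (cis \<theta>))"
  proof (rule sum.cong[OF refl])
    fix \<theta> assume "\<theta> \<in> ?A"
    then have "?H (Complex 0 \<theta>) = g (cis \<theta>) * circle_symbol (cis \<theta>)" by (intro H_circle) auto
    then show "?H (\<i> * of_real \<theta>) = g (cis \<theta>) * circle_symbol (cis \<theta>)" by (simp add: Complex_eq)
  qed
  moreover have "integral {ang j..ang (j + 1)} (\<lambda>\<theta>. ?H (Complex 0 \<theta>))
      = integral {ang j..ang (j + 1)} (\<lambda>\<theta>. g (cis \<theta>) * circle_symbol (cis \<theta>))"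
    by (rule integral_cong) (use H_circle in auto)
  ultimately show ?claim2
    unfolding sf(2) by simp
qed

text \<open>Sum the sector formula over all sectors. A root of unity equal to some \<open>w j\<close> belongs to no open
  arc, but the symbol vanishes there; the integrals over the arcs add up to one full period.\<close>

lemma contour_formula:
  fixes P Q :: "complex poly"
  defines "g \<equiv> \<lambda>z. poly P (inverse z) * poly Q z"
  assumes M: "M > 0"
  shows "(\<Sum>j=1..k. \<Sum>e\<in>UNIV. sector_integral j e
        (\<lambda>\<zeta>. g (exp \<zeta>) * lifted_symbol j \<zeta> * v_fun M (exp \<zeta>))) / (2 * of_real pi * \<i>)
    = (\<Sum>\<rho> | \<rho> ^ M = 1. g \<rho> * circle_symbol \<rho>) / of_nat M - circle_mean (\<lambda>z. g z * circle_symbol z)"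
proof -
  let ?G = "\<lambda>z. g z * circle_symbol z"
  let ?arc = "\<lambda>j. \<Sum>\<theta> | \<theta> \<in> {ang j<..<ang (j + 1)} \<and> cis \<theta> ^ M = 1. ?G (cis \<theta>)"
  have contG: "continuous_on (sphere 0 1) ?G"
  proof -
    have "z \<noteq> 0" if "z \<in> sphere 0 1" for z :: complex using that by auto
    then show ?thesis unfolding g_def by (intro continuous_intros continuous_circle_symbol) auto
  qed
  have last: "ang (k + 1) = ang 1 + 2 * pi" using k by (simp add: angle_def)
  have ang1: "0 \<le> ang 1" "ang 1 \<le> 2 * pi" using Arg2pi[of "w 1"] k by (auto simp: angle_def)
  have fin: "finite {\<theta>\<in>{ang 1..<ang n}. cis \<theta> ^ M = 1}" for n
  proof (rule finite_subset)
    have "ang n < ang 1 + 2 * pi \<or> n = k + 1"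
      using Arg2pi[of "w n"] Arg2pi[of "w 1"] k by (auto simp: angle_def)
    moreover have "ang n \<le> ang 1 + 2 * pi" if "n = k + 1" using last that by simp
    ultimately show "{\<theta>\<in>{ang 1..<ang n}. cis \<theta> ^ M = 1} \<subseteq> {\<theta>\<in>{ang 1..<ang 1 + 2 * pi}. cis \<theta> ^ M = 1}"
      by fastforce
    show "finite {\<theta>\<in>{ang 1..<ang 1 + 2 * pi}. cis \<theta> ^ M = 1}"
      using bij_betw_finite[OF bij_betw_cis_roots_unity[OF M, of "ang 1"]] M by (simp add: finite_roots_unity)
  qed
  have zero: "?G (cis (ang j)) = 0" if "j \<in> {1..k}" for j
  proof -
    have "cis (ang j) = w j"
      using w[OF that] that complex_norm_eq_1_exp by (simp add: angle_def cis_conv_exp)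
    then show ?thesis using circle_symbol_zero[OF that] by simp
  qed
  have roots: "(\<Sum>j=1..k. \<Sum>\<theta> | \<theta> \<in> {ang j<..<ang (j + 1)} \<and> cis \<theta> ^ M = 1. ?G (cis \<theta>))
      = (\<Sum>\<rho> | \<rho> ^ M = 1. ?G \<rho>)"
  proof -
    have "(\<Sum>j=1..k. \<Sum>\<theta> | \<theta> \<in> {ang j<..<ang (j + 1)} \<and> cis \<theta> ^ M = 1. ?G (cis \<theta>))
        = (\<Sum>\<theta> | \<theta> \<in> {ang 1..<ang (k + 1)} \<and> cis \<theta> ^ M = 1. ?G (cis \<theta>))"
      by (rule sum_arcs_roots[where s = ang and n = k and G = ?G, OF fin angle_less(1) zero])
    also have "\<dots> = (\<Sum>\<rho> | \<rho> ^ M = 1. ?G \<rho>)"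
      unfolding last by (rule sum.reindex_bij_betw[OF bij_betw_cis_roots_unity[OF M]])
    finally show ?thesis .
  qed
  have integrals: "(\<Sum>j=1..k. integral {ang j..ang (j + 1)} (\<lambda>\<theta>. ?G (cis \<theta>)))
      = integral {0..2 * pi} (\<lambda>\<theta>. ?G (cis \<theta>))"
    using integral_combine_consecutive[of "\<lambda>\<theta>. ?G (cis \<theta>)" k ang]
      continuous_on_circle_integrable[OF contG] angle_less(1)
      integral_over_period[OF contG ang1] last by (simp add: less_imp_le)
  have "(\<Sum>j=1..k. \<Sum>e\<in>UNIV. sector_integral j e
        (\<lambda>\<zeta>. g (exp \<zeta>) * lifted_symbol j \<zeta> * v_fun M (exp \<zeta>)))
      = (\<Sum>j=1..k. 2 * pi * \<i> / of_nat M * ?arc j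
        - \<i> * integral {ang j..ang (j + 1)} (\<lambda>\<theta>. ?G (cis \<theta>)))"
    unfolding g_def by (intro sum.cong refl lifted_formula(2) M)
  also have "\<dots> = 2 * pi * \<i> / of_nat M * (\<Sum>\<rho> | \<rho> ^ M = 1. ?G \<rho>) - \<i> * integral {0..2 * pi} (\<lambda>\<theta>. ?G (cis \<theta>))"
    unfolding roots[symmetric] integrals[symmetric] by (simp only: sum_subtractf sum_distrib_left)
  finally show ?thesis
    by (simp add: circle_mean_def diff_divide_distrib)
qed

text \<open>The function \<open>v f\<close> whose square root enters the kernel.\<close>

definition weight :: "nat \<Rightarrow> cpoint \<Rightarrow> complex" where
  "weight M x = v_fun M (cpt \<epsilon> k w x) * inside_limit \<epsilon> k w (ext_symbol) x"

lemma weighted_integral: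
  fixes P Q :: "complex poly"
  defines "g \<equiv> \<lambda>z. poly P (inverse z) * poly Q z"
  defines "F M \<equiv> \<lambda>x. I_fun \<epsilon> (cpt \<epsilon> k w x) * weight M x * g (cpt \<epsilon> k w x) * of_real (sigma_density \<epsilon> k w x)"
  assumes M: "M > 0"
  shows "integrable (param_measure k) (F M)"
    and "(LINT x|param_measure k. F M x)
      = (\<Sum>\<rho> | \<rho> ^ M = 1. g \<rho> * circle_symbol \<rho>) / of_nat M - circle_mean (\<lambda>z. g z * circle_symbol z)" (is ?claim2)
proof -
  let ?E = "\<lambda>j e t. g (exp (log_path j e t)) * lifted_symbol j (log_path j e t) * v_fun M (exp (log_path j e t))
      * log_deriv j e t / (2 * of_real pi * \<i>)"
  have F: "F M (j, e, t) = ?E j e t" if "j \<in> {1..k}" "t \<in> {0<..<1}" for j e t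
  proof -
    have t: "0 < t" "t < 1" using that by auto
    have "F M (j, e, t) = v_fun M (exp (log_path j e t)) * lifted_symbol j (log_path j e t) * g (exp (log_path j e t))
        * (edge_unit e * of_real (sigma_density \<epsilon> k w (j, e, t)))"
      unfolding F_def weight_def I_fun_log[OF t] inside_limit_log[OF that(1) t]
      unfolding cpt_log[OF t] by (simp only: mult_ac)
    then show ?thesis unfolding sigma_density_log[OF t] by (simp add: mult_ac)
  qed
  have int: "set_integrable lborel {0<..<1} (\<lambda>t. ?E j e t)" if "j \<in> {1..k}" for j e
    using lifted_formula(1)[OF that M, of e P Q] unfolding edge_integrable_def g_def
    by (intro set_integrable_divide) 
  have intF: "set_integrable lborel {0<..<1} (\<lambda>t. F M (j, e, t))" if "j \<in> {1..k}" for j e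
    using int[OF that, of e] by (rule set_integrable_cong[THEN iffD1, rotated -1]) (auto simp: F[OF that])
  note I = integral_param_measure[of k "F M", OF intF]
  show "integrable (param_measure k) (F M)" using I(1) by blast
  have "(LINT x|param_measure k. F M x) = (\<Sum>j=1..k. \<Sum>e\<in>UNIV. LINT t:{0<..<1}|lborel. F M (j, e, t))"
    using I(2) by blast
  also have "\<dots> = (\<Sum>j=1..k. \<Sum>e\<in>UNIV. sector_integral j e
        (\<lambda>\<zeta>. g (exp \<zeta>) * lifted_symbol j \<zeta> * v_fun M (exp \<zeta>)) / (2 * of_real pi * \<i>))"
  proof (intro sum.cong refl)
    fix j e assume j: "j \<in> {1..k}"
    have "(LINT t:{0<..<1}|lborel. F M (j, e, t)) = (LINT t:{0<..<1}|lborel. ?E j e t)"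
      by (rule set_lebesgue_integral_cong) (auto simp: F[OF j])
    then show "(LINT t:{0<..<1}|lborel. F M (j, e, t)) = sector_integral j e
        (\<lambda>\<zeta>. g (exp \<zeta>) * lifted_symbol j \<zeta> * v_fun M (exp \<zeta>)) / (2 * of_real pi * \<i>)"
      unfolding edge_integral_def by simp
  qed
  also have "\<dots> = (\<Sum>\<rho> | \<rho> ^ M = 1. g \<rho> * circle_symbol \<rho>) / of_nat M - circle_mean (\<lambda>z. g z * circle_symbol z)"
    unfolding sum_divide_distrib[symmetric] g_def by (rule contour_formula[OF M])
  finally show ?claim2 .
qed

lemma cpt_nonzero: "x \<in> space (param_measure k) \<Longrightarrow> cpt \<epsilon> k w x \<noteq> 0"
  by (cases x) (auto simp: space_param_measure cpt_log simp del: edge_log.simps)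

lemma norm_I_fun_param: "x \<in> space (param_measure k) \<Longrightarrow> cmod (I_fun \<epsilon> (cpt \<epsilon> k w x)) = 1"
  by (cases x) (auto simp: space_param_measure I_fun_log)

lemma cpt_measurable: "cpt \<epsilon> k w \<in> borel_measurable (param_measure k)"
proof (rule measurable_param_measure)
  fix j e
  have "continuous_on {0<..<1} (\<lambda>t. exp (log_path j e t))"
    by (intro continuous_intros continuous_on_subset[OF continuous_on_edge_log[OF eps]]) auto
  from continuous_Ioo_measurable[OF this]
  show "(\<lambda>t. cpt \<epsilon> k w (j, e, t)) \<in> borel_measurable unit_interval"
    by (rule measurable_cong[THEN iffD1, rotated]) (auto simp: cpt_log space_restrict_space)
qed

lemma weight_measurable: "weight M \<in> borel_measurable (param_measure k)"
proof -
  have "inside_limit \<epsilon> k w (ext_symbol) \<in> borel_measurable (param_measure k)"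
  proof (rule measurable_param_measure)
    fix j e assume j: "j \<in> {1..k}"
    have "continuous_on {0<..<1} (\<lambda>t. lifted_symbol j (log_path j e t))"
    proof (rule continuous_on_compose2[OF continuous_lifted_symbol[OF j]])
      show "continuous_on {0<..<1} (log_path j e)"
        by (rule continuous_on_subset[OF continuous_on_edge_log[OF eps]]) auto
      show "log_path j e ` {0<..<1} \<subseteq> {\<zeta>. ang j \<le> Im \<zeta> \<and> Im \<zeta> \<le> ang (j + 1)}"
        using edge_log_in_rect[OF eps less_imp_le[OF angle_less(1)[OF j]], of _ e]
        by (force simp: in_cbox_complex_iff simp del: edge_log.simps)
    qed
    from continuous_Ioo_measurable[OF this]
    show "(\<lambda>t. inside_limit \<epsilon> k w (ext_symbol) (j, e, t)) \<in> borel_measurable unit_interval"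
      by (rule measurable_cong[THEN iffD1, rotated]) (auto simp: inside_limit_log[OF j] space_restrict_space)
  qed
  then show ?thesis
    unfolding weight_def
    by (intro borel_measurable_times measurable_compose[OF cpt_measurable v_fun_measurable])
qed

lemma I_fun_measurable: "(\<lambda>x. I_fun \<epsilon> (cpt \<epsilon> k w x)) \<in> borel_measurable (param_measure k)"
proof (rule measurable_param_measure)
  fix j e
  have "(\<lambda>t. edge_unit e) \<in> borel_measurable unit_interval" by simp
  then show "(\<lambda>t. I_fun \<epsilon> (cpt \<epsilon> k w (j, e, t))) \<in> borel_measurable unit_interval"
    by (rule measurable_cong[THEN iffD1, rotated]) (auto simp: I_fun_log space_restrict_space)
qed

lemma poly_measurable [measurable]: "(\<lambda>z. poly P z :: complex) \<in> borel_measurable borel"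
  by (intro borel_measurable_continuous_onI continuous_intros)

text \<open>Since \<open>|I| = 1\<close>, the density \<open>|h|\<^sup>2\<close> with respect to \<open>|\<sigma>|\<close> is the modulus of an integrand of
  the contour formula.\<close>

lemma root_weight_L2:
  fixes P Q :: "complex poly"
  assumes M: "M > 0" and h: "h \<in> borel_measurable (param_measure k)"
    and norm: "\<And>x. x \<in> space (param_measure k) \<Longrightarrow>
      (cmod (h x))\<^sup>2 = cmod (weight M x * (poly P (inverse (cpt \<epsilon> k w x)) * poly Q (cpt \<epsilon> k w x)))"
  shows "h \<in> L2_space (sigma_var \<epsilon> k w)"
proof -
  let ?F = "\<lambda>x. I_fun \<epsilon> (cpt \<epsilon> k w x) * weight M x *
      (poly P (inverse (cpt \<epsilon> k w x)) * poly Q (cpt \<epsilon> k w x)) * of_real (sigma_density \<epsilon> k w x)"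
  have "integrable (param_measure k) (\<lambda>x. cmod (?F x))"
    by (rule integrable_norm[OF weighted_integral(1)[OF M]])
  then have "integrable (param_measure k) (\<lambda>x. \<bar>sigma_density \<epsilon> k w x\<bar> * (cmod (h x))\<^sup>2)"
    by (rule Bochner_Integration.integrable_cong[THEN iffD1, rotated -1])
       (auto simp: norm norm_mult norm_I_fun_param)
  then show ?thesis
    unfolding sigma_var_def L2_density_iff[OF sigma_density_measurable] using h by simp
qed

text \<open>In \<open>A\<^sub>m B\<^sub>l\<close> the two square roots combine to \<open>v f\<close>, and on the circle \<open>poly (map_poly cnj (\<phi> m)) (inverse z)\<close>
  is the conjugate of \<open>\<phi>\<^sub>m(z)\<close>. By the contour formula the matrix entering the Fredholm determinant is the
  Gram matrix of \<open>\<phi>\<^sub>0, \<dots>, \<phi>\<^sub>N\<^sub>-\<^sub>1\<close> for the discrete measure, whose moments are \<open>H l m\<close> below.\<close>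

theorem toeplitz_fredholm:
  assumes N: "1 \<le> N" "N \<le> M" and on: "orthonormal_polys circle_symbol \<phi>"
  defines "K \<equiv> K_kernel \<epsilon> k w (ext_symbol) M N (\<phi> N)"
  shows "trace_class_on (sigma_var \<epsilon> k w) (K_operator \<epsilon> k w K)"
    and "toeplitz_discrete M (N - 1) circle_symbol
      = toeplitz (N - 1) circle_symbol * fredholm_det (param_measure k) (sigma_density \<epsilon> k w) K"
proof -
  have M: "M > 0" using N by simp
  note f = continuous_circle_symbol
  note [measurable] = cpt_measurable weight_measurable I_fun_measurable sigma_density_measurable
  let ?\<nu> = "param_measure k" and ?\<sigma> = "sigma_density \<epsilon> k w" and ?z = "cpt \<epsilon> k w"
  define A where "A m x = I_fun \<epsilon> (?z x) * csqrt (weight M x) * poly (map_poly cnj (\<phi> m)) (inverse (?z x))" for m x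
  define B where "B m x = csqrt (weight M x) * poly (\<phi> m) (?z x)" for m x
  have K: "K x y = (\<Sum>m<N. A m x * B m y)" if xy: "x \<in> space ?\<nu>" "y \<in> space ?\<nu>" for x y
  proof -
    have "K x y = I_fun \<epsilon> (?z x) * csqrt (weight M x) * csqrt (weight M y) *
        (\<Sum>m<N. poly (map_poly cnj (\<phi> m)) (inverse (?z x)) * poly (\<phi> m) (?z y))"
      unfolding K_def K_kernel_def Let_def weight_def
        K_CD_eq_sum[OF f on cpt_nonzero[OF xy(1)] cpt_nonzero[OF xy(2)]] ..
    then show ?thesis unfolding A_def B_def sum_distrib_left by (simp only: mult_ac)
  qed
  have measA: "A m \<in> borel_measurable ?\<nu>" and measB: "B m \<in> borel_measurable ?\<nu>" for m
    unfolding A_def B_def by measurable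
  have A_L2: "A m \<in> L2_space (sigma_var \<epsilon> k w)" for m
  proof (rule root_weight_L2[OF M measA])
    fix x assume x: "x \<in> space ?\<nu>"
    have "cmod (csqrt (weight M x)) ^ 2 = cmod (weight M x)" by (simp flip: norm_power)
    then show "(cmod (A m x))\<^sup>2 = cmod (weight M x * (poly (map_poly cnj (\<phi> m) * map_poly cnj (\<phi> m)) (inverse (?z x)) * poly 1 (?z x)))"
      using norm_I_fun_param[OF x] by (simp add: A_def norm_mult power_mult_distrib power2_eq_square)
  qed
  have B_L2: "B m \<in> L2_space (sigma_var \<epsilon> k w)" for m
  proof (rule root_weight_L2[OF M measB])
    fix x assume x: "x \<in> space ?\<nu>"
    have "cmod (csqrt (weight M x)) ^ 2 = cmod (weight M x)" by (simp flip: norm_power)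
    then show "(cmod (B m x))\<^sup>2 = cmod (weight M x * (poly 1 (inverse (?z x)) * poly (\<phi> m * \<phi> m) (?z x)))"
      by (simp add: B_def norm_mult power_mult_distrib power2_eq_square)
  qed
  note AB_int = L2_density_mult_integrable[OF sigma_density_measurable, folded sigma_var_def, OF A_L2]
  have op: "K_operator \<epsilon> k w K h y = (\<Sum>m<N. (LINT x|?\<nu>. A m x * h x * of_real (?\<sigma> x)) * B m y)"
    if h: "h \<in> L2_space (sigma_var \<epsilon> k w)" and y: "y \<in> space ?\<nu>" for h y
  proof -
    have eq: "K x y * h x * of_real (?\<sigma> x) = (\<Sum>m<N. (A m x * h x * of_real (?\<sigma> x)) * B m y)"
      if "x \<in> space ?\<nu>" for x
      unfolding K[OF that y] by (simp add: sum_distrib_right sum_distrib_left mult_ac)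
    have int: "integrable ?\<nu> (\<lambda>x. \<Sum>m<N. (A m x * h x * of_real (?\<sigma> x)) * B m y)"
      by (intro Bochner_Integration.integrable_sum integrable_mult_left AB_int h)
    then have int': "integrable ?\<nu> (\<lambda>x. K x y * h x * of_real (?\<sigma> x))"
      by (rule Bochner_Integration.integrable_cong[THEN iffD1, rotated -1]) (simp_all add: eq)
    have "K_operator \<epsilon> k w K h y = (LINT x|?\<nu>. K x y * h x * of_real (?\<sigma> x))"
      unfolding K_operator_def sigma_integral_def integral_param_measure_sections[OF int'] UNIV_edge ..
    also have "\<dots> = (LINT x|?\<nu>. (\<Sum>m<N. (A m x * h x * of_real (?\<sigma> x)) * B m y))"
      by (rule Bochner_Integration.integral_cong) (simp_all add: eq)
    also have "\<dots> = (\<Sum>m<N. LINT x|?\<nu>. (A m x * h x * of_real (?\<sigma> x)) * B m y)"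
      by (intro Bochner_Integration.integral_sum integrable_mult_left AB_int h)
    finally show ?thesis by simp
  qed
  show "trace_class_on (sigma_var \<epsilon> k w) (K_operator \<epsilon> k w K)"
    unfolding sigma_var_def
    by (rule finite_rank_trace_class[where A = A and B = B and N = N, OF sigma_density_measurable];
        fold sigma_var_def; (rule A_L2 | rule B_L2 | (rule op; assumption)))
  define H where "H l m = (\<Sum>\<rho> | \<rho> ^ M = 1. \<rho> ^ m * cnj (\<rho> ^ l) * circle_symbol \<rho>) / of_nat M" for l m :: nat
  let ?F = "\<lambda>l m. circle_mean (\<lambda>z. z ^ m * cnj (z ^ l) * circle_symbol z)"
  have deg: "degree (\<phi> j) = j" for j
    using on by (simp add: orthonormal_polys_def)
  have ip: "circle_mean (\<lambda>z. poly (\<phi> j) z * cnj (poly (\<phi> l) z) * circle_symbol z) = (if j = l then 1 else 0)" for j l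
    using on by (simp add: orthonormal_polys_def circle_mean_def)
  have root_circle: "cmod \<rho> = 1" if "\<rho> ^ M = 1" for \<rho> :: complex
  proof -
    have "cmod \<rho> ^ M = 1" using that by (metis norm_power norm_one)
    then show ?thesis using M power_eq_imp_eq_base[of "cmod \<rho>" M 1] by simp
  qed
  have formH: "coeff_form H N (\<phi> l) (\<phi> m)
      = (\<Sum>\<rho> | \<rho> ^ M = 1. poly (map_poly cnj (\<phi> m)) (inverse \<rho>) * poly (\<phi> l) \<rho> * circle_symbol \<rho>) / of_nat M"
    if "l < N" "m < N" for l m
  proof -
    have d: "degree (\<phi> l) < N" "degree (\<phi> m) < N" using that by (simp_all add: deg)
    let ?g = "\<lambda>i \<rho>. cnj (coeff (\<phi> m) (fst i)) * coeff (\<phi> l) (snd i) *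
        (\<rho> ^ snd i * cnj (\<rho> ^ fst i) * circle_symbol \<rho>) / of_nat M"
    have "coeff_form H N (\<phi> l) (\<phi> m)
        = (\<Sum>i\<in>{..<N} \<times> {..<N}. cnj (coeff (\<phi> m) (fst i)) * coeff (\<phi> l) (snd i) * H (fst i) (snd i))"
      unfolding coeff_form_def sum.cartesian_product by (simp add: split_def)
    also have "\<dots> = (\<Sum>i\<in>{..<N} \<times> {..<N}. \<Sum>\<rho> | \<rho> ^ M = 1. ?g i \<rho>)"
      by (simp add: H_def sum_divide_distrib sum_distrib_left)
    also have "\<dots> = (\<Sum>\<rho> | \<rho> ^ M = 1. \<Sum>i\<in>{..<N} \<times> {..<N}. ?g i \<rho>)"
      by (rule sum.swap)
    also have "\<dots> = (\<Sum>\<rho> | \<rho> ^ M = 1. poly (\<phi> l) \<rho> * cnj (poly (\<phi> m) \<rho>) * circle_symbol \<rho> / of_nat M)"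
      by (simp only: poly_mult_cnj_expand[OF d] sum_divide_distrib)
    also have "\<dots> = (\<Sum>\<rho> | \<rho> ^ M = 1. poly (map_poly cnj (\<phi> m)) (inverse \<rho>) * poly (\<phi> l) \<rho> * circle_symbol \<rho> / of_nat M)"
      by (intro sum.cong refl) (simp only: mem_Collect_eq poly_cnj_circle[OF root_circle] mult_ac)
    finally show ?thesis by (simp only: sum_divide_distrib)
  qed
  have gram: "(if m = l then 1 else 0) + (LINT x|?\<nu>. A m x * B l x * of_real (?\<sigma> x)) = coeff_form H N (\<phi> l) (\<phi> m)"
    if "m < N" "l < N" for m l
  proof -
    let ?P = "map_poly cnj (\<phi> m)"
    have "(LINT x|?\<nu>. A m x * B l x * of_real (?\<sigma> x)) = (LINT x|?\<nu>. I_fun \<epsilon> (?z x) * weight M x *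
        (poly ?P (inverse (?z x)) * poly (\<phi> l) (?z x)) * of_real (?\<sigma> x))"
    proof (rule Bochner_Integration.integral_cong[OF refl])
      fix x
      have "A m x * B l x = I_fun \<epsilon> (?z x) * (csqrt (weight M x) * csqrt (weight M x))
          * (poly ?P (inverse (?z x)) * poly (\<phi> l) (?z x))"
        unfolding A_def B_def by (simp only: mult_ac)
      also have "csqrt (weight M x) * csqrt (weight M x) = weight M x"
        by (simp flip: power2_eq_square)
      finally have "A m x * B l x = I_fun \<epsilon> (?z x) * weight M x * (poly ?P (inverse (?z x)) * poly (\<phi> l) (?z x))" .
      then show "A m x * B l x * of_real (?\<sigma> x) = I_fun \<epsilon> (?z x) * weight M x *
        (poly ?P (inverse (?z x)) * poly (\<phi> l) (?z x)) * of_real (?\<sigma> x)" by (simp only:)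
    qed
    also have "\<dots> = coeff_form H N (\<phi> l) (\<phi> m)
        - circle_mean (\<lambda>z. poly ?P (inverse z) * poly (\<phi> l) z * circle_symbol z)"
      unfolding weighted_integral(2)[OF M] formH[OF that(2,1)] ..
    also have "circle_mean (\<lambda>z. poly ?P (inverse z) * poly (\<phi> l) z * circle_symbol z)
        = circle_mean (\<lambda>z. poly (\<phi> l) z * cnj (poly (\<phi> m) z) * circle_symbol z)"
      by (rule circle_mean_cong) (simp only: poly_cnj_circle mult_ac)
    finally show ?thesis unfolding ip by auto
  qed
  have "fredholm_det ?\<nu> ?\<sigma> K = Determinant.det (mat N N (\<lambda>(m, l). (if m = l then 1 else 0)
          + (LINT x|?\<nu>. A m x * B l x * of_real (?\<sigma> x))))"
    by (rule fredholm_det_finite_rank[OF sigma_finite_param_measure K AB_int[OF B_L2]])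
  also have "mat N N (\<lambda>(m, l). (if m = l then 1 else 0)
          + (LINT x|?\<nu>. A m x * B l x * of_real (?\<sigma> x))) = mat N N (\<lambda>(m, l). coeff_form H N (\<phi> l) (\<phi> m))"
    by (rule cong_mat) (auto simp: gram)
  finally have fred: "fredholm_det ?\<nu> ?\<sigma> K = Determinant.det (mat N N (\<lambda>(m, l). coeff_form H N (\<phi> l) (\<phi> m)))" .
  have unit_power: "z powi (- (int l - int m)) = z ^ m * cnj (z ^ l)" if "cmod z = 1" for z :: complex and l m
  proof -
    have z: "z \<noteq> 0" using that by auto
    have "z * cnj z = 1"
      using that by (simp add: complex_norm_square[symmetric])
    then have "cnj z = inverse z" by (metis inverse_unique)
    then have "cnj (z ^ l) = inverse (z ^ l)" by (simp add: power_inverse)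
    moreover have "z powi (- (int l - int m)) = z ^ m / z ^ l"
      using z by (simp add: power_int_diff)
    ultimately show ?thesis by (simp only: divide_inverse)
  qed
  have disc: "toeplitz_discrete M (N - 1) circle_symbol = Determinant.det (mat N N (\<lambda>(l, m). H l m))"
  proof -
    have "(\<Sum>z | z ^ M = 1. z powi (- (int l - int m)) * circle_symbol z) / of_nat M = H l m" for l m
      unfolding H_def by (intro arg_cong2[where f = "(/)"] sum.cong refl) (metis mem_Collect_eq root_circle unit_power)
    then show ?thesis unfolding toeplitz_discrete_def using N by simp
  qed
  have cont: "toeplitz (N - 1) circle_symbol = Determinant.det (mat N N (\<lambda>(l, m). ?F l m))"
  proof -
    have "cis (- (real l - real m) * \<theta>) = cis \<theta> ^ m * cnj (cis \<theta> ^ l)" for l m \<theta>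
      by (simp add: Complex.DeMoivre cis_cnj cis_mult algebra_simps)
    then show ?thesis unfolding toeplitz_def circle_mean_def using N by simp
  qed
  have "Determinant.det (mat N N (\<lambda>(l, m). H l m)) = Determinant.det (mat N N (\<lambda>(l, m). ?F l m))
      * Determinant.det (mat N N (\<lambda>(m, l). coeff_form H N (\<phi> l) (\<phi> m)))"
    by (rule det_moments_eq) (subst coeff_form_circle[OF f]; auto simp: deg ip)
  then show "toeplitz_discrete M (N - 1) circle_symbol = toeplitz (N - 1) circle_symbol * fredholm_det ?\<nu> ?\<sigma> K"
    unfolding disc cont fred .
qed

end

theorem proposition30:
  fixes N M p k :: nat
    and a w :: "nat \<Rightarrow> complex"
    and \<beta> :: "nat \<Rightarrow> real"
    and \<epsilon> :: real
    and \<phi> :: "nat \<Rightarrow> complex poly"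
  defines "V \<equiv> laurent_V p a"
  defines "f \<equiv> symbol_circle V k w \<beta>"
  defines "K \<equiv> K_kernel \<epsilon> k w (symbol_ext V k w \<beta>) M N (\<phi> N)"
  assumes "1 \<le> N" and "N \<le> M"
    and "1 \<le> k"
    and "\<And>j. j \<in> {1..k} \<Longrightarrow> cmod (w j) = 1"
    and "strict_mono_on {1..k} (\<lambda>j. Arg2pi (w j))"
    and "\<And>j. j \<in> {1..k} \<Longrightarrow> \<beta> j > 0"
    and "0 < \<epsilon>" and "\<epsilon> < 1"
    and "orthonormal_polys f \<phi>"
  shows "trace_class_on (sigma_var \<epsilon> k w) (K_operator \<epsilon> k w K) \<and>
         toeplitz_discrete M (N - 1) f =
           toeplitz (N - 1) f * fredholm_det (param_measure k) (sigma_density \<epsilon> k w) K"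
proof -
  interpret contour_data k w \<beta> \<epsilon> p a
    by unfold_locales (use assms in auto)
  show ?thesis
    using toeplitz_fredholm[of N M \<phi>] assms unfolding K_def f_def V_def by blast
qed

end
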